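(* There exist $p\in\mathrm{poly}$, a constant $\alpha>0$, and a classical two-prover one-round interactive proof system for the Succinct Circuit Value problem such that: (completeness) for every yes-instance $x$ there is a no-signaling strategy making the verifier accept with probability $1$; (soundness) for every no-instance $x$, every no-signaling strategy makes the verifier accept with probability at most $1-2^{-2^{p(|x|)}}$. In particular $\text{Succinct Circuit Value}\in\mathrm{MIP}^{\mathrm{ns}}_{1,1-2^{-2^{\mathrm{poly}}}}(2,1)$. Moreover, for infinitely many input strings $x$, the soundness error of this proof system on $x$ (the maximum acceptance probability over no-signaling strategies) is at least $1-2^{-2^{|x|^\alpha}}$.
   Context: $\mathrm{poly}$ is the set of functions $p\colon\mathbb{N}\to\mathbb{N}$ such that some polynomial-time deterministic Turing machine outputs $1^{p(n)}$ on input $1^n$. Succinct Circuit Value: for a Boolean circuit $C$ with gates $g_0,\dots,g_{N-1}$ of fan-in at most two, where $g_j$ is an input to $g_i$ only if $j<i$, a succinct representation is a pair $(N,D)$ where $D$ is a Boolean circuit that on input $0\le i\le N-1$ returns the kind of gate $g_i$ (ZERO, ONE, AND, OR, or NOT) and the indices of the gates feeding $g_i$. An instance is a succinct representation $(N,D)$ together with an integer $0\le k\le N-1$; the question is whether gate $g_k$ has value $1$. In a two-prover one-round interactive proof system, a randomized polynomial-time verifier, on input $x$, sends polynomial-length questions $s$ to prover Alice and $t$ to prover Bob (drawn from some distribution), receives polynomial-length answers $y$ from Alice and $z$ from Bob, and accepts with some probability $R(y,z\mid s,t)$. A strategy is a family of probability distributions $p(\cdot,\cdot\mid s,t)$ over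 answer pairs $(y,z)$ indexed by question pairs; it is no-signaling if $\sum_y p(y,z\mid s,t)=\sum_y p(y,z\mid s',t)$ for all $s,s',t,z$ and $\sum_z p(y,z\mid s,t)=\sum_z p(y,z\mid s,t')$ for all $s,t,t',y$. For $a,b\colon\mathbb{N}\to[0,1]$, $\mathrm{MIP}^{\mathrm{ns}}_{a,b}(2,1)$ is the class of promise problems $A=(A_{\mathrm{yes}},A_{\mathrm{no}})$ having such a system where for each $x\in A_{\mathrm{yes}}$ some no-signaling strategy gives acceptance probability at least $a(|x|)$, and for each $x\in A_{\mathrm{no}}$ every no-signaling strategy gives acceptance probability at most $b(|x|)$; $\mathrm{MIP}^{\mathrm{ns}}_{1,1-2^{-2^{\mathrm{poly}}}}(2,1)=\bigcup_{p\in\mathrm{poly}}\mathrm{MIP}^{\mathrm{ns}}_{1,1-2^{-2^{p}}}(2,1)$. *)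

theory Defs
  imports Complex_Main
begin

text \<open>Strings over the alphabet {0,1} are bool lists (True = 1).
  A tuple of strings is encoded self-delimitingly: every bit b is doubled to bb,
  and each component is terminated by the separator 10.\<close>

definition dbl :: "bool list \<Rightarrow> bool list" where
  "dbl w = concat (map (\<lambda>b. [b, b]) w)"

definition enc_tuple :: "bool list list \<Rightarrow> bool list" where
  "enc_tuple ws = concat (map (\<lambda>w. dbl w @ [True, False]) ws)"

fun nat_bits :: "nat \<Rightarrow> bool list" where
  "nat_bits n = (if n = 0 then [] else odd n # nat_bits (n div 2))"

definition nat_to_bits :: "nat \<Rightarrow> nat \<Rightarrow> bool list" where
  "nat_to_bits m i = map (\<lambda>j. odd (i div 2 ^ j)) [0..<m]"

definition bits_to_nat :: "bool list \<Rightarrow> nat" where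
  "bits_to_nat bs = (\<Sum>j<length bs. if bs ! j then 2 ^ j else 0)"

text \<open>Single-tape deterministic Turing machines over the tape alphabet
  {0,1,blank} (blank = None). A machine is a pair (q, \<delta>) with states
  0..q-1, start state 0 and halting state 1; \<delta> s a = (s', b, d) means:
  in state s reading a, go to state s', write b and move the head by d.\<close>

type_synonym tm = "nat \<times> (nat \<Rightarrow> bool option \<Rightarrow> nat \<times> bool option \<times> int)"
type_synonym config = "nat \<times> (int \<Rightarrow> bool option) \<times> int"

definition tm_wf :: "tm \<Rightarrow> bool" where
  "tm_wf M = (2 \<le> fst M \<and>
     (\<forall>s < fst M. \<forall>a. (case snd M s a of (s', b, d) \<Rightarrow> s' < fst M \<and> d \<in> {-1, 0, 1})))"

definition tm_step :: "tm \<Rightarrow> config \<Rightarrow> config" where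
  "tm_step M c = (case c of (s, tp, h) \<Rightarrow>
     if s = 1 then (s, tp, h)
     else (case snd M s (tp h) of (s', b, d) \<Rightarrow> (s', tp(h := b), h + d)))"

definition tm_init :: "bool list \<Rightarrow> config" where
  "tm_init x = (0, (\<lambda>i. if 0 \<le> i \<and> i < int (length x) then Some (x ! nat i) else None), 0)"

definition tm_run :: "tm \<Rightarrow> bool list \<Rightarrow> nat \<Rightarrow> config" where
  "tm_run M x t = (tm_step M ^^ t) (tm_init x)"

definition tm_halted :: "config \<Rightarrow> bool" where
  "tm_halted c = (fst c = 1)"

definition tm_output :: "config \<Rightarrow> bool list" where
  "tm_output c = (let tp = fst (snd c) in
     map (\<lambda>i. the (tp (int i))) [0..<(LEAST n. tp (int n) = None)])"

definition poly_computes_on :: "tm \<Rightarrow> bool list set \<Rightarrow> (bool list \<Rightarrow> bool list) \<Rightarrow> bool" where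
  "poly_computes_on M D f = (tm_wf M \<and> (\<exists>c k::nat. \<forall>w \<in> D. \<exists>t. t \<le> c * (length w + 1) ^ k \<and>
      tm_halted (tm_run M w t) \<and> tm_output (tm_run M w t) = f w))"

definition poly :: "(nat \<Rightarrow> nat) set" where
  "poly = {p. \<exists>M. poly_computes_on M (range (\<lambda>n. replicate n True))
                    (\<lambda>w. replicate (p (length w)) True)}"

datatype gkind = ZERO | ONE | AND | OR | NOT

definition gate_val :: "gkind \<Rightarrow> bool \<Rightarrow> bool \<Rightarrow> bool" where
  "gate_val g u v = (case g of ZERO \<Rightarrow> False | ONE \<Rightarrow> True | AND \<Rightarrow> u \<and> v
                     | OR \<Rightarrow> u \<or> v | NOT \<Rightarrow> \<not> u)"

text \<open>An ordinary Boolean circuit with m input bits: (m, gates, outs).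
  Wire w < m is input bit w, wire m + j is gate j; gate j = (g, a, b) has kind g
  and reads wires a and b (ignored if not needed), which must precede it.
  outs lists the output wires.\<close>
type_synonym circuit = "nat \<times> (gkind \<times> nat \<times> nat) list \<times> nat list"

definition circuit_wf :: "circuit \<Rightarrow> bool" where
  "circuit_wf C = (case C of (m, gs, outs) \<Rightarrow>
     (\<forall>j < length gs. case gs ! j of (g, a, b) \<Rightarrow> a < m + j \<and> b < m + j) \<and>
     (\<forall>w \<in> set outs. w < m + length gs))"

definition circuit_eval :: "circuit \<Rightarrow> bool list \<Rightarrow> bool list" where
  "circuit_eval C inp = (case C of (m, gs, outs) \<Rightarrow>
     (let ws = foldl (\<lambda>vs (g, a, b). vs @ [gate_val g (vs ! a) (vs ! b)]) inp gs
      in map (\<lambda>w. ws ! w) outs))"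

definition kind_of_code :: "nat \<Rightarrow> gkind" where
  "kind_of_code c = (if c = 0 then ZERO else if c = 1 then ONE else if c = 2 then AND
                     else if c = 3 then OR else NOT)"

definition code_of_kind :: "gkind \<Rightarrow> nat" where
  "code_of_kind g = (case g of ZERO \<Rightarrow> 0 | ONE \<Rightarrow> 1 | AND \<Rightarrow> 2 | OR \<Rightarrow> 3 | NOT \<Rightarrow> 4)"

text \<open>A succinct Circuit Value instance (N, D, k). D has m inputs (the index i in
  m-bit binary) and 3 + 2m outputs: a 3-bit kind code (0..4 for
  ZERO, ONE, AND, OR, NOT) followed by the indices of the two gates feeding g_i,
  each in m-bit binary.\<close>
type_synonym scv_instance = "nat \<times> circuit \<times> nat"

definition D_out :: "circuit \<Rightarrow> nat \<Rightarrow> bool list" where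
  "D_out D i = circuit_eval D (nat_to_bits (fst D) i)"

definition D_code :: "circuit \<Rightarrow> nat \<Rightarrow> nat" where
  "D_code D i = bits_to_nat (take 3 (D_out D i))"

definition D_in1 :: "circuit \<Rightarrow> nat \<Rightarrow> nat" where
  "D_in1 D i = bits_to_nat (take (fst D) (drop 3 (D_out D i)))"

definition D_in2 :: "circuit \<Rightarrow> nat \<Rightarrow> nat" where
  "D_in2 D i = bits_to_nat (drop (3 + fst D) (D_out D i))"

definition scv_wf :: "scv_instance \<Rightarrow> bool" where
  "scv_wf I = (case I of (N, D, k) \<Rightarrow>
     circuit_wf D \<and> length (snd (snd D)) = 3 + 2 * fst D \<and>
     1 \<le> N \<and> N \<le> 2 ^ fst D \<and> k < N \<and>
     (\<forall>i < N. D_code D i \<le> 4 \<and>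
        (kind_of_code (D_code D i) \<in> {AND, OR, NOT} \<longrightarrow> D_in1 D i < i) \<and>
        (kind_of_code (D_code D i) \<in> {AND, OR} \<longrightarrow> D_in2 D i < i)))"

fun scv_vals :: "circuit \<Rightarrow> nat \<Rightarrow> bool list" where
  "scv_vals D 0 = []"
| "scv_vals D (Suc i) = (let vs = scv_vals D i in
     vs @ [gate_val (kind_of_code (D_code D i)) (vs ! D_in1 D i) (vs ! D_in2 D i)])"

definition scv_value :: "scv_instance \<Rightarrow> bool" where
  "scv_value I = (case I of (N, D, k) \<Rightarrow> scv_vals D (Suc k) ! k)"

definition scv_enc :: "scv_instance \<Rightarrow> bool list" where
  "scv_enc I = (case I of (N, (m, gs, outs), k) \<Rightarrow>
     enc_tuple (map nat_bits ([N, k, m, length gs] @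
        concat (map (\<lambda>(g, a, b). [code_of_kind g, a, b]) gs) @ outs)))"

definition SCV_yes :: "bool list set" where
  "SCV_yes = {scv_enc I | I. scv_wf I \<and> scv_value I}"

definition SCV_no :: "bool list set" where
  "SCV_no = {scv_enc I | I. scv_wf I \<and> \<not> scv_value I}"

text \<open>A verifier (r, l, Q, Dec): on input x it draws a uniformly random string
  \<rho> of length r |x|, computes the questions (s, t) = Q x \<rho> for Alice and Bob,
  receives answers y, z of length l |x|, and accepts iff Dec x \<rho> y z.\<close>
type_synonym verifier = "(nat \<Rightarrow> nat) \<times> (nat \<Rightarrow> nat) \<times>
   (bool list \<Rightarrow> bool list \<Rightarrow> bool list \<times> bool list) \<times>
   (bool list \<Rightarrow> bool list \<Rightarrow> bool list \<Rightarrow> bool list \<Rightarrow> bool)"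

definition v_rand :: "verifier \<Rightarrow> nat \<Rightarrow> nat" where "v_rand V = fst V"
definition v_alen :: "verifier \<Rightarrow> nat \<Rightarrow> nat" where "v_alen V = fst (snd V)"
definition v_ques :: "verifier \<Rightarrow> bool list \<Rightarrow> bool list \<Rightarrow> bool list \<times> bool list" where
  "v_ques V = fst (snd (snd V))"
definition v_dec :: "verifier \<Rightarrow> bool list \<Rightarrow> bool list \<Rightarrow> bool list \<Rightarrow> bool list \<Rightarrow> bool" where
  "v_dec V = snd (snd (snd V))"

definition poly_verifier :: "verifier \<Rightarrow> bool" where
  "poly_verifier V = (v_rand V \<in> poly \<and> v_alen V \<in> poly \<and>
     (\<exists>M. poly_computes_on M
        {enc_tuple [x, \<rho>] | x \<rho>. length \<rho> = v_rand V (length x)}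
        (\<lambda>w. SOME out. \<exists>x \<rho>. w = enc_tuple [x, \<rho>] \<and> length \<rho> = v_rand V (length x) \<and>
            out = enc_tuple [fst (v_ques V x \<rho>), snd (v_ques V x \<rho>)])) \<and>
     (\<exists>M. poly_computes_on M
        {enc_tuple [x, \<rho>, y, z] | x \<rho> y z. length \<rho> = v_rand V (length x) \<and>
            length y = v_alen V (length x) \<and> length z = v_alen V (length x)}
        (\<lambda>w. SOME out. \<exists>x \<rho> y z. w = enc_tuple [x, \<rho>, y, z] \<and> length \<rho> = v_rand V (length x) \<and>
            length y = v_alen V (length x) \<and> length z = v_alen V (length x) \<and>
            out = [v_dec V x \<rho> y z])))"

definition answers :: "verifier \<Rightarrow> bool list \<Rightarrow> bool list set" where
  "answers V x = {y. length y = v_alen V (length x)}"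

definition strategy :: "verifier \<Rightarrow> bool list \<Rightarrow>
    (bool list \<Rightarrow> bool list \<Rightarrow> bool list \<Rightarrow> bool list \<Rightarrow> real) \<Rightarrow> bool" where
  "strategy V x P = (\<forall>s t. (\<forall>y \<in> answers V x. \<forall>z \<in> answers V x. 0 \<le> P s t y z) \<and>
       (\<Sum>y \<in> answers V x. \<Sum>z \<in> answers V x. P s t y z) = 1)"

definition no_signaling :: "verifier \<Rightarrow> bool list \<Rightarrow>
    (bool list \<Rightarrow> bool list \<Rightarrow> bool list \<Rightarrow> bool list \<Rightarrow> real) \<Rightarrow> bool" where
  "no_signaling V x P = (strategy V x P \<and>
     (\<forall>s s' t. \<forall>z \<in> answers V x.
        (\<Sum>y \<in> answers V x. P s t y z) = (\<Sum>y \<in> answers V x. P s' t y z)) \<and>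
     (\<forall>s t t'. \<forall>y \<in> answers V x.
        (\<Sum>z \<in> answers V x. P s t y z) = (\<Sum>z \<in> answers V x. P s t' y z)))"

definition accept_prob :: "verifier \<Rightarrow> bool list \<Rightarrow>
    (bool list \<Rightarrow> bool list \<Rightarrow> bool list \<Rightarrow> bool list \<Rightarrow> real) \<Rightarrow> real" where
  "accept_prob V x P =
     (\<Sum>\<rho> \<in> {\<rho>. length \<rho> = v_rand V (length x)}.
        \<Sum>y \<in> answers V x. \<Sum>z \<in> answers V x.
          P (fst (v_ques V x \<rho>)) (snd (v_ques V x \<rho>)) y z *
          (if v_dec V x \<rho> y z then 1 else 0)) / 2 ^ v_rand V (length x)"

end

theory Submission
  imports Defs
begin

text \<open>Alice is asked for a gate i and answers with claimed values of its two inputs; Bob is asked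
  for a gate j and answers with its claimed value. The verifier evaluates D on i and rejects if Bob
  answers 0 for j = k, or if j is i or an input of i and Bob's bit disagrees with what Alice's bits
  say about j.

  By no-signaling, Bob's marginal at every gate is well defined. If every question pair is rejected
  with probability at most d, then the probability e(i) that Bob errs at gate i satisfies
  e(i) \<le> e(a) + e(b) + 3d for the inputs a, b of i, hence e(k) < 3d 2^(k+1), whereas e(k) \<ge> 1 - d on
  a no-instance. So d is at least 2^-O(N). This doubling is attained by two parallel chains of OR
  gates over ZERO gates: at level l Bob answers 1 with probability 2^(l-M), and Alice makes her two
  bits disjoint, so that only the ZERO gates are ever caught, with probability 2^-M, where M is
  exponential in the size of D.\<close>

section \<open>Stack programs\<close>

datatype com = Skip | Push nat bool | Seq com com (infixl ";;" 60)
  | Case nat com "bool \<Rightarrow> com" | Loop nat "bool \<Rightarrow> com"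

type_synonym store = "nat \<Rightarrow> bool list"

text \<open>The number bounds the running time from above; it need not be exact.\<close>

inductive exec :: "com \<Rightarrow> store \<Rightarrow> nat \<Rightarrow> store \<Rightarrow> bool" where
  exec_Skip: "0 < t \<Longrightarrow> exec Skip R t R"
| exec_Push: "0 < t \<Longrightarrow> exec (Push r b) R t (R(r := b # R r))"
| exec_Seq: "exec c R t S \<Longrightarrow> exec d S u T \<Longrightarrow> t + u < v \<Longrightarrow> exec (c ;; d) R v T"
| exec_Case_Nil: "R r = [] \<Longrightarrow> exec c R t S \<Longrightarrow> t < v \<Longrightarrow> exec (Case r c f) R v S"
| exec_Case_Cons: "R r = b # bs \<Longrightarrow> exec (f b) (R(r := bs)) t S \<Longrightarrow> t < v
    \<Longrightarrow> exec (Case r c f) R v S"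
| exec_Loop_Nil: "R r = [] \<Longrightarrow> 0 < t \<Longrightarrow> exec (Loop r f) R t R"
| exec_Loop_Cons: "R r = b # bs \<Longrightarrow> exec (f b) (R(r := bs)) t S \<Longrightarrow> exec (Loop r f) S u T
    \<Longrightarrow> t + u < v \<Longrightarrow> exec (Loop r f) R v T"

lemma exec_mono: "exec c R t S \<Longrightarrow> t \<le> u \<Longrightarrow> exec c R u S"
  by (erule exec.cases) (auto intro: exec.intros)

lemma exec_trans [trans]: "exec c R t S \<Longrightarrow> exec d S u T \<Longrightarrow> exec (c ;; d) R (t + u + 1) T"
  by (rule exec_Seq[OF _ _ less_add_one])

primrec uses_below :: "nat \<Rightarrow> com \<Rightarrow> bool" where
  "uses_below k Skip = True"
| "uses_below k (Push r b) = (r < k)"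
| "uses_below k (c ;; d) = (uses_below k c \<and> uses_below k d)"
| "uses_below k (Case r c f) = (r < k \<and> uses_below k c \<and> (\<forall>b. uses_below k (f b)))"
| "uses_below k (Loop r f) = (r < k \<and> (\<forall>b. uses_below k (f b)))"

section \<open>Turing machines with arbitrary states\<close>

type_synonym 's transition = "'s \<Rightarrow> bool option \<Rightarrow> 's \<times> bool option \<times> int"
type_synonym 's conf = "'s \<times> (int \<Rightarrow> bool option) \<times> int"

definition machine_step :: "'s transition \<Rightarrow> 's conf \<Rightarrow> 's conf" where
  "machine_step D c
    = (case c of (s, tp, h) \<Rightarrow> case D s (tp h) of (s', b, d) \<Rightarrow> (s', tp(h := b), h + d))"

definition reaches :: "'s transition \<Rightarrow> nat \<Rightarrow> 's conf \<Rightarrow> 's conf \<Rightarrow> bool" where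
  "reaches D t c c' \<longleftrightarrow> (\<exists>t' \<le> t. (machine_step D ^^ t') c = c')"

lemma reaches_refl: "reaches D t c c"
  unfolding reaches_def by (rule exI[of _ 0]) simp

lemma reaches_trans [trans]: "reaches D t c c' \<Longrightarrow> reaches D u c' c'' \<Longrightarrow> reaches D (t + u) c c''"
  unfolding reaches_def
proof (elim exE conjE)
  fix t' u' assume "t' \<le> t" "(machine_step D ^^ t') c = c'"
    and "u' \<le> u" "(machine_step D ^^ u') c' = c''"
  then have "(machine_step D ^^ (u' + t')) c = c''" "u' + t' \<le> t + u" by (simp_all add: funpow_add)
  then show "\<exists>v\<le>t + u. (machine_step D ^^ v) c = c''" by blast
qed

lemma reaches_mono: "reaches D t c c' \<Longrightarrow> t \<le> u \<Longrightarrow> reaches D u c c'"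
  unfolding reaches_def using le_trans by blast

lemma reaches_step: "D s (tp h) = (s', b, d) \<Longrightarrow> reaches D 1 (s, tp, h) (s', tp(h := b), h + d)"
  unfolding reaches_def by (rule exI[of _ 1]) (simp add: machine_step_def)

definition tape :: "bool option list \<Rightarrow> int \<Rightarrow> bool option" where
  "tape xs = (\<lambda>i. if 0 \<le> i \<and> i < int (length xs) then xs ! nat i else None)"

definition zipper :: "'s \<Rightarrow> bool option list \<Rightarrow> bool option list \<Rightarrow> 's conf" where
  "zipper s xs ys = (s, tape (xs @ ys), int (length xs))"

lemma tape_at: "tape (xs @ a # ys) (int (length xs)) = a"
  by (auto simp: tape_def nth_append)

lemma tape_update: "(tape (xs @ a # ys))(int (length xs) := b) = tape (xs @ b # ys)"
  by (rule ext) (auto simp: tape_def nth_append nth_Cons')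

lemma tape_None [simp]: "tape (xs @ [None]) = tape xs"
  by (rule ext) (auto simp: tape_def nth_append)

lemma zipper_None [simp]: "zipper s xs [None] = zipper s xs []"
  by (simp add: zipper_def)

lemma reaches_zipper:
  assumes "D s a = (s', b, d)"
  shows "reaches D 1 (zipper s xs (a # ys)) (s', tape (xs @ b # ys), int (length xs) + d)"
  using reaches_step[of D s "tape (xs @ a # ys)" "int (length xs)"] assms
  by (simp add: zipper_def tape_at tape_update)

lemma reaches_right:
  assumes "D s a = (s', b, 1)"
  shows "reaches D 1 (zipper s xs (a # ys)) (zipper s' (xs @ [b]) ys)"
  using reaches_zipper[of D s a s' b _ xs ys] assms by (simp add: zipper_def add.commute)

lemma reaches_stay:
  assumes "D s a = (s', b, 0)"
  shows "reaches D 1 (zipper s xs (a # ys)) (zipper s' xs (b # ys))"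
  using reaches_zipper[of D s a s' b _ xs ys] assms by (simp add: zipper_def)

lemma reaches_left:
  assumes "D s a = (s', b, -1)"
  shows "reaches D 1 (zipper s (xs @ [x]) (a # ys)) (zipper s' xs (x # b # ys))"
  using reaches_zipper[of D s a s' b _ "xs @ [x]" ys] assms by (simp add: zipper_def)

lemma reaches_right_end:
  "D s None = (s', b, 1) \<Longrightarrow> reaches D 1 (zipper s xs []) (zipper s' (xs @ [b]) [])"
  using reaches_right[of D s None s' b xs "[]"] by simp

lemma reaches_stay_end:
  "D s None = (s', None, 0) \<Longrightarrow> reaches D 1 (zipper s xs []) (zipper s' xs [])"
  using reaches_stay[of D s None s' None xs "[]"] by simp

lemma tm_output_tape: "tm_output (s, tape (map Some xs @ None # ys), h) = xs"
proof -
  let ?tp = "tape (map Some xs @ None # ys)"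
  have "(LEAST n. ?tp (int n) = None) = length xs"
  proof (rule Least_equality)
    show "?tp (int (length xs)) = None" using tape_at[of "map Some xs" None ys] by simp
    fix n assume "?tp (int n) = None"
    then show "length xs \<le> n" by (rule contrapos_pp) (auto simp: tape_def nth_append)
  qed
  moreover have "map (\<lambda>i. the (?tp (int i))) [0..<length xs] = xs"
    by (rule nth_equalityI) (auto simp: tape_def nth_append)
  ultimately show ?thesis by (simp add: tm_output_def)
qed

lemma tm_run_simulates:
  fixes code :: "'s \<Rightarrow> nat"
  assumes closed: "\<And>s a. s \<in> Q \<Longrightarrow> fst (D s a) \<in> Q"
    and halting: "\<And>a. D halt a = (halt, a, 0)"
    and code: "inj_on code Q" "start \<in> Q" "halt \<in> Q" "code start = 0" "code halt = 1"
    and M: "\<And>s a. s \<in> Q \<Longrightarrow> snd M (code s) a = apfst code (D s a)"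
  shows "fst ((machine_step D ^^ t) (start, snd (tm_init x))) \<in> Q \<and>
     tm_run M x t = apfst code ((machine_step D ^^ t) (start, snd (tm_init x)))"
proof (induction t)
  case 0
  then show ?case using code by (simp add: tm_run_def tm_init_def)
next
  case (Suc t)
  obtain s tp h where now: "(machine_step D ^^ t) (start, snd (tm_init x)) = (s, tp, h)"
    by (metis prod_cases3)
  obtain s' b d where D: "D s (tp h) = (s', b, d)" by (metis prod_cases3)
  have s: "s \<in> Q" and run: "tm_run M x t = (code s, tp, h)" using Suc now by auto
  have "tm_step M (code s, tp, h) = (code s', tp(h := b), h + d)"
  proof (cases "s = halt")
    case True
    then show ?thesis using D halting[of "tp h"] code(5) by (auto simp: tm_step_def)
  next
    case False
    then have "code s \<noteq> 1" using code s by (metis inj_onD)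
    then show ?thesis using D M[OF s] by (simp add: tm_step_def)
  qed
  then have "tm_run M x (Suc t) = (code s', tp(h := b), h + d)" using run by (simp add: tm_run_def)
  moreover have "s' \<in> Q" using closed[OF s, of "tp h"] D by simp
  moreover have "machine_step D (s, tp, h) = (s', tp(h := b), h + d)"
    using D by (simp add: machine_step_def)
  ultimately show ?case using now by simp
qed

lemma tm_of_finite_machine:
  fixes D :: "'s transition"
  assumes Q: "finite Q" "start \<in> Q" "halt \<in> Q" "start \<noteq> halt"
    and closed: "\<And>s a. s \<in> Q \<Longrightarrow> fst (D s a) \<in> Q"
    and moves: "\<And>s a. snd (snd (D s a)) \<in> {-1, 0, 1}"
    and halting: "\<And>a. D halt a = (halt, a, 0)"
  obtains M where "tm_wf M"
    "\<And>x t tp h. (machine_step D ^^ t) (start, snd (tm_init x)) = (halt, tp, h)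
      \<Longrightarrow> tm_run M x t = (1, tp, h)"
proof -
  obtain rest where rest: "set rest = Q - {start, halt}" "distinct rest"
    using finite_distinct_list[of "Q - {start, halt}"] Q(1) by auto
  define states where "states = start # halt # rest"
  have states: "distinct states" "set states = Q" using rest Q by (auto simp: states_def)
  define code where "code = the_inv_into {..<length states} ((!) states)"
  have bij: "bij_betw ((!) states) {..<length states} Q" by (rule bij_betw_nth) (use states in auto)
  have code_nth: "code (states ! n) = n" if "n < length states" for n
    using that bij by (simp add: code_def the_inv_into_f_f bij_betw_imp_inj_on)
  have nth_code: "states ! code s = s" if "s \<in> Q" for s
    using that bij by (simp add: code_def f_the_inv_into_f_bij_betw)
  have code_less: "code s < length states" if "s \<in> Q" for s
    using that bij_betw_apply[OF bij_betw_the_inv_into[OF bij]] by (simp add: code_def)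
  define M :: tm where "M = (length states, \<lambda>n a. apfst code (D (states ! n) a))"
  have "code (fst (D (states ! n) a)) < length states" if "n < length states" for n a
    using code_less closed states(2) nth_mem[OF that] by auto
  then have "tm_wf M" using moves by (auto simp: tm_wf_def M_def states_def case_prod_beta)
  moreover have "tm_run M x t = (1, tp, h)"
    if "(machine_step D ^^ t) (start, snd (tm_init x)) = (halt, tp, h)" for x t tp h
  proof -
    have "code start = 0" "code halt = 1"
      using code_nth[of 0] code_nth[of 1] by (simp_all add: states_def)
    moreover have "inj_on code Q" by (metis inj_onI nth_code)
    ultimately show ?thesis
      using tm_run_simulates[of Q D halt code start M t x] closed halting Q that
      by (simp add: M_def nth_code)
  qed
  ultimately show ?thesis by (rule that)
qed

section \<open>Compiling stack programs\<close>

lemma enc_tuple_Nil [simp]: "enc_tuple [] = []"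
  and enc_tuple_Cons: "enc_tuple (w # ws) = dbl w @ [True, False] @ enc_tuple ws"
  by (simp_all add: enc_tuple_def)

lemma enc_tuple_append: "enc_tuple (vs @ ws) = enc_tuple vs @ enc_tuple ws"
  by (simp add: enc_tuple_def)

lemma dbl_simps [simp]: "dbl [] = []" "dbl (b # w) = b # b # dbl w"
  by (simp_all add: dbl_def)

lemma length_dbl [simp]: "length (dbl w) = 2 * length w"
  by (induction w) auto

lemma length_enc_tuple_empty: "length (enc_tuple (replicate e [])) = 2 * e"
  by (induction e) (auto simp: enc_tuple_Cons)

text \<open>The tape holds the encoded tuple of all registers, starting at cell 0, and a state consists of
  a phase and the list of commands still to be executed. \<open>Append\<close> adds empty registers to the input;
  \<open>Seek n\<close> skips n registers; \<open>Insert\<close> shifts the rest of the tape right by two cells to make room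
  for a pushed bit; \<open>Pop b\<close> has blanked the first of the two cells of a bit b, or the first cell of
  the separator if the register is empty, in which case \<open>Restore\<close> rewrites it; \<open>Shift\<close> closes a gap
  of two cells from the right end. When no commands are left, everything behind the output is
  discarded by blanking a single cell.\<close>

datatype phase = Start | Append nat | Append_snd nat | Ready | Seek nat | Seek_snd bool nat
  | Insert bool bool | Insert_last bool | Pop bool | Restore | To_end
  | Shift "bool option" "bool option" | Shift_last "bool option" | Rewind | Skip_cell | Cut | Halt

type_synonym state = "phase \<times> com list"

datatype output_mode = First_bit | Registers nat

fun on_empty :: "com list \<Rightarrow> com list" where
  "on_empty (Case r c f # K) = c # K"
| "on_empty K = tl K"

fun on_bit :: "bool \<Rightarrow> com list \<Rightarrow> com list" where
  "on_bit b (Case r c f # K) = f b # K"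
| "on_bit b (Loop r f # K) = f b # Loop r f # K"
| "on_bit b K = K"

fun fetch :: "output_mode \<Rightarrow> com list \<Rightarrow> state" where
  "fetch out [] = (case out of First_bit \<Rightarrow> Skip_cell | Registers n \<Rightarrow> Seek n, [])"
| "fetch out (Skip # K) = (Ready, K)"
| "fetch out ((c ;; d) # K) = (Ready, c # d # K)"
| "fetch out (Push r b # K) = (Seek r, Push r b # K)"
| "fetch out (Case r c f # K) = (Seek r, Case r c f # K)"
| "fetch out (Loop r f # K) = (Seek r, Loop r f # K)"

fun operate :: "com list \<Rightarrow> bool option \<Rightarrow> state \<times> bool option \<times> int" where
  "operate [] a = ((Cut, []), a, 0)"
| "operate (Push r b # K) a = ((Insert b b, K), a, 0)"
| "operate K a = ((Pop (a = Some True), K), None, 1)"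

fun delta :: "output_mode \<Rightarrow> nat \<Rightarrow> state transition" where
  "delta out e (Start, K) a = (if a = None then ((Append e, K), None, 0) else ((Start, K), a, 1))"
| "delta out e (Append 0, K) a = ((Rewind, K), a, -1)"
| "delta out e (Append (Suc n), K) a = ((Append_snd n, K), Some True, 1)"
| "delta out e (Append_snd n, K) a = ((Append n, K), Some False, 1)"
| "delta out e (Ready, K) a = (fetch out K, a, 0)"
| "delta out e (Seek 0, K) a = operate K a"
| "delta out e (Seek (Suc n), K) a = ((Seek_snd (a = Some True) n, K), a, 1)"
| "delta out e (Seek_snd b n, K) a = ((Seek (if a = Some b then Suc n else n), K), a, 1)"
| "delta out e (Insert b c, K) a = (case a of Some d \<Rightarrow> ((Insert c d, K), Some b, 1)
     | None \<Rightarrow> ((Insert_last c, K), Some b, 1))"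
| "delta out e (Insert_last c, K) a = ((Rewind, K), Some c, -1)"
| "delta out e (Pop b, K) a =
     (if a = Some b then ((To_end, on_bit b K), None, 1) else ((Restore, on_empty K), a, -1))"
| "delta out e (Restore, K) a = ((Rewind, K), Some True, -1)"
| "delta out e (To_end, K) a =
     (if a = None then ((Shift None None, K), None, -1) else ((To_end, K), a, 1))"
| "delta out e (Shift x y, K) a = (case a of Some d \<Rightarrow> ((Shift y (Some d), K), x, -1)
     | None \<Rightarrow> ((Shift_last y, K), x, -1))"
| "delta out e (Shift_last y, K) a = ((Rewind, K), y, -1)"
| "delta out e (Rewind, K) a = (if a = None then ((Ready, K), None, 1) else ((Rewind, K), a, -1))"
| "delta out e (Skip_cell, K) a = ((Cut, K), a, 1)"
| "delta out e (Cut, K) a = ((Halt, []), None, 0)"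
| "delta out e (Halt, K) a = ((Halt, K), a, 0)"

lemma reaches_Rewind:
  assumes "n \<le> length zs"
  shows "reaches (delta out e) (n + 1) ((Rewind, K), tape (map Some zs), int n - 1)
     (zipper (Ready, K) [] (map Some zs))"
  using assms
proof (induction n)
  case 0
  have "tape (map Some zs) (-1) = None" by (simp add: tape_def)
  then show ?case
    using reaches_step[of "delta out e" "(Rewind, K)" "tape (map Some zs)" "-1"]
    by (simp add: zipper_def fun_upd_idem)
next
  case (Suc n)
  then have "tape (map Some zs) (int n) = Some (zs ! n)" by (simp add: tape_def)
  then have "reaches (delta out e) 1 ((Rewind, K), tape (map Some zs), int (Suc n) - 1)
      ((Rewind, K), tape (map Some zs), int n - 1)"
    using reaches_step[of "delta out e" "(Rewind, K)" "tape (map Some zs)" "int n"]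
    by (simp add: fun_upd_idem)
  also have "reaches (delta out e) (n + 1) \<dots> (zipper (Ready, K) [] (map Some zs))" using Suc by simp
  finally show ?case by simp
qed

lemma reaches_Seek_register:
  "reaches (delta out e) (2 * length w + 2)
     (zipper (Seek (Suc n), K) xs (map Some (dbl w @ [True, False]) @ ys))
     (zipper (Seek n, K) (xs @ map Some (dbl w @ [True, False])) ys)" (is "reaches ?D _ _ _")
proof (induction w arbitrary: xs)
  case Nil
  have "reaches ?D 1 (zipper (Seek (Suc n), K) xs (map Some [True, False] @ ys))
      (zipper (Seek_snd True n, K) (xs @ [Some True]) (Some False # ys))"
    using reaches_right[of ?D "(Seek (Suc n), K)" "Some True"] by simp
  also have "reaches ?D 1 \<dots> (zipper (Seek n, K) ((xs @ [Some True]) @ [Some False]) ys)"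
    by (rule reaches_right) simp
  finally show ?case by simp
next
  case (Cons b w)
  let ?ys = "map Some (dbl w @ [True, False]) @ ys"
  have "reaches ?D 1 (zipper (Seek (Suc n), K) xs (Some b # Some b # ?ys))
      (zipper (Seek_snd b n, K) (xs @ [Some b]) (Some b # ?ys))"
    by (rule reaches_right) simp
  also have "reaches ?D 1 \<dots> (zipper (Seek (Suc n), K) ((xs @ [Some b]) @ [Some b]) ?ys)"
    by (rule reaches_right) simp
  also note Cons.IH
  finally show ?case by simp
qed

lemma reaches_Seek:
  "reaches (delta out e) (length (enc_tuple ws))
     (zipper (Seek (length ws), K) xs (map Some (enc_tuple ws) @ ys))
     (zipper (Seek 0, K) (xs @ map Some (enc_tuple ws)) ys)" (is "reaches ?D _ _ _")
proof (induction ws arbitrary: xs)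
  case Nil
  then show ?case by (simp add: reaches_refl)
next
  case (Cons w ws)
  have "reaches ?D (2 * length w + 2)
     (zipper (Seek (Suc (length ws)), K) xs
        (map Some (dbl w @ [True, False]) @ map Some (enc_tuple ws) @ ys))
     (zipper (Seek (length ws), K) (xs @ map Some (dbl w @ [True, False]))
        (map Some (enc_tuple ws) @ ys))"
    by (rule reaches_Seek_register)
  also note Cons.IH
  finally show ?case by (simp add: enc_tuple_Cons)
qed

lemma reaches_Insert:
  "reaches (delta out e) (length ds + 2) (zipper (Insert b c, K) (map Some xs) (map Some ds))
     ((Rewind, K), tape (map Some (xs @ b # c # ds)), int (length xs + length ds))"
    (is "reaches ?D _ _ _")
proof (induction ds arbitrary: xs b c)
  case Nil
  have "reaches ?D 1 (zipper (Insert b c, K) (map Some xs) [])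
      (zipper (Insert_last c, K) (map Some xs @ [Some b]) [])"
    by (rule reaches_right_end) simp
  also have "reaches ?D 1 \<dots> ((Rewind, K), tape (map Some (xs @ [b, c])), int (length xs))"
    using reaches_zipper[of ?D "(Insert_last c, K)" None _ _ _ "map Some xs @ [Some b]" "[]"]
    by simp
  finally show ?case by simp
next
  case (Cons d ds)
  have "reaches ?D 1 (zipper (Insert b c, K) (map Some xs) (map Some (d # ds)))
      (zipper (Insert c d, K) (map Some (xs @ [b])) (map Some ds))"
    using reaches_right[of ?D "(Insert b c, K)" "Some d"] by simp
  also note Cons.IH
  finally show ?case by simp
qed

lemma reaches_To_end:
  "reaches (delta out e) (length ds + 1) (zipper (To_end, K) xs (map Some ds))
     ((Shift None None, K), tape (xs @ map Some ds), int (length xs + length ds) - 1)"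
    (is "reaches ?D _ _ _")
proof (induction ds arbitrary: xs)
  case Nil
  show ?case using reaches_zipper[of ?D "(To_end, K)" None _ _ _ xs "[]"] by simp
next
  case (Cons d ds)
  have "reaches ?D 1 (zipper (To_end, K) xs (map Some (d # ds)))
      (zipper (To_end, K) (xs @ [Some d]) (map Some ds))"
    using reaches_right[of ?D "(To_end, K)" "Some d"] by simp
  also note Cons.IH
  finally show ?case by simp
qed

lemma reaches_Shift:
  "reaches (delta out e) (length ds + 2)
     ((Shift u v, K), tape (xs @ [None, None] @ map Some ds @ ys),
        int (length xs + 2 + length ds) - 1)
     ((Rewind, K), tape (xs @ map Some ds @ v # u # ys), int (length xs) - 1)"
    (is "reaches ?D _ _ _")
proof (induction ds arbitrary: u v ys rule: rev_induct)
  case Nil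
  have "reaches ?D 1 ((Shift u v, K), tape (xs @ [None, None] @ ys), int (length xs + 2) - 1)
      (zipper (Shift_last v, K) xs (None # u # ys))"
    using reaches_left[of ?D "(Shift u v, K)" None _ _ xs None ys] by (simp add: zipper_def)
  also have "reaches ?D 1 \<dots> ((Rewind, K), tape (xs @ v # u # ys), int (length xs) - 1)"
    using reaches_zipper[of ?D "(Shift_last v, K)" None _ _ _ xs "u # ys"] by simp
  finally show ?case by simp
next
  case (snoc d ds)
  have "reaches ?D 1
      ((Shift u v, K), tape (xs @ [None, None] @ map Some (ds @ [d]) @ ys),
         int (length xs + 2 + length (ds @ [d])) - 1)
      ((Shift v (Some d), K), tape (xs @ [None, None] @ map Some ds @ u # ys),
         int (length xs + 2 + length ds) - 1)"
    using reaches_zipper[of ?D "(Shift u v, K)" "Some d" _ _ _ "xs @ [None, None] @ map Some ds" ys]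
    by (simp add: zipper_def algebra_simps)
  also note snoc.IH
  finally show ?case by simp
qed

definition enc_store :: "nat \<Rightarrow> store \<Rightarrow> bool list" where
  "enc_store k R = enc_tuple (map R [0..<k])"

definition ready :: "nat \<Rightarrow> com list \<Rightarrow> store \<Rightarrow> state conf" where
  "ready k K R = zipper (Ready, K) [] (map Some (enc_store k R))"

lemma enc_store_split:
  assumes "r < k"
  shows "enc_store k R
      = enc_tuple (map R [0..<r]) @ dbl (R r) @ [True, False] @ enc_tuple (map R [Suc r..<k])"
proof -
  have "[0..<k] = [0..<r] @ r # [Suc r..<k]"
    using assms by (metis le_add_diff_inverse less_imp_le_nat upt_add_eq_append upt_conv_Cons
        zero_le)
  then show ?thesis by (simp add: enc_store_def enc_tuple_append enc_tuple_Cons)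
qed

lemma enc_store_update:
  assumes "r < k"
  shows "enc_store k (R(r := w))
      = enc_tuple (map R [0..<r]) @ dbl w @ [True, False] @ enc_tuple (map R [Suc r..<k])"
proof -
  have "map (R(r := w)) [0..<r] = map R [0..<r]" "map (R(r := w)) [Suc r..<k] = map R [Suc r..<k]"
    by auto
  then show ?thesis by (simp add: enc_store_split[OF assms])
qed

lemma length_enc_store_update:
  "r < k \<Longrightarrow> length (enc_store k (R(r := w))) + 2 * length (R r)
    = length (enc_store k R) + 2 * length w"
  using enc_store_split[of r k R] enc_store_update[of r k R w] by simp

lemma reaches_fetch:
  assumes "fetch out K = (ph, L)"
  shows "reaches (delta out e) 1 (ready k K R) (zipper (ph, L) [] (map Some (enc_store k R)))"
proof (cases "enc_store k R")
  case Nil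
  then show ?thesis
    using assms reaches_stay_end[of "delta out e" "(Ready, K)"] by (simp add: ready_def)
next
  case (Cons a as)
  then show ?thesis
    using assms reaches_stay[of "delta out e" "(Ready, K)" "Some a"] by (simp add: ready_def)
qed

lemma reaches_fetch_Seek:
  assumes "r < k" "fetch out K = (Seek r, K)"
  shows "reaches (delta out e) (1 + length (enc_tuple (map R [0..<r]))) (ready k K R)
     (zipper (Seek 0, K) (map Some (enc_tuple (map R [0..<r])))
       (map Some (dbl (R r) @ [True, False] @ enc_tuple (map R [Suc r..<k]))))"
proof -
  note reaches_fetch[OF assms(2), of e k R]
  also have "reaches (delta out e) (length (enc_tuple (map R [0..<r])))
      (zipper (Seek r, K) [] (map Some (enc_store k R)))
      (zipper (Seek 0, K) (map Some (enc_tuple (map R [0..<r])))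
        (map Some (dbl (R r) @ [True, False] @ enc_tuple (map R [Suc r..<k]))))"
    using reaches_Seek[of out e "map R [0..<r]" K "[]"]
    unfolding enc_store_split[OF assms(1)] by simp
  finally show ?thesis .
qed

lemma reaches_Push:
  assumes "r < k" "length (enc_store k R) \<le> M"
  shows "reaches (delta out e) (4 * M + 20) (ready k (Push r b # K) R)
      (ready k K (R(r := b # R r)))"
    (is "reaches ?D _ _ _")
proof -
  let ?pre = "enc_tuple (map R [0..<r])"
  let ?post = "dbl (R r) @ [True, False] @ enc_tuple (map R [Suc r..<k])"
  have result: "enc_store k (R(r := b # R r)) = ?pre @ b # b # ?post"
    using enc_store_update[OF assms(1)] by simp
  have "reaches ?D (1 + length ?pre) (ready k (Push r b # K) R)
      (zipper (Seek 0, Push r b # K) (map Some ?pre) (map Some ?post))"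
    by (rule reaches_fetch_Seek[OF assms(1)]) simp
  also have "reaches ?D 1 \<dots> (zipper (Insert b b, K) (map Some ?pre) (map Some ?post))"
  proof -
    obtain a as where "map Some ?post = a # as" by (cases "R r") auto
    then show ?thesis using reaches_stay[of ?D "(Seek 0, Push r b # K)" a] by simp
  qed
  also have "reaches ?D (length ?post + 2) \<dots>
      ((Rewind, K), tape (map Some (?pre @ b # b # ?post)), int (length ?pre + length ?post))"
    by (rule reaches_Insert)
  also have "reaches ?D (length ?pre + length ?post + 2) \<dots> (ready k K (R(r := b # R r)))"
    using reaches_Rewind[of "length ?pre + length ?post + 1" "?pre @ b # b # ?post"]
    by (simp add: ready_def result)
  finally show ?thesis
    by (rule reaches_mono) (use assms(2) in \<open>simp add: enc_store_split[OF assms(1)]\<close>)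
qed

definition pops :: "nat \<Rightarrow> com list \<Rightarrow> bool" where
  "pops r K \<longleftrightarrow> (\<exists>c f L. K = Case r c f # L \<or> K = Loop r f # L)"

lemma pops_simps [simp]: "pops r (Case r c f # K)" "pops r (Loop r f # K)"
  by (auto simp: pops_def)

lemma pops_fetch: "pops r K \<Longrightarrow> fetch out K = (Seek r, K)"
  and pops_operate: "pops r K \<Longrightarrow> operate K a = ((Pop (a = Some True), K), None, 1)"
  by (auto simp: pops_def)

lemma reaches_pop_Nil:
  assumes "r < k" "pops r K" "R r = []" "length (enc_store k R) \<le> M"
  shows "reaches (delta out e) (4 * M + 20) (ready k K R) (ready k (on_empty K) R)"
    (is "reaches ?D _ _ _")
proof -
  let ?pre = "enc_tuple (map R [0..<r])"
  let ?post = "enc_tuple (map R [Suc r..<k])"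
  have store: "enc_store k R = ?pre @ True # False # ?post"
    using enc_store_split[OF assms(1), of R] assms(3) by simp
  have "reaches ?D (1 + length ?pre) (ready k K R)
      (zipper (Seek 0, K) (map Some ?pre) (Some True # Some False # map Some ?post))"
    using reaches_fetch_Seek[OF assms(1) pops_fetch[OF assms(2)], of out e R] assms(3) by simp
  also have "reaches ?D 1 \<dots>
      (zipper (Pop True, K) (map Some ?pre @ [None]) (Some False # map Some ?post))"
    by (rule reaches_right) (simp add: pops_operate[OF assms(2)])
  also have "reaches ?D 1 \<dots>
      (zipper (Restore, on_empty K) (map Some ?pre) (None # Some False # map Some ?post))"
    by (rule reaches_left) simp
  also have "reaches ?D 1 \<dots>
      ((Rewind, on_empty K), tape (map Some (enc_store k R)), int (length ?pre) - 1)"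
    using reaches_zipper[of ?D "(Restore, on_empty K)" None _ _ _ "map Some ?pre"
        "Some False # map Some ?post"]
    by (simp add: store)
  also have "reaches ?D (length ?pre + 1) \<dots> (ready k (on_empty K) R)"
    unfolding ready_def by (rule reaches_Rewind) (simp add: store)
  finally show ?thesis by (rule reaches_mono) (use assms(4) in \<open>simp add: store\<close>)
qed

lemma reaches_pop_Cons:
  assumes "r < k" "pops r K" "R r = b # bs" "length (enc_store k R) \<le> M"
  shows "reaches (delta out e) (4 * M + 20) (ready k K R) (ready k (on_bit b K) (R(r := bs)))"
    (is "reaches ?D _ _ _")
proof -
  let ?pre = "enc_tuple (map R [0..<r])"
  let ?post = "dbl bs @ [True, False] @ enc_tuple (map R [Suc r..<k])"
  have result: "enc_store k (R(r := bs)) = ?pre @ ?post" by (rule enc_store_update[OF assms(1)])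
  have "reaches ?D (1 + length ?pre) (ready k K R)
      (zipper (Seek 0, K) (map Some ?pre) (Some b # Some b # map Some ?post))"
    using reaches_fetch_Seek[OF assms(1) pops_fetch[OF assms(2)], of out e R] assms(3) by simp
  also have "reaches ?D 1 \<dots> (zipper (Pop b, K) (map Some ?pre @ [None]) (Some b # map Some ?post))"
    by (rule reaches_right) (simp add: pops_operate[OF assms(2)])
  also have "reaches ?D 1 \<dots>
      (zipper (To_end, on_bit b K) ((map Some ?pre @ [None]) @ [None]) (map Some ?post))"
    by (rule reaches_right) simp
  also have "reaches ?D (length ?post + 1) \<dots>
      ((Shift None None, on_bit b K), tape (map Some ?pre @ [None, None] @ map Some ?post @ []),
        int (length (map Some ?pre) + 2 + length ?post) - 1)"
    using reaches_To_end[of out e ?post "on_bit b K" "(map Some ?pre @ [None]) @ [None]"] by simp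
  also have "reaches ?D (length ?post + 2) \<dots>
      ((Rewind, on_bit b K), tape (map Some ?pre @ map Some ?post @ [None, None]),
         int (length (map Some ?pre)) - 1)"
    by (rule reaches_Shift)
  also have "tape (map Some ?pre @ map Some ?post @ [None, None])
      = tape (map Some (enc_store k (R(r := bs))))"
    using tape_None[of "map Some ?pre @ map Some ?post @ [None]"]
        tape_None[of "map Some ?pre @ map Some ?post"]
    by (simp add: result)
  also have "reaches ?D (length ?pre + 1)
      ((Rewind, on_bit b K), tape (map Some (enc_store k (R(r := bs)))),
         int (length (map Some ?pre)) - 1)
      (ready k (on_bit b K) (R(r := bs)))"
    unfolding ready_def length_map by (rule reaches_Rewind) (simp add: result)
  finally show ?thesis by (rule reaches_mono)
    (use assms(4) in \<open>simp add: enc_store_split[OF assms(1)] assms(3)\<close>)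
qed

lemma exec_length:
  assumes "exec c R t S" "uses_below k c"
  shows "length (enc_store k S) \<le> length (enc_store k R) + 2 * t"
  using assms
proof (induction rule: exec.induct)
  case (exec_Push t r b R)
  then show ?case using length_enc_store_update[of r k R "b # R r"] by (simp add: fun_upd_def)
next
  case (exec_Case_Cons R r b bs f t S v c)
  then show ?case using length_enc_store_update[of r k R bs] by (simp add: fun_upd_def)
next
  case (exec_Loop_Cons R r b bs f t S u T v)
  then show ?case using length_enc_store_update[of r k R bs] by (simp add: fun_upd_def)
qed auto

lemma length_enc_store_pop:
  "r < k \<Longrightarrow> R r = b # bs \<Longrightarrow> length (enc_store k (R(r := bs))) \<le> length (enc_store k R)"
  using length_enc_store_update[of r k R bs] by simp

lemma reaches_mult_mono:
  assumes "reaches D w c c'" "w \<le> (u + 1) * B" "u < v"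
  shows "reaches D (v * B) c c'"
proof (rule reaches_mono[OF assms(1)])
  have "(u + 1) * B \<le> v * B" using assms(3) by (intro mult_right_mono) simp_all
  then show "w \<le> v * B" using assms(2) by simp
qed

theorem exec_reaches:
  assumes "exec c R t S" "uses_below k c" "length (enc_store k R) + 2 * t \<le> M"
  shows "reaches (delta out e) (t * (4 * M + 20)) (ready k (c # K) R) (ready k K S)"
    (is "reaches ?D (_ * ?B) _ _")
  using assms
proof (induction arbitrary: K rule: exec.induct)
  case (exec_Skip t R)
  have "reaches ?D 1 (ready k (Skip # K) R) (ready k K R)"
    unfolding ready_def[of k K] by (rule reaches_fetch) simp
  then show ?case by (rule reaches_mult_mono) (use exec_Skip in auto)
next
  case (exec_Push t r b R)
  have "reaches ?D ?B (ready k (Push r b # K) R) (ready k K (R(r := b # R r)))"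
    using exec_Push by (intro reaches_Push) auto
  then show ?case by (rule reaches_mult_mono[where u = 0]) (use exec_Push in auto)
next
  case (exec_Seq c R t S d u T v)
  have "reaches ?D 1 (ready k ((c ;; d) # K) R) (ready k (c # d # K) R)"
    unfolding ready_def[of k "c # d # K"] by (rule reaches_fetch) simp
  also have "reaches ?D (t * ?B) \<dots> (ready k (d # K) S)" using exec_Seq by simp
  also have "reaches ?D (u * ?B) \<dots> (ready k K T)"
    using exec_Seq exec_length[OF exec_Seq(1), of k] by simp
  finally show ?case
    by (rule reaches_mult_mono[where u = "t + u"]) (use exec_Seq in \<open>auto simp: algebra_simps\<close>)
next
  case (exec_Case_Nil R r c t S v f)
  have "reaches ?D ?B (ready k (Case r c f # K) R) (ready k (c # K) R)"
    using reaches_pop_Nil[of r k "Case r c f # K" R] exec_Case_Nil by simp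
  also have "reaches ?D (t * ?B) \<dots> (ready k K S)" using exec_Case_Nil by simp
  finally show ?case by (rule reaches_mult_mono[where u = t]) (use exec_Case_Nil in auto)
next
  case (exec_Case_Cons R r b bs f t S v c)
  have "reaches ?D ?B (ready k (Case r c f # K) R) (ready k (f b # K) (R(r := bs)))"
    using reaches_pop_Cons[of r k "Case r c f # K" R b bs] exec_Case_Cons by simp
  also have "reaches ?D (t * ?B) \<dots> (ready k K S)"
    using exec_Case_Cons length_enc_store_pop[of r k R b bs] by (simp add: fun_upd_def)
  finally show ?case by (rule reaches_mult_mono[where u = t]) (use exec_Case_Cons in auto)
next
  case (exec_Loop_Nil R r t f)
  then have "reaches ?D ?B (ready k (Loop r f # K) R) (ready k K R)"
    using reaches_pop_Nil[of r k "Loop r f # K" R] by simp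
  then show ?case by (rule reaches_mult_mono[where u = 0]) (use exec_Loop_Nil in auto)
next
  case (exec_Loop_Cons R r b bs f t S u T v)
  have "reaches ?D ?B (ready k (Loop r f # K) R) (ready k (f b # Loop r f # K) (R(r := bs)))"
    using reaches_pop_Cons[of r k "Loop r f # K" R b bs] exec_Loop_Cons by simp
  also have "reaches ?D (t * ?B) \<dots> (ready k (Loop r f # K) S)"
    using exec_Loop_Cons length_enc_store_pop[of r k R b bs] by (simp add: fun_upd_def)
  also have "reaches ?D (u * ?B) \<dots> (ready k K T)"
    using exec_Loop_Cons length_enc_store_pop[of r k R b bs] exec_length[OF exec_Loop_Cons(2), of k]
    by (simp add: fun_upd_def)
  finally show ?case
    by (rule reaches_mult_mono[where u = "t + u"])
      (use exec_Loop_Cons in \<open>auto simp: algebra_simps\<close>)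
qed

primrec continuations :: "com \<Rightarrow> com list \<Rightarrow> com list set" where
  "continuations Skip K = {Skip # K}"
| "continuations (Push r b) K = {Push r b # K}"
| "continuations (c ;; d) K = insert ((c ;; d) # K) (continuations c (d # K) \<union> continuations d K)"
| "continuations (Case r c f) K
    = insert (Case r c f # K) (continuations c K \<union> (\<Union>b. continuations (f b) K))"
| "continuations (Loop r f) K = insert (Loop r f # K) (\<Union>b. continuations (f b) (Loop r f # K))"

lemma finite_continuations: "finite (continuations c K)"
  by (induction c arbitrary: K) auto

lemma continuations_self: "c # K \<in> continuations c K"
  by (cases c) auto

definition successors :: "output_mode \<Rightarrow> com list \<Rightarrow> com list set" where
  "successors out L = {snd (fetch out L), on_empty L} \<union> range (\<lambda>b. on_bit b L)"

lemma successors_continuations: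
  "L \<in> continuations c K \<Longrightarrow> successors out L \<subseteq> insert K (continuations c K)"
proof (induction c arbitrary: K)
  case (Seq c d)
  have "successors out ((c ;; d) # K) \<subseteq> continuations (c ;; d) K \<union> {K}"
    using continuations_self[of c] by (auto simp: successors_def)
  moreover have "d # K \<in> continuations (c ;; d) K" using continuations_self by simp
  ultimately show ?case using Seq.prems Seq.IH(1)[of "d # K"] Seq.IH(2)[of K] by auto
next
  case (Case r c f)
  have "successors out (Case r c f # K) \<subseteq> continuations (Case r c f) K \<union> {K}"
    using continuations_self[of _ K] by (auto simp: successors_def)
  then show ?case using Case.prems Case.IH(1)[of K] Case.IH(2)[OF rangeI, of _ K] by fastforce
next
  case (Loop r f)
  have "successors out (Loop r f # K) \<subseteq> continuations (Loop r f) K \<union> {K}"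
    using continuations_self[of _ "Loop r f # K"] by (auto simp: successors_def)
  then show ?case using Loop.prems Loop.IH[OF rangeI, of _ "Loop r f # K"] by fastforce
qed (auto simp: successors_def)

text \<open>The counters that occur in the reachable phases are bounded by the number of registers.\<close>

fun counter :: "phase \<Rightarrow> nat" where
  "counter (Append n) = n"
| "counter (Append_snd n) = n"
| "counter (Seek n) = n"
| "counter (Seek_snd b n) = Suc n"
| "counter ph = 0"

lemma finite_phases: "finite {ph. counter ph \<le> k}"
proof (rule finite_subset)
  let ?phases = "\<Union>n\<le>k. \<Union>b c. \<Union>u v. {Start, Append n, Append_snd n, Ready, Seek n, Seek_snd b n,
    Insert b c, Insert_last b, Pop b, Restore, To_end, Shift u v, Shift_last u, Rewind, Skip_cell,
    Cut, Halt}"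
  show "{ph. counter ph \<le> k} \<subseteq> ?phases"
  proof
    fix ph assume "ph \<in> {ph. counter ph \<le> k}"
    then show "ph \<in> ?phases" by (cases ph) auto
  qed
qed simp

lemma delta_closed:
  assumes "counter ph \<le> k" "K \<in> C" "e \<le> k" "[] \<in> C" "successors out K \<subseteq> C"
    and "counter (fst (fetch out K)) \<le> k"
  shows "fst (delta out e (ph, K) a) \<in> {ph. counter ph \<le> k} \<times> C"
proof -
  have "snd (fetch out K) \<in> C" "on_empty K \<in> C" "on_bit b K \<in> C" for b
    using assms(5) by (auto simp: successors_def)
  moreover from this have "fst (operate K a) \<in> {ph. counter ph \<le> k} \<times> C"
    by (cases "(K, a)" rule: operate.cases) (use assms in auto)
  moreover note assms
  ultimately show ?thesis
    by (cases ph; cases "counter ph") (auto simp: mem_Times_iff split: option.split)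
qed

lemma tm_of_stack_program:
  obtains M where "tm_wf M"
    "\<And>x t tp h. (machine_step (delta out e) ^^ t) ((Start, [p]), snd (tm_init x))
      = ((Halt, []), tp, h) \<Longrightarrow> tm_run M x t = (1, tp, h)"
proof -
  let ?C = "insert [] (continuations p [])"
  have closed: "successors out L \<subseteq> ?C" if "L \<in> ?C" for L
    using that successors_continuations[of L p "[]" out] by (auto simp: successors_def)
  have finite: "finite (insert e ((\<lambda>L. counter (fst (fetch out L))) ` ?C))"
    by (simp add: finite_continuations)
  then obtain k where k: "e \<le> k" "\<And>L. L \<in> ?C \<Longrightarrow> counter (fst (fetch out L)) \<le> k"
    unfolding finite_nat_set_iff_bounded_le by blast
  have "snd (snd (operate K a)) \<in> {-1, 0, 1}" for K a
    by (cases "(K, a)" rule: operate.cases) auto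
  then have moves: "snd (snd (delta out e s a)) \<in> {-1, 0, 1}" for s a
    by (cases "(out, e, s, a)" rule: delta.cases) (auto split: option.split)
  show ?thesis
  proof (rule tm_of_finite_machine[of
        "{ph. counter ph \<le> k} \<times> ?C" "(Start, [p])" "(Halt, [])" "delta out e"])
    show "finite ({ph. counter ph \<le> k} \<times> ?C)" by (simp add: finite_phases finite_continuations)
    show "fst (delta out e s a) \<in> {ph. counter ph \<le> k} \<times> ?C"
      if "s \<in> {ph. counter ph \<le> k} \<times> ?C" for s a
      using delta_closed[of "fst s" k "snd s" ?C e out a] that closed[of "snd s"] k
      by (auto simp: mem_Times_iff)
  qed (use that moves continuations_self in auto)
qed

definition init_store :: "bool list list \<Rightarrow> store" where
  "init_store ws = (\<lambda>i. if i < length ws then ws ! i else [])"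

lemma enc_store_init: "enc_store (length ws + e) (init_store ws) = enc_tuple (ws @ replicate e [])"
  unfolding enc_store_def init_store_def
  by (intro arg_cong[of _ _ enc_tuple] nth_equalityI) (auto simp: nth_append)

lemma reaches_Start:
  "reaches (delta out e) (length ds + 1) (zipper (Start, K) xs (map Some ds))
     (zipper (Append e, K) (xs @ map Some ds) [])" (is "reaches ?D _ _ _")
proof (induction ds arbitrary: xs)
  case Nil
  show ?case using reaches_stay_end[of ?D "(Start, K)"] by simp
next
  case (Cons d ds)
  have "reaches ?D 1 (zipper (Start, K) xs (map Some (d # ds)))
      (zipper (Start, K) (xs @ [Some d]) (map Some ds))"
    using reaches_right[of ?D "(Start, K)" "Some d"] by simp
  also note Cons.IH
  finally show ?case by simp
qed

lemma reaches_Append: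
  "reaches (delta out e) (2 * n) (zipper (Append n, K) (map Some xs) [])
     (zipper (Append 0, K) (map Some (xs @ enc_tuple (replicate n []))) [])" (is "reaches ?D _ _ _")
proof (induction n arbitrary: xs)
  case 0
  then show ?case by (simp add: reaches_refl)
next
  case (Suc n)
  have "reaches ?D 1 (zipper (Append (Suc n), K) (map Some xs) [])
      (zipper (Append_snd n, K) (map Some xs @ [Some True]) [])"
    by (rule reaches_right_end) simp
  also have "reaches ?D 1 \<dots> (zipper (Append n, K) (map Some (xs @ [True, False])) [])"
    using reaches_right_end[of ?D "(Append_snd n, K)" _ _ "map Some xs @ [Some True]"] by simp
  also note Suc.IH
  finally show ?case by (simp add: enc_tuple_Cons)
qed

lemma reaches_init_store:
  "reaches (delta out e) (2 * length (enc_tuple ws) + 4 * e + 3)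
     ((Start, [p]), snd (tm_init (enc_tuple ws)))
     (ready (length ws + e) [p] (init_store ws))" (is "reaches ?D _ _ _")
proof -
  let ?input = "enc_tuple ws" and ?store = "enc_store (length ws + e) (init_store ws)"
  have store: "?store = ?input @ enc_tuple (replicate e [])"
    by (simp add: enc_store_init enc_tuple_append)
  have "((Start, [p]), snd (tm_init ?input)) = zipper (Start, [p]) [] (map Some ?input)"
    by (auto simp: tm_init_def zipper_def tape_def fun_eq_iff)
  also have "reaches ?D (length ?input + 1) \<dots> (zipper (Append e, [p]) (map Some ?input) [])"
    using reaches_Start[of out e ?input "[p]" "[]"] by simp
  also have "reaches ?D (2 * e) \<dots> (zipper (Append 0, [p]) (map Some ?store) [])"
    unfolding store by (rule reaches_Append)
  also have "reaches ?D 1 \<dots> ((Rewind, [p]), tape (map Some ?store), int (length ?store) - 1)"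
    using reaches_zipper[of ?D "(Append 0, [p])" None _ _ _ "map Some ?store" "[]"] by simp
  also have "reaches ?D (length ?store + 1) \<dots> (ready (length ws + e) [p] (init_store ws))"
    unfolding ready_def by (rule reaches_Rewind) simp
  finally show ?thesis by (rule reaches_mono) (simp add: store length_enc_tuple_empty)
qed

fun output_registers :: "output_mode \<Rightarrow> nat" where
  "output_registers First_bit = 1"
| "output_registers (Registers n) = n"

fun outputs :: "output_mode \<Rightarrow> store \<Rightarrow> bool list \<Rightarrow> bool" where
  "outputs First_bit S w \<longleftrightarrow> S 0 \<noteq> [] \<and> w = [hd (S 0)]"
| "outputs (Registers n) S w \<longleftrightarrow> w = enc_tuple (map S [0..<n])"

lemma reaches_Cut:
  "reaches (delta out e) 1 (zipper (Cut, K) xs ys) (zipper (Halt, []) xs (None # tl ys))"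
proof (cases ys)
  case Nil
  then show ?thesis using reaches_stay_end[of "delta out e" "(Cut, K)"] by simp
next
  case (Cons a as)
  then show ?thesis using reaches_stay[of "delta out e" "(Cut, K)" a] by simp
qed

lemma reaches_output:
  assumes "output_registers out \<le> k" "outputs out S w"
  shows "\<exists>ys. reaches (delta out e) (length (enc_store k S) + 3) (ready k [] S)
    (zipper (Halt, []) (map Some w) (None # ys))" (is "\<exists>ys. reaches ?D _ _ _")
proof (cases out)
  case First_bit
  then obtain b bs where b: "S 0 = b # bs" "w = [b]" using assms(2) by (cases "S 0") auto
  then obtain ys where store: "enc_store k S = w @ ys"
    using enc_store_split[of 0 k S] assms(1) First_bit by simp
  have "reaches ?D 1 (ready k [] S) (zipper (Skip_cell, []) [] (map Some (w @ ys)))"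
    using reaches_fetch[of out "[]" Skip_cell "[]" e k S] First_bit store by simp
  also have "reaches ?D 1 \<dots> (zipper (Cut, []) (map Some w) (map Some ys))"
    using reaches_right[of ?D "(Skip_cell, [])" "Some b" _ _ "[]" "map Some ys"] b(2) by simp
  also note reaches_Cut
  finally show ?thesis by (intro exI) (erule reaches_mono, simp)
next
  case (Registers n)
  then have "[0..<k] = [0..<n] @ [n..<k]"
    using assms(1) upt_add_eq_append[of 0 n "k - n"] by simp
  then have store: "enc_store k S = w @ enc_tuple (map S [n..<k])"
    using assms(2) Registers by (simp add: enc_store_def enc_tuple_append)
  let ?ys = "map Some (enc_tuple (map S [n..<k]))"
  have "reaches ?D 1 (ready k [] S) (zipper (Seek n, []) [] (map Some w @ ?ys))"
    using reaches_fetch[of out "[]" "Seek n" "[]" e k S] Registers store by simp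
  also have "reaches ?D (length w) \<dots> (zipper (Seek 0, []) (map Some w) ?ys)"
    using reaches_Seek[of out e "map S [0..<n]" "[]" "[]"] assms(2) Registers by simp
  also have "reaches ?D 1 \<dots> (zipper (Cut, []) (map Some w) ?ys)"
    by (cases ?ys) (auto intro: reaches_stay reaches_stay_end simp del: One_nat_def)
  also note reaches_Cut
  finally show ?thesis by (intro exI) (erule reaches_mono, simp add: store)
qed

text \<open>Every configuration occupies O(n) cells, where n is the sum of the input length, e and t, and
  each of the at most t commands is carried out by a constant number of sweeps over the tape.\<close>

lemma reaches_halt:
  assumes "exec p (init_store ws) t S" "uses_below (length ws + e) p"
    and "output_registers out \<le> length ws + e" "outputs out S w"
  shows "\<exists>ys. reaches (delta out e) (100 * (length (enc_tuple ws) + e + t + 1)\<^sup>2)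
    ((Start, [p]), snd (tm_init (enc_tuple ws))) (zipper (Halt, []) (map Some w) (None # ys))"
proof -
  let ?k = "length ws + e" and ?n = "length (enc_tuple ws)"
  let ?m = "?n + 2 * e + 2 * t"
  have init_length: "length (enc_store ?k (init_store ws)) = ?n + 2 * e"
    by (simp add: enc_store_init enc_tuple_append length_enc_tuple_empty)
  have final_length: "length (enc_store ?k S) \<le> ?m"
    using exec_length[OF assms(1,2)] init_length by simp
  obtain ys where final: "reaches (delta out e) (length (enc_store ?k S) + 3) (ready ?k [] S)
      (zipper (Halt, []) (map Some w) (None # ys))"
    using reaches_output[OF assms(3,4)] by blast
  note reaches_init_store
  also have "reaches (delta out e) (t * (4 * ?m + 20)) (ready ?k [p] (init_store ws))
      (ready ?k [] S)"
    by (rule exec_reaches[OF assms(1,2)]) (simp add: init_length)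
  also note reaches_mono[OF final, of "?m + 3"]
  finally have "reaches (delta out e) (2 * ?n + 4 * e + 3 + t * (4 * ?m + 20) + (?m + 3))
      ((Start, [p]), snd (tm_init (enc_tuple ws))) (zipper (Halt, []) (map Some w) (None # ys))"
    using final_length by simp
  moreover have "2 * ?n + 4 * e + 3 + t * (4 * ?m + 20) + (?m + 3) \<le> 100 * (?n + e + t + 1)\<^sup>2"
    by (simp add: power2_eq_square algebra_simps)
  ultimately show ?thesis using reaches_mono by blast
qed

lemma halting_time_le:
  "100 * (l + e + c * (l + 1) ^ d + 1)\<^sup>2 \<le> 100 * (c + e + 1)\<^sup>2 * (l + 1) ^ ((d + 1) * 2)"
  for l :: nat
proof -
  define u where "u = (l + 1) ^ (d + 1)"
  have "l + 1 \<le> u" unfolding u_def by (rule self_le_power) simp_all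
  moreover have "c * (l + 1) ^ d \<le> c * u"
    unfolding u_def by (intro mult_le_mono2 power_increasing) simp_all
  moreover have "e * 1 \<le> e * u" unfolding u_def by (intro mult_le_mono2 one_le_power) simp
  ultimately have "l + e + c * (l + 1) ^ d + 1 \<le> (c + e + 1) * u"
    unfolding add_mult_distrib by linarith
  then have "100 * (l + e + c * (l + 1) ^ d + 1)\<^sup>2 \<le> 100 * ((c + e + 1) * u)\<^sup>2"
    by (intro mult_le_mono2 power_mono) simp_all
  also have "\<dots> = 100 * (c + e + 1)\<^sup>2 * (l + 1) ^ ((d + 1) * 2)"
    unfolding u_def power_mult_distrib power_mult mult.assoc ..
  finally show ?thesis .
qed

theorem poly_computes_on_stack_program:
  assumes "uses_below (m + e) p" "output_registers out \<le> m + e" "\<And>ws. ws \<in> W \<Longrightarrow> length ws = m"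
    and correct: "\<And>ws. ws \<in> W \<Longrightarrow> \<exists>S. exec p (init_store ws) (c * (length (enc_tuple ws) + 1) ^ d) S
      \<and> outputs out S (f (enc_tuple ws))"
  shows "\<exists>M. poly_computes_on M (enc_tuple ` W) f"
proof -
  obtain M where M: "tm_wf M"
    "\<And>x t tp h. (machine_step (delta out e) ^^ t) ((Start, [p]), snd (tm_init x))
      = ((Halt, []), tp, h) \<Longrightarrow> tm_run M x t = (1, tp, h)"
    using tm_of_stack_program by blast
  have "\<exists>t. t \<le> 100 * (c + e + 1)\<^sup>2 * (length w + 1) ^ ((d + 1) * 2) \<and> tm_halted (tm_run M w t)
      \<and> tm_output (tm_run M w t) = f w" if "w \<in> enc_tuple ` W" for w
  proof -
    from that obtain ws where ws: "ws \<in> W" "w = enc_tuple ws" by auto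
    obtain S where S: "exec p (init_store ws) (c * (length w + 1) ^ d) S" "outputs out S (f w)"
      using correct[OF ws(1)] ws(2) by auto
    obtain ys where "reaches (delta out e) (100 * (length w + e + c * (length w + 1) ^ d + 1)\<^sup>2)
        ((Start, [p]), snd (tm_init w)) (zipper (Halt, []) (map Some (f w)) (None # ys))"
      using reaches_halt[OF S(1) _ _ S(2), of e] assms(1-3) ws by auto
    then obtain t where "t \<le> 100 * (length w + e + c * (length w + 1) ^ d + 1)\<^sup>2"
      and run: "tm_run M w t = (1, tape (map Some (f w) @ None # ys), int (length (f w)))"
      using M(2) unfolding reaches_def zipper_def by fastforce
    then have "t \<le> 100 * (c + e + 1)\<^sup>2 * (length w + 1) ^ ((d + 1) * 2)"
      using halting_time_le le_trans by blast
    then show ?thesis using run by (intro exI[of _ t]) (simp add: tm_halted_def tm_output_tape)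
  qed
  then have "poly_computes_on M (enc_tuple ` W) f"
    unfolding poly_computes_on_def using M(1) by blast
  then show ?thesis ..
qed

lemma id_in_poly: "(\<lambda>n. n) \<in> poly"
proof -
  let ?M = "(2, \<lambda>s a. (1, a, 0)) :: tm"
  have "\<exists>t. t \<le> 1 * (length w + 1) ^ 0 \<and> tm_halted (tm_run ?M w t)
      \<and> tm_output (tm_run ?M w t) = replicate (length w) True"
    if "w \<in> range (\<lambda>n. replicate n True)" for w
  proof -
    have "tm_run ?M w 1 = (1, tape (map Some w @ [None]), 0)"
      by (auto simp: tm_run_def tm_step_def tm_init_def tape_def nth_append fun_eq_iff)
    then show ?thesis using that tm_output_tape[of 1 w "[]" 0]
      by (intro exI[of _ 1]) (auto simp: tm_halted_def)
  qed
  moreover have "tm_wf ?M" by (simp add: tm_wf_def)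
  ultimately
  have "poly_computes_on ?M (range (\<lambda>n. replicate n True)) (\<lambda>w. replicate (length w) True)"
    unfolding poly_computes_on_def by blast
  then show ?thesis unfolding poly_def by blast
qed

section \<open>Subroutines\<close>

definition hd_bit :: "bool list \<Rightarrow> bool" where
  "hd_bit xs \<longleftrightarrow> xs \<noteq> [] \<and> hd xs"

lemma hd_bit_simps [simp]: "hd_bit [] = False" "hd_bit (x # xs) = x"
  by (simp_all add: hd_bit_def)

definition nth_bit :: "bool list \<Rightarrow> nat \<Rightarrow> bool" where
  "nth_bit xs i \<longleftrightarrow> i < length xs \<and> xs ! i"

lemma nth_bit_simps [simp]: "nth_bit [] i = False" "nth_bit (x # xs) 0 = x"
  "nth_bit (x # xs) (Suc i) = nth_bit xs i"
  by (simp_all add: nth_bit_def)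

lemma hd_bit_drop: "hd_bit (drop i xs) = nth_bit xs i"
  by (cases "i < length xs") (simp_all add: nth_bit_def Cons_nth_drop_Suc[symmetric])

lemma bits_to_nat_Nil [simp]: "bits_to_nat [] = 0"
  by (simp add: bits_to_nat_def)

lemma bits_to_nat_Cons: "bits_to_nat (b # bs) = of_bool b + 2 * bits_to_nat bs"
  unfolding bits_to_nat_def length_Cons sum.lessThan_Suc_shift sum_distrib_left
  by (simp add: if_distrib[of "(*) 2"] cong: if_cong)

lemma bits_to_nat_less: "bits_to_nat bs < 2 ^ length bs"
  by (induction bs) (auto simp: bits_to_nat_Cons)

lemma bits_to_nat_take_Suc:
  "bits_to_nat (take (Suc i) xs) = bits_to_nat (take i xs) + of_bool (nth_bit xs i) * 2 ^ i"
proof (induction i arbitrary: xs)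
  case 0
  then show ?case by (cases xs) (auto simp: bits_to_nat_Cons nth_bit_def)
next
  case (Suc i)
  then show ?case by (cases xs) (auto simp: bits_to_nat_Cons nth_bit_def)
qed

fun first_token :: "bool list \<Rightarrow> bool list" where
  "first_token (x # y # xs) = (if x = y then x # first_token xs else [])"
| "first_token _ = []"

fun drop_token :: "bool list \<Rightarrow> bool list" where
  "drop_token (x # y # xs) = (if x = y then drop_token xs else xs)"
| "drop_token _ = []"

definition number_at :: "nat \<Rightarrow> bool list \<Rightarrow> nat" where
  "number_at i xs = bits_to_nat (first_token ((drop_token ^^ i) xs))"

lemma length_tokens: "length (first_token xs) + length (drop_token xs) \<le> length xs"
  by (induction xs rule: first_token.induct) auto

lemma length_first_token: "length (first_token xs) \<le> length xs"
  using length_tokens[of xs] by simp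

lemma length_drop_tokens: "length ((drop_token ^^ i) xs) \<le> length xs"
proof (induction i)
  case (Suc i)
  then show ?case using length_tokens[of "(drop_token ^^ i) xs"] by simp
qed simp

lemma exec_Skip_eq: "S = R \<Longrightarrow> 0 < t \<Longrightarrow> exec Skip R t S"
  by (simp add: exec_Skip)

lemma exec_Push_eq: "S = R(r := b # R r) \<Longrightarrow> 0 < t \<Longrightarrow> exec (Push r b) R t S"
  by (simp add: exec_Push)

text \<open>S j is the store after j iterations.\<close>

lemma exec_Loop:
  assumes "R = S 0" "T = S (length (R r))"
    and "\<And>j. j < length (R r) \<Longrightarrow> exec (f (R r ! j)) ((S j)(r := drop (Suc j) (R r))) t (S (Suc j))"
    and "\<And>j. j \<le> length (R r) \<Longrightarrow> S j r = drop j (R r)" "length (R r) * (t + 1) + 1 \<le> u"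
  shows "exec (Loop r f) R u T"
proof -
  let ?n = "length (R r)"
  have "exec (Loop r f) (S j) ((?n - j) * (t + 1) + 1) (S ?n)" if "j \<le> ?n" for j
    using that
  proof (induction j rule: inc_induct)
    case base
    have "S ?n r = []" using assms(4)[of ?n] by simp
    then show ?case by (simp add: exec_Loop_Nil)
  next
    case (step j)
    have "S j r = R r ! j # drop (Suc j) (R r)"
      using assms(4)[of j] step(2) by (simp add: Cons_nth_drop_Suc)
    then show ?case
    proof (rule exec_Loop_Cons[OF _ assms(3) step.IH])
      show "t + ((?n - Suc j) * (t + 1) + 1) < (?n - j) * (t + 1) + 1"
        using step(2) by (simp add: Suc_diff_Suc[symmetric])
    qed (rule step(2))
  qed
  from exec_mono[OF this[of 0]] show ?thesis using assms(1,2,5) by simp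
qed

definition read_bit :: "nat \<Rightarrow> (bool \<Rightarrow> com) \<Rightarrow> com" where
  "read_bit r f = Case r (f False) f"

lemma exec_read_bit:
  assumes "exec (f (hd_bit (R r))) (R(r := tl (R r))) t S" "t < u"
  shows "exec (read_bit r f) R u S"
proof (cases "R r")
  case Nil
  then have "R(r := tl (R r)) = R" by auto
  then show ?thesis
    using assms Nil exec_Case_Nil[of R r "f False" t S u f] by (simp add: read_bit_def)
next
  case (Cons b bs)
  then show ?thesis
    using assms exec_Case_Cons[of R r b bs f t S u "f False"] by (simp add: read_bit_def)
qed

primrec read_bits :: "nat list \<Rightarrow> (bool list \<Rightarrow> com) \<Rightarrow> com" where
  "read_bits [] f = f []"
| "read_bits (r # rs) f = read_bit r (\<lambda>b. read_bits rs (\<lambda>bs. f (b # bs)))"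

primrec bits_read :: "nat list \<Rightarrow> store \<Rightarrow> bool list" where
  "bits_read [] R = []"
| "bits_read (r # rs) R = hd_bit (R r) # bits_read rs (R(r := tl (R r)))"

primrec store_read :: "nat list \<Rightarrow> store \<Rightarrow> store" where
  "store_read [] R = R"
| "store_read (r # rs) R = store_read rs (R(r := tl (R r)))"

lemma exec_read_bits:
  "exec (f (bits_read rs R)) (store_read rs R) t S \<Longrightarrow> exec (read_bits rs f) R (length rs + t) S"
proof (induction rs arbitrary: R f)
  case (Cons r rs)
  from Cons.prems[unfolded bits_read.simps store_read.simps]
  have "exec (read_bits rs (\<lambda>bs. f (hd_bit (R r) # bs))) (R(r := tl (R r))) (length rs + t) S"
    by (rule Cons.IH)
  then show ?case by (auto intro: exec_read_bit)
qed simp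

definition move :: "nat \<Rightarrow> nat \<Rightarrow> com" where
  "move a b = Loop a (Push b)"

lemma exec_move:
  assumes "a \<noteq> b" "S = R(a := [], b := rev (R a) @ R b)"
  shows "exec (move a b) R (2 * length (R a) + 1) S"
  unfolding move_def
  by (rule exec_Loop[where S = "\<lambda>j. R(a := drop j (R a), b := rev (take j (R a)) @ R b)" and t = 1])
    (use assms in \<open>auto intro!: exec_Push_eq simp: fun_eq_iff take_Suc_conv_app_nth\<close>)

definition clear :: "nat \<Rightarrow> com" where
  "clear a = Loop a (\<lambda>_. Skip)"

lemma exec_clear:
  assumes "S = R(a := [])"
  shows "exec (clear a) R (2 * length (R a) + 1) S"
  unfolding clear_def
  by (rule exec_Loop[where S = "\<lambda>j. R(a := drop j (R a))" and t = 1])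
    (use assms in \<open>auto intro!: exec_Skip_eq\<close>)

text \<open>The subroutines use three scratch registers, which are empty between calls.\<close>

abbreviation (input) r_work :: nat where "r_work \<equiv> 9"
abbreviation (input) r_acc :: nat where "r_acc \<equiv> 10"
abbreviation (input) r_flag :: nat where "r_flag \<equiv> 11"

definition copy :: "nat \<Rightarrow> nat \<Rightarrow> com" where
  "copy a b = move a r_acc ;; Loop r_acc (\<lambda>x. Push a x ;; Push b x)"

lemma exec_copy:
  assumes "a \<noteq> b" "a \<noteq> r_acc" "b \<noteq> r_acc" "R r_acc = []" "S = R(b := R a @ R b)"
  shows "exec (copy a b) R (6 * length (R a) + 3) S"
proof -
  let ?xs = "rev (R a)"
  have "exec (move a r_acc) R (2 * length (R a) + 1) (R(a := [], r_acc := ?xs))"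
    by (rule exec_move) (use assms in auto)
  also have "exec (Loop r_acc (\<lambda>x. Push a x ;; Push b x)) \<dots> (4 * length (R a) + 1) S"
  proof (rule exec_Loop[where t = 3])
    let ?S = "\<lambda>j. R(r_acc := drop j ?xs, a := rev (take j ?xs), b := rev (take j ?xs) @ R b)"
    show "R(a := [], r_acc := ?xs) = ?S 0" using assms by (auto simp: fun_eq_iff)
    fix j assume "j < length ((R(a := [], r_acc := ?xs)) r_acc)"
    then have j: "j < length ?xs" by simp
    have "exec (Push a (?xs ! j)) ((?S j)(r_acc := drop (Suc j) ?xs)) 1
        ((?S j)(r_acc := drop (Suc j) ?xs, a := rev (take (Suc j) ?xs)))"
      using j assms by (intro exec_Push_eq) (auto simp: fun_eq_iff take_Suc_conv_app_nth)
    also have "exec (Push b (?xs ! j)) \<dots> 1 (?S (Suc j))"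
      using j assms by (intro exec_Push_eq) (auto simp: fun_eq_iff take_Suc_conv_app_nth)
    finally show "exec (Push a ((R(a := [], r_acc := ?xs)) r_acc ! j)
          ;; Push b ((R(a := [], r_acc := ?xs)) r_acc ! j))
        ((?S j)(r_acc := drop (Suc j) ((R(a := [], r_acc := ?xs)) r_acc))) 3 (?S (Suc j))"
      by (simp add: numeral_3_eq_3)
  qed (use assms in \<open>auto simp: fun_eq_iff\<close>)
  finally show ?thesis unfolding copy_def by (rule exec_mono) simp
qed

definition token_step :: "nat \<Rightarrow> com" where
  "token_step a = Case a Skip (\<lambda>x. Case a Skip (\<lambda>y.
     if x = y then Push r_acc x ;; Push r_flag True else Skip))"

definition get_token :: "nat \<Rightarrow> nat \<Rightarrow> com" where
  "get_token a b = Push r_flag True ;; Loop r_flag (\<lambda>_. token_step a) ;; move r_acc b"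

lemma exec_token_step:
  assumes "a \<notin> {r_acc, r_flag}"
    and "S = (case R a of
     x # y # xs \<Rightarrow>
       if x = y then R(a := xs, r_acc := x # R r_acc, r_flag := True # R r_flag) else R(a := xs)
   | _ \<Rightarrow> R(a := []))"
  shows "exec (token_step a) R 5 S"
proof -
  let ?f = "\<lambda>x y. if x = y then Push r_acc x ;; Push r_flag True else Skip"
  consider "R a = []" | x where "R a = [x]" | x y xs where "R a = x # y # xs"
    by (metis list.exhaust)
  then show ?thesis
  proof cases
    assume "R a = []"
    then show ?thesis unfolding token_step_def assms(2)
      by (auto simp: fun_upd_idem intro!: exec_Case_Nil[where t = 1] exec_Skip)
  next
    fix x assume x: "R a = [x]"
    have "exec (Case a Skip (?f x)) (R(a := [])) 4 (R(a := []))"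
      by (rule exec_Case_Nil[where t = 1]) (simp_all add: exec_Skip)
    then show ?thesis unfolding token_step_def assms(2)
      using exec_Case_Cons[of R a x "[]" "\<lambda>x. Case a Skip (?f x)"] x by simp
  next
    fix x y xs assume xy: "R a = x # y # xs"
    have "exec (Push r_acc x) (R(a := xs)) 1 (R(a := xs, r_acc := x # R r_acc))"
      by (rule exec_Push_eq) (use assms(1) in auto)
    also have "exec (Push r_flag True) \<dots> 1
        (R(a := xs, r_acc := x # R r_acc, r_flag := True # R r_flag))"
      by (rule exec_Push_eq) (use assms(1) in auto)
    finally have "exec (?f x y) (R(a := xs)) 3 S"
      using xy by (cases "x = y") (simp_all add: assms(2) numeral_3_eq_3 exec_Skip)
    then have "exec (Case a Skip (?f x)) (R(a := y # xs)) 4 S"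
      by (intro exec_Case_Cons[where f = "?f x" and b = y and bs = xs]) auto
    then show ?thesis unfolding token_step_def
      by (intro exec_Case_Cons[where f = "\<lambda>x. Case a Skip (?f x)" and b = x and bs = "y # xs"])
        (auto simp: xy)
  qed
qed

lemma exec_token_loop:
  assumes "a \<notin> {r_acc, r_flag}" "R a = xs" "R r_flag = [True]"
    "S = R(r_flag := [], a := drop_token xs, r_acc := rev (first_token xs) @ R r_acc)"
  shows "exec (Loop r_flag (\<lambda>_. token_step a)) R (10 * length xs + 10) S" (is "exec ?loop _ _ _")
proof -
  have stop: "exec ?loop R (10 * length xs + 10) S"
    if "exec (token_step a) (R(r_flag := [])) 5 S" "R r_flag = [True]" "S r_flag = []" for R xs
  proof (rule exec_Loop_Cons[OF that(2,1)])
    show "exec ?loop S 1 S" using that(3) by (simp add: exec_Loop_Nil)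
  qed simp
  show ?thesis using assms(2-4)
  proof (induction xs arbitrary: R rule: first_token.induct)
    case (1 x y xs)
    show ?case
    proof (cases "x = y")
      case True
      let ?R = "R(a := xs, r_acc := x # R r_acc)"
      have "exec (token_step a) (R(r_flag := [])) 5 ?R"
        by (rule exec_token_step[OF assms(1)]) (use 1(2,3) True assms(1) in \<open>auto simp: fun_eq_iff\<close>)
      moreover have "exec ?loop ?R (10 * length xs + 10) S"
        by (rule 1(1)[OF True]) (use 1(3,4) True assms(1) in \<open>auto simp: fun_eq_iff\<close>)
      ultimately show ?thesis
        using 1(3) exec_Loop_Cons[of R r_flag True "[]" "\<lambda>_. token_step a" 5 ?R] by simp
    next
      case False
      then show ?thesis using 1(2-4) assms(1)
        by (intro stop exec_token_step[OF assms(1)]) (auto simp: fun_eq_iff)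
    qed
  next
    case "2_1"
    then show ?case
      using assms(1) by (intro stop exec_token_step[OF assms(1)]) (auto simp: fun_eq_iff)
  next
    case ("2_2" x)
    then show ?case
      using assms(1) by (intro stop exec_token_step[OF assms(1)]) (auto simp: fun_eq_iff)
  qed
qed

lemma exec_get_token:
  assumes "a \<notin> {r_acc, r_flag}" "b \<notin> {r_acc, r_flag}" "a \<noteq> b" "R r_acc = []" "R r_flag = []"
    "S = R(a := drop_token (R a), b := first_token (R a) @ R b)"
  shows "exec (get_token a b) R (12 * length (R a) + 14) S"
proof -
  let ?token = "first_token (R a)"
  have "exec (Push r_flag True) R 1 (R(r_flag := [True]))"
    by (rule exec_Push_eq) (use assms in auto)
  also have "exec (Loop r_flag (\<lambda>_. token_step a)) \<dots> (10 * length (R a) + 10)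
      (R(a := drop_token (R a), r_acc := rev ?token))"
    by (rule exec_token_loop) (use assms in \<open>auto simp: fun_eq_iff\<close>)
  also have "exec (move r_acc b) \<dots> (2 * length (R a) + 1) S"
    by (rule exec_mono[OF exec_move])
      (use assms length_first_token[of "R a"] in \<open>auto simp: fun_eq_iff\<close>)
  finally show ?thesis unfolding get_token_def by (rule exec_mono) simp
qed

fun evens :: "'a list \<Rightarrow> 'a list" where
  "evens (x # y # xs) = x # evens xs"
| "evens xs = xs"

lemma length_evens: "length (evens xs) = (length xs + 1) div 2"
  by (induction xs rule: evens.induct) auto

lemma evens_snoc: "evens (xs @ [x]) = (if even (length xs) then evens xs @ [x] else evens xs)"
  by (induction xs rule: evens.induct) auto

lemma nth_bit_evens: "nth_bit (evens xs) i = nth_bit xs (2 * i)"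
proof (induction xs arbitrary: i rule: evens.induct)
  case (1 x y xs)
  then show ?case by (cases i) simp_all
next
  case ("2_2" x)
  then show ?case by (cases i) simp_all
qed simp

definition select :: "bool list \<Rightarrow> bool list \<Rightarrow> bool list" where
  "select bs xs = foldl (\<lambda>xs b. evens (if b then tl xs else xs)) xs bs"

lemma length_select: "length (select bs xs) \<le> length xs"
proof (induction bs rule: rev_induct)
  case (snoc b bs)
  then show ?case by (auto simp: select_def length_evens)
qed (simp add: select_def)

text \<open>Each digit of the index decides whether the elements at even or at odd positions survive.\<close>

lemma hd_bit_select: "hd_bit (select bs xs) = nth_bit xs (bits_to_nat bs)"
proof (induction bs arbitrary: xs)
  case Nil
  show ?case using hd_bit_drop[of 0 xs] by (simp add: select_def)
next
  case (Cons b bs)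
  have "hd_bit (select (b # bs) xs) = hd_bit (select bs (evens (if b then tl xs else xs)))"
    by (simp add: select_def)
  also have "\<dots> = nth_bit (if b then tl xs else xs) (2 * bits_to_nat bs)"
    by (simp only: Cons.IH nth_bit_evens)
  also have "\<dots> = nth_bit xs (bits_to_nat (b # bs))"
    by (cases xs) (auto simp: bits_to_nat_Cons nth_bit_def)
  finally show ?case .
qed

definition keep_evens :: com where
  "keep_evens = Loop r_work (\<lambda>x. Case r_flag (Push r_acc x ;; Push r_flag True) (\<lambda>_. Skip)) ;;
     clear r_flag ;; move r_acc r_work"

lemma exec_evens_loop:
  assumes "R r_acc = []" "R r_flag = []"
    and "S = R(r_work := [], r_acc := rev (evens (R r_work)),
      r_flag := if even (length (R r_work)) then [] else [True])"
  shows "exec (Loop r_work (\<lambda>x. Case r_flag (Push r_acc x ;; Push r_flag True) (\<lambda>_. Skip))) R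
      (5 * length (R r_work) + 1) S"
proof (rule exec_Loop[where t = 4])
  let ?xs = "R r_work"
  let ?S = "\<lambda>j. R(r_work := drop j ?xs, r_acc := rev (evens (take j ?xs)),
    r_flag := if even j then [] else [True])"
  show "R = ?S 0" using assms(1,2) by (auto simp: fun_eq_iff)
  fix j assume j: "j < length ?xs"
  let ?R = "(?S j)(r_work := drop (Suc j) ?xs)"
  show "exec (Case r_flag (Push r_acc (?xs ! j) ;; Push r_flag True) (\<lambda>_. Skip)) ?R 4 (?S (Suc j))"
  proof (cases "even j")
    case True
    have "exec (Push r_acc (?xs ! j)) ?R 1 (?R(r_acc := rev (evens (take (Suc j) ?xs))))"
      using j True by (intro exec_Push_eq) (auto simp: take_Suc_conv_app_nth evens_snoc)
    also have "exec (Push r_flag True) \<dots> 1 (?S (Suc j))"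
      using True by (intro exec_Push_eq) (auto simp: fun_eq_iff)
    finally show ?thesis by (rule exec_Case_Nil[rotated]) (use True in auto)
  next
    case False
    then show ?thesis using j
      by (intro exec_Case_Cons[of _ _ True "[]" _ 1] exec_Skip_eq)
        (auto simp: fun_eq_iff take_Suc_conv_app_nth evens_snoc)
  qed
qed (use assms(3) in auto)

lemma exec_keep_evens:
  assumes "R r_acc = []" "R r_flag = []" "S = R(r_work := evens (R r_work))"
  shows "exec keep_evens R (7 * length (R r_work) + 8) S"
proof -
  let ?xs = "R r_work"
  let ?flag = "if even (length ?xs) then [] else [True]"
  have "exec (Loop r_work (\<lambda>x. Case r_flag (Push r_acc x ;; Push r_flag True) (\<lambda>_. Skip))) R
      (5 * length ?xs + 1) (R(r_work := [], r_acc := rev (evens ?xs), r_flag := ?flag))"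
    by (rule exec_evens_loop[OF assms(1,2) refl])
  also have "exec (clear r_flag) \<dots> 3 (R(r_work := [], r_acc := rev (evens ?xs)))"
    by (rule exec_mono[OF exec_clear]) (use assms in \<open>auto simp: fun_eq_iff\<close>)
  also have "exec (move r_acc r_work) \<dots> (2 * length ?xs + 1) S"
    by (rule exec_mono[OF exec_move]) (use assms in \<open>auto simp: fun_eq_iff length_evens\<close>)
  finally show ?thesis unfolding keep_evens_def by (rule exec_mono) simp
qed

definition quad :: "nat \<Rightarrow> nat" where
  "quad n = (n + 1)\<^sup>2"

definition cube :: "nat \<Rightarrow> nat" where
  "cube n = (n + 1) ^ 3"

lemma quad_gt: "n < quad n"
  by (simp add: quad_def power2_eq_square)

lemma loop_le_quad:
  assumes "m \<le> n"
  shows "m * (a * n + b) \<le> (a + b) * quad n"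
proof -
  have "m * (a * n + b) \<le> n * (a * n + b)" using assms by (rule mult_le_mono1)
  also have "\<dots> \<le> (a + b) * quad n" by (simp add: quad_def power2_eq_square algebra_simps)
  finally show ?thesis .
qed

lemma quad_le_cube: "quad n \<le> cube n"
  unfolding quad_def cube_def by (rule power_increasing) simp_all

lemma loop_le_cube:
  assumes "m \<le> n"
  shows "m * (a * quad n + 1) + 1 \<le> (a + 1) * cube n"
proof -
  have "m * (a * quad n + 1) + 1 \<le> n * (a * quad n + 1) + 1"
    using assms by (intro add_mono mult_le_mono1) simp_all
  also have "\<dots> \<le> (n + 1) * (a * quad n + quad n)" using quad_gt[of n] by (simp add: algebra_simps)
  also have "\<dots> = (a + 1) * cube n"
    by (simp add: quad_def cube_def power2_eq_square power3_eq_cube algebra_simps)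
  finally show ?thesis .
qed

definition lookup :: "nat \<Rightarrow> nat \<Rightarrow> nat \<Rightarrow> com" where
  "lookup w a v = copy w r_work ;;
     Loop a (\<lambda>b. if b then read_bit r_work (\<lambda>_. keep_evens) else keep_evens) ;;
     read_bit r_work (\<lambda>x. clear r_work ;; Push v x)"

lemma exec_select_loop:
  assumes "a \<notin> {r_work, r_acc, r_flag}" "R r_acc = []" "R r_flag = []" "length (R r_work) \<le> n"
    "S = R(a := [], r_work := select (R a) (R r_work))"
  shows "exec (Loop a (\<lambda>b. if b then read_bit r_work (\<lambda>_. keep_evens) else keep_evens)) R
     (length (R a) * (7 * n + 10) + 1) S"
proof (rule exec_Loop[where t = "7 * n + 9"])
  let ?bs = "R a"
  let ?xs = "\<lambda>j. select (take j ?bs) (R r_work)"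
  let ?S = "\<lambda>j. R(a := drop j ?bs, r_work := ?xs j)"
  show "R = ?S 0" by (simp add: select_def)
  fix j assume j: "j < length ?bs"
  let ?R = "(?S j)(a := drop (Suc j) ?bs)"
  have length: "length (?xs j) \<le> n" using length_select[of "take j ?bs" "R r_work"] assms(4) by simp
  have keep: "exec keep_evens R' (7 * n + 8) (?S (Suc j))"
    if "R' = ?R(r_work := if ?bs ! j then tl (?xs j) else ?xs j)" for R'
    by (rule exec_mono[OF exec_keep_evens])
      (use that assms j length in \<open>auto simp: fun_eq_iff select_def take_Suc_conv_app_nth\<close>)
  show "exec (if ?bs ! j then read_bit r_work (\<lambda>_. keep_evens) else keep_evens) ?R (7 * n + 9)
      (?S (Suc j))"
  proof (cases "?bs ! j")
    case True
    then show ?thesis using assms(1) by (auto intro!: exec_read_bit[where t = "7 * n + 8"] keep)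
  next
    case False
    then show ?thesis
      using assms(1) by (auto intro!: exec_mono[OF keep, of _ "7 * n + 9"] simp: fun_eq_iff)
  qed
qed (use assms in auto)

lemma exec_lookup:
  assumes "w \<notin> {r_work, r_acc, r_flag}" "a \<notin> {r_work, r_acc, r_flag}" "v \<notin> {r_work, r_acc, r_flag}"
    "a \<noteq> w" "R r_work = []" "R r_acc = []" "R r_flag = []" "length (R w) \<le> n" "length (R a) \<le> n"
    "S = (R(a := []))(v := nth_bit (R w) (bits_to_nat (R a)) # (R(a := [])) v)"
  shows "exec (lookup w a v) R (40 * quad n) S"
proof -
  let ?xs = "select (R a) (R w)"
  have "exec (copy w r_work) R (6 * length (R w) + 3) (R(r_work := R w))"
    by (rule exec_copy) (use assms in auto)
  also have "exec (Loop a (\<lambda>b. if b then read_bit r_work (\<lambda>_. keep_evens) else keep_evens)) \<dots>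
      (length (R a) * (7 * n + 10) + 1) (R(a := [], r_work := ?xs))"
    by (rule exec_mono[OF exec_select_loop[where n = n]]) (use assms in \<open>auto simp: fun_eq_iff\<close>)
  also have "exec (read_bit r_work (\<lambda>x. clear r_work ;; Push v x)) \<dots> (2 * n + 4) S"
  proof (rule exec_read_bit)
    let ?R = "R(a := [], r_work := tl ?xs)"
    have "exec (clear r_work) ?R (2 * n + 1) (R(a := []))"
      by (rule exec_mono[OF exec_clear])
        (use assms length_select[of "R a" "R w"] in \<open>auto simp: fun_eq_iff\<close>)
    also have "exec (Push v (hd_bit ?xs)) \<dots> 1 S"
      by (rule exec_Push_eq) (simp_all add: assms hd_bit_select)
    finally show "exec (clear r_work ;; Push v (hd_bit ((R(a := [], r_work := ?xs)) r_work)))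
        ((R(a := [], r_work := ?xs))(r_work := tl ((R(a := [], r_work := ?xs)) r_work)))
        (2 * n + 3) S"
      by (simp add: numeral_3_eq_3)
  qed simp
  finally show ?thesis unfolding lookup_def
    by (rule exec_mono) (use quad_gt[of n] loop_le_quad[OF assms(9), of 7 10] assms(8) in simp)
qed

text \<open>Two numbers are compared from the least significant bit on, so the last difference found
  decides.\<close>

definition comparison :: "nat \<Rightarrow> nat \<Rightarrow> bool list" where
  "comparison m n = (if m = n then [] else [m < n])"

lemma comparison_eq_Nil: "comparison m n = [] \<longleftrightarrow> m = n"
  and comparison_eq_True: "comparison m n = [True] \<longleftrightarrow> m < n"
  and length_comparison: "length (comparison m n) \<le> 1"
  by (auto simp: comparison_def)

lemma comparison_take_Suc:
  "comparison (bits_to_nat (take (Suc i) xs)) (bits_to_nat (take (Suc i) ys)) =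
    (if nth_bit xs i = nth_bit ys i
     then comparison (bits_to_nat (take i xs)) (bits_to_nat (take i ys))
     else [nth_bit ys i])"
proof -
  have "bits_to_nat (take i zs) < 2 ^ i" for zs
    using bits_to_nat_less[of "take i zs"] by (rule less_le_trans) (simp add: power_increasing)
  from this[of xs] this[of ys] show ?thesis by (auto simp: bits_to_nat_take_Suc comparison_def)
qed

definition set_flag :: "bool \<Rightarrow> com" where
  "set_flag b = read_bit r_flag (\<lambda>_. Push r_flag b)"

lemma exec_set_flag:
  assumes "length (R r_flag) \<le> 1" "S = R(r_flag := [b])"
  shows "exec (set_flag b) R 2 S"
  unfolding set_flag_def
  by (rule exec_read_bit[where t = 1], rule exec_Push_eq) (use assms in \<open>cases "R r_flag", auto\<close>)

definition compare :: "nat \<Rightarrow> nat \<Rightarrow> com" where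
  "compare a b = Loop a (\<lambda>x. read_bit b (\<lambda>y. if x = y then Skip else set_flag y)) ;;
     Loop b (\<lambda>y. if y then set_flag True else Skip)"

lemma exec_compare:
  assumes "a \<noteq> r_flag" "b \<noteq> r_flag" "a \<noteq> b" "R r_flag = []"
    "S = R(a := [], b := [], r_flag := comparison (bits_to_nat (R a)) (bits_to_nat (R b)))"
  shows "exec (compare a b) R (4 * length (R a) + 3 * length (R b) + 3) S"
proof -
  let ?xs = "R a" and ?ys = "R b"
  let ?S = "\<lambda>j. R(a := drop j ?xs, b := drop j ?ys,
    r_flag := comparison (bits_to_nat (take j ?xs)) (bits_to_nat (take j ?ys)))"
  have "exec (Loop a (\<lambda>x. read_bit b (\<lambda>y. if x = y then Skip else set_flag y))) R
      (4 * length ?xs + 1) (?S (length ?xs))"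
  proof (rule exec_Loop[where S = ?S and t = 3])
    fix j assume j: "j < length ?xs"
    let ?y = "nth_bit ?ys j"
    have "exec (if ?xs ! j = ?y then Skip else set_flag ?y)
        ((?S j)(a := drop (Suc j) ?xs, b := drop (Suc j) ?ys)) 2 (?S (Suc j))"
      using j assms(1-3) length_comparison
      by (auto intro!: exec_Skip_eq exec_set_flag simp: fun_eq_iff comparison_take_Suc nth_bit_def)
    then show "exec (read_bit b (\<lambda>y. if ?xs ! j = y then Skip else set_flag y))
        ((?S j)(a := drop (Suc j) ?xs)) 3 (?S (Suc j))"
      using assms(1-3)
      by (auto intro!: exec_read_bit[where t = 2] simp: hd_bit_drop drop_Suc tl_drop)
  qed (use assms(1-4) in \<open>auto simp: fun_eq_iff comparison_def\<close>)
  also have "exec (Loop b (\<lambda>y. if y then set_flag True else Skip)) (?S (length ?xs))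
      (3 * length ?ys + 1) S"
  proof (rule exec_Loop[where S = "\<lambda>j. ?S (length ?xs + j)" and t = 2])
    let ?zs = "?S (length ?xs) b"
    have zs: "?zs = drop (length ?xs) ?ys" using assms(2) by simp
    fix j assume "j < length ?zs"
    then show "exec (if ?zs ! j then set_flag True else Skip)
        ((?S (length ?xs + j))(b := drop (Suc j) ?zs)) 2 (?S (length ?xs + Suc j))"
      using assms(1-3) length_comparison comparison_take_Suc[of "length ?xs + j" ?xs ?ys]
      by (auto intro!: exec_Skip_eq exec_set_flag simp: zs fun_eq_iff nth_bit_def add.commute)
  qed (use assms in \<open>auto simp: fun_eq_iff add.commute\<close>)
  finally show ?thesis unfolding compare_def by (rule exec_mono) simp
qed

section \<open>The verifier\<close>

text \<open>Besides the scratch registers: the number of gates of D is expected in unary in \<open>r_gates\<close>,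
  \<open>r_wires\<close> holds the wire values of D, and \<open>r_tests\<close> the outcomes of the tests, the last one
  first.\<close>

abbreviation (input) r_input :: nat where "r_input \<equiv> 0"
abbreviation (input) r_random :: nat where "r_random \<equiv> Suc 0"
abbreviation (input) r_alice :: nat where "r_alice \<equiv> 2"
abbreviation (input) r_bob :: nat where "r_bob \<equiv> 3"
abbreviation (input) r_ques1 :: nat where "r_ques1 \<equiv> 4"
abbreviation (input) r_ques2 :: nat where "r_ques2 \<equiv> 5"
abbreviation (input) r_gates :: nat where "r_gates \<equiv> 6"
abbreviation (input) r_wires :: nat where "r_wires \<equiv> 7"
abbreviation (input) r_index :: nat where "r_index \<equiv> 8"
abbreviation (input) r_size :: nat where "r_size \<equiv> 12"
abbreviation (input) r_target :: nat where "r_target \<equiv> 13"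
abbreviation (input) r_kind :: nat where "r_kind \<equiv> 14"
abbreviation (input) r_in1 :: nat where "r_in1 \<equiv> 15"
abbreviation (input) r_in2 :: nat where "r_in2 \<equiv> 16"
abbreviation (input) r_left :: nat where "r_left \<equiv> 17"
abbreviation (input) r_right :: nat where "r_right \<equiv> 18"
abbreviation (input) r_count :: nat where "r_count \<equiv> 19"
abbreviation (input) r_tests :: nat where "r_tests \<equiv> 20"
abbreviation (input) r_onehot :: nat where "r_onehot \<equiv> 21"

definition token_gate :: "bool list \<Rightarrow> gkind" where
  "token_gate bs = kind_of_code (bits_to_nat (take 3 bs))"

definition eval_step :: "bool list \<times> bool list \<Rightarrow> bool list \<times> bool list" where
  "eval_step = (\<lambda>(w, xs). (w @ [gate_val (token_gate (first_token xs)) (nth_bit w (number_at 1 xs))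
     (nth_bit w (number_at 2 xs))], (drop_token ^^ 3) xs))"

definition gate_step :: com where
  "gate_step = get_token r_input r_kind ;; get_token r_input r_index ;;
     lookup r_wires r_index r_left ;;
     get_token r_input r_index ;; lookup r_wires r_index r_right ;; move r_wires r_acc ;;
     read_bits [r_kind, r_kind, r_kind, r_left, r_right]
       (\<lambda>bs. Push r_acc (gate_val (token_gate bs) (bs ! 3) (bs ! 4))) ;;
     clear r_kind ;; move r_acc r_wires"

lemma token_gate_padded:
  "token_gate (hd_bit bs # hd_bit (tl bs) # hd_bit (tl (tl bs)) # cs) = token_gate bs"
proof (cases "bs = [] \<or> tl bs = [] \<or> tl (tl bs) = []")
  case True
  then show ?thesis
    by (cases bs; cases "tl bs"; cases "tl (tl bs)") (auto simp: token_gate_def bits_to_nat_Cons)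
next
  case False
  then show ?thesis by (cases bs; cases "tl bs"; cases "tl (tl bs)") (auto simp: token_gate_def)
qed

lemma exec_gate_step:
  assumes "R r_index = []" "R r_work = []" "R r_acc = []" "R r_flag = []"
      "R r_kind = []" "R r_left = []" "R r_right = []"
    and "length (R r_input) \<le> n" "length (R r_wires) \<le> n"
    and "S = R(r_wires := fst (eval_step (R r_wires, R r_input)),
      r_input := snd (eval_step (R r_wires, R r_input)))"
  shows "exec gate_step R (150 * quad n) S"
proof -
  let ?w = "R r_wires" and ?x = "\<lambda>i. (drop_token ^^ i) (R r_input)"
  let ?tok = "\<lambda>i. first_token (?x i)"
  let ?left = "nth_bit ?w (number_at 1 (R r_input))"
    and ?right = "nth_bit ?w (number_at 2 (R r_input))"
  let ?g = "gate_val (token_gate (?tok 0)) ?left ?right"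
  have len: "length (?x i) \<le> n" "length (?tok i) \<le> n" for i
    using length_drop_tokens[of i "R r_input"] length_first_token[of "?x i"] assms(8) by linarith+
  have "exec (get_token r_input r_kind) R (12 * n + 14) (R(r_input := ?x 1, r_kind := ?tok 0))"
    by (rule exec_mono[OF exec_get_token]) (use assms len[of 0] in auto)
  also have "exec (get_token r_input r_index) \<dots> (12 * n + 14)
      (R(r_input := ?x 2, r_kind := ?tok 0, r_index := ?tok 1))"
    by (rule exec_mono[OF exec_get_token])
      (use assms len[of 1] in \<open>auto simp: fun_eq_iff numeral_2_eq_2\<close>)
  also have "exec (lookup r_wires r_index r_left) \<dots> (40 * quad n)
      (R(r_input := ?x 2, r_kind := ?tok 0, r_left := [?left]))"
    by (rule exec_lookup) (use assms len[of 1] in \<open>auto simp: fun_eq_iff number_at_def\<close>)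
  also have "exec (get_token r_input r_index) \<dots> (12 * n + 14)
      (R(r_input := ?x 3, r_kind := ?tok 0, r_left := [?left], r_index := ?tok 2))"
    by (rule exec_mono[OF exec_get_token])
      (use assms len[of 2] in \<open>auto simp: fun_eq_iff numeral_3_eq_3 numeral_2_eq_2\<close>)
  also have "exec (lookup r_wires r_index r_right) \<dots> (40 * quad n)
      (R(r_input := ?x 3, r_kind := ?tok 0, r_left := [?left], r_right := [?right]))"
    by (rule exec_lookup) (use assms len[of 2] in \<open>auto simp: fun_eq_iff number_at_def\<close>)
  also have "exec (move r_wires r_acc) \<dots> (2 * n + 1)
      (R(r_input := ?x 3, r_kind := ?tok 0, r_left := [?left], r_right := [?right],
        r_wires := [], r_acc := rev ?w))"
    by (rule exec_mono[OF exec_move]) (use assms in auto)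
  also have "exec (read_bits [r_kind, r_kind, r_kind, r_left, r_right]
      (\<lambda>bs. Push r_acc (gate_val (token_gate bs) (bs ! 3) (bs ! 4)))) \<dots> 6
      (R(r_input := ?x 3, r_kind := tl (tl (tl (?tok 0))), r_wires := [], r_acc := ?g # rev ?w))"
    by (rule exec_mono[OF exec_read_bits[where t = 1]], rule exec_Push_eq)
      (use assms in \<open>auto simp: fun_eq_iff token_gate_padded\<close>)
  also have "exec (clear r_kind) \<dots> (2 * n + 1)
      (R(r_input := ?x 3, r_wires := [], r_acc := ?g # rev ?w))"
    by (rule exec_mono[OF exec_clear]) (use assms len(2)[of 0] in \<open>auto simp: fun_eq_iff\<close>)
  also have "exec (move r_acc r_wires) \<dots> (2 * n + 3) S"
    by (rule exec_mono[OF exec_move]) (use assms in \<open>auto simp: fun_eq_iff eval_step_def\<close>)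
  finally show ?thesis unfolding gate_step_def by (rule exec_mono) (use quad_gt[of n] in simp)
qed

lemma length_eval_step:
  "length (fst (eval_step p)) = Suc (length (fst p))" "length (snd (eval_step p)) \<le> length (snd p)"
  using length_drop_tokens[of 3 "snd p"] by (auto simp: eval_step_def split: prod.split)

lemma length_eval_steps:
  "length (fst ((eval_step ^^ i) p)) = length (fst p) + i"
  "length (snd ((eval_step ^^ i) p)) \<le> length (snd p)"
  by (induction i) (auto simp: length_eval_step intro: le_trans[OF length_eval_step(2)])

lemma exec_gates_loop:
  assumes "R r_index = []" "R r_work = []" "R r_acc = []" "R r_flag = []" "R r_kind = []"
      "R r_left = []" "R r_right = []"
    and "length (R r_input) \<le> n" "length (R r_wires) + length (R r_gates) \<le> n"
    and "S = R(r_gates := [],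
      r_wires := fst ((eval_step ^^ length (R r_gates)) (R r_wires, R r_input)),
      r_input := snd ((eval_step ^^ length (R r_gates)) (R r_wires, R r_input)))"
  shows "exec (Loop r_gates (\<lambda>_. gate_step)) R (151 * cube n) S"
proof -
  let ?us = "R r_gates" and ?p = "\<lambda>j. (eval_step ^^ j) (R r_wires, R r_input)"
  let ?S = "\<lambda>j. R(r_gates := drop j ?us, r_wires := fst (?p j), r_input := snd (?p j))"
  show ?thesis
  proof (rule exec_Loop[where S = ?S and t = "150 * quad n"])
    fix j assume "j < length ?us"
    then show "exec gate_step ((?S j)(r_gates := drop (Suc j) ?us)) (150 * quad n) (?S (Suc j))"
      using assms length_eval_steps[of j "(R r_wires, R r_input)"]
      by (intro exec_gate_step) (auto simp: fun_eq_iff)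
  qed (use assms loop_le_cube[of "length ?us" n 150] in auto)
qed

definition output_bits :: "bool list \<Rightarrow> bool list \<Rightarrow> nat \<Rightarrow> bool list" where
  "output_bits w xs k = map (\<lambda>i. nth_bit w (number_at i xs)) [0..<k]"

lemma length_output_bits [simp]: "length (output_bits w xs k) = k"
  by (simp add: output_bits_def)

definition read_output :: com where
  "read_output = get_token r_input r_index ;; lookup r_wires r_index r_left"

definition read_outputs :: "nat \<Rightarrow> com" where
  "read_outputs d = Loop r_count (\<lambda>_. read_output) ;; move r_left d"

lemma exec_read_output:
  assumes "R r_index = []" "R r_work = []" "R r_acc = []" "R r_flag = []"
    and "length (R r_input) \<le> n" "length (R r_wires) \<le> n"
    and "S = R(r_input := drop_token (R r_input),
      r_left := nth_bit (R r_wires) (number_at 0 (R r_input)) # R r_left)"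
  shows "exec read_output R (60 * quad n) S"
proof -
  let ?tok = "first_token (R r_input)"
  have len: "length ?tok \<le> n" using length_first_token[of "R r_input"] assms(5) by linarith
  have "exec (get_token r_input r_index) R (12 * n + 14)
      (R(r_input := drop_token (R r_input), r_index := ?tok))"
    by (rule exec_mono[OF exec_get_token]) (use assms in auto)
  also have "exec (lookup r_wires r_index r_left) \<dots> (40 * quad n) S"
    by (rule exec_lookup) (use assms len in \<open>auto simp: fun_eq_iff number_at_def\<close>)
  finally show ?thesis unfolding read_output_def by (rule exec_mono) (use quad_gt[of n] in simp)
qed

lemma exec_read_outputs:
  assumes "R r_index = []" "R r_work = []" "R r_acc = []" "R r_flag = []" "R r_left = []" "R d = []"
    and "d \<notin> {r_input, r_wires, r_left, r_count}"
    and "length (R r_input) \<le> n" "length (R r_wires) \<le> n" "length (R r_count) \<le> n"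
    and "S = R(r_count := [], r_input := (drop_token ^^ length (R r_count)) (R r_input),
           d := output_bits (R r_wires) (R r_input) (length (R r_count)))"
  shows "exec (read_outputs d) R (65 * cube n) S"
proof -
  let ?us = "R r_count" and ?x = "\<lambda>i. (drop_token ^^ i) (R r_input)"
  let ?out = "output_bits (R r_wires) (R r_input)"
  let ?S = "\<lambda>j. R(r_count := drop j ?us, r_input := ?x j, r_left := rev (?out j))"
  have "exec (Loop r_count (\<lambda>_. read_output)) R (61 * cube n)
      (R(r_count := [], r_input := ?x (length ?us), r_left := rev (?out (length ?us))))"
  proof (rule exec_Loop[where S = ?S and t = "60 * quad n"])
    show "R = ?S 0" using assms by (auto simp: fun_eq_iff output_bits_def)
    fix j assume "j < length ?us"
    then show "exec read_output ((?S j)(r_count := drop (Suc j) ?us)) (60 * quad n) (?S (Suc j))"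
      using assms length_drop_tokens[of j "R r_input"]
      by (intro exec_read_output) (auto simp: fun_eq_iff output_bits_def number_at_def)
  qed (use assms loop_le_cube[of "length ?us" n 60] in auto)
  also have "exec (move r_left d) \<dots> (2 * n + 1) S"
    by (rule exec_mono[OF exec_move]) (use assms in \<open>auto simp: fun_eq_iff\<close>)
  finally show ?thesis
    unfolding read_outputs_def by (rule exec_mono) (use quad_gt[of n] quad_le_cube[of n] in simp)
qed

text \<open>A length is compared with a binary number by a lookup in a one-hot list.\<close>

definition check_length :: "nat \<Rightarrow> com" where
  "check_length a = copy a r_count ;; Push r_onehot True ;; Loop r_count (\<lambda>_. Push r_onehot False) ;;
     get_token r_input r_index ;; lookup r_onehot r_index r_tests ;; clear r_onehot"

lemma nth_bit_onehot: "nth_bit (replicate k False @ [True]) i \<longleftrightarrow> i = k"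
  by (auto simp: nth_bit_def nth_append)

lemma exec_onehot_loop:
  assumes "S = R(r_count := [], r_onehot := replicate (length (R r_count)) False @ R r_onehot)"
  shows "exec (Loop r_count (\<lambda>_. Push r_onehot False)) R (2 * length (R r_count) + 1) S"
  by (rule exec_Loop[where t = 1
      and S = "\<lambda>j. R(r_count := drop j (R r_count), r_onehot := replicate j False @ R r_onehot)"])
    (use assms in \<open>auto intro!: exec_Push_eq\<close>)

lemma exec_check_length:
  assumes "R r_index = []" "R r_work = []" "R r_acc = []" "R r_flag = []" "R r_count = []"
      "R r_onehot = []"
    and "a \<notin> {r_input, r_index, r_work, r_acc, r_flag, r_count, r_tests, r_onehot}"
    and "length (R r_input) \<le> n" "length (R a) < n"
    and "S = R(r_input := drop_token (R r_input),
      r_tests := (number_at 0 (R r_input) = length (R a)) # R r_tests)"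
  shows "exec (check_length a) R (100 * quad n) S"
proof -
  let ?onehot = "replicate (length (R a)) False @ [True]" and ?tok = "first_token (R r_input)"
  have len: "length ?tok \<le> n" using length_first_token[of "R r_input"] assms(8) by linarith
  have "exec (copy a r_count) R (6 * n + 3) (R(r_count := R a))"
    by (rule exec_mono[OF exec_copy]) (use assms in auto)
  also have "exec (Push r_onehot True) \<dots> 1 (R(r_count := R a, r_onehot := [True]))"
    by (rule exec_Push_eq) (use assms in auto)
  also have "exec (Loop r_count (\<lambda>_. Push r_onehot False)) \<dots> (2 * n + 1) (R(r_onehot := ?onehot))"
    by (rule exec_mono[OF exec_onehot_loop]) (use assms in \<open>auto simp: fun_eq_iff\<close>)
  also have "exec (get_token r_input r_index) \<dots> (12 * n + 14)
      (R(r_onehot := ?onehot, r_input := drop_token (R r_input), r_index := ?tok))"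
    by (rule exec_mono[OF exec_get_token]) (use assms in auto)
  also have "exec (lookup r_onehot r_index r_tests) \<dots> (40 * quad n) (S(r_onehot := ?onehot))"
    by (rule exec_lookup)
      (use assms len in \<open>auto simp: fun_eq_iff number_at_def nth_bit_onehot\<close>)
  also have "exec (clear r_onehot) \<dots> (2 * n + 1) S"
    by (rule exec_mono[OF exec_clear]) (use assms in \<open>auto simp: fun_eq_iff\<close>)
  finally show ?thesis unfolding check_length_def by (rule exec_mono) (use quad_gt[of n] in simp)
qed

definition push_comparison :: "nat \<Rightarrow> nat \<Rightarrow> bool list \<Rightarrow> com" where
  "push_comparison a b c = copy a r_count ;; compare r_count b ;;
     Case r_flag (Push r_tests (c = [])) (\<lambda>x. Push r_tests (c = [x]))"

lemma exec_push_comparison: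
  assumes "R r_acc = []" "R r_flag = []" "R r_count = []" "a \<notin> {r_acc, r_flag, r_count, r_tests}"
    and "b \<notin> {r_acc, r_flag, r_count, r_tests}" "a \<noteq> b" "length (R a) \<le> n" "length (R b) \<le> n"
    and "S = R(b := [],
      r_tests := (comparison (bits_to_nat (R a)) (bits_to_nat (R b)) = c) # R r_tests)"
  shows "exec (push_comparison a b c) R (20 * quad n) S"
proof -
  let ?c = "comparison (bits_to_nat (R a)) (bits_to_nat (R b))"
  have "exec (copy a r_count) R (6 * n + 3) (R(r_count := R a))"
    by (rule exec_mono[OF exec_copy]) (use assms in auto)
  also have "exec (compare r_count b) \<dots> (7 * n + 3) (R(b := [], r_flag := ?c))"
    by (rule exec_mono[OF exec_compare]) (use assms in \<open>auto simp: fun_eq_iff\<close>)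
  also have "exec (Case r_flag (Push r_tests (c = [])) (\<lambda>x. Push r_tests (c = [x]))) \<dots> 2 S"
  proof (cases ?c)
    case Nil
    then show ?thesis
      by (intro exec_Case_Nil[where t = 1] exec_Push_eq) (use assms in \<open>auto simp: fun_eq_iff\<close>)
  next
    case (Cons x xs)
    then have "?c = [x]" using length_comparison[of "bits_to_nat (R a)" "bits_to_nat (R b)"] by simp
    then show ?thesis
      by (intro exec_Case_Cons[where f = "\<lambda>x. Push r_tests (c = [x])" and b = x and bs = "[]"
            and t = 1] exec_Push_eq)
        (use assms in \<open>auto simp: fun_eq_iff\<close>)
  qed
  finally show ?thesis unfolding push_comparison_def by (rule exec_mono) (use quad_gt[of n] in simp)
qed

definition ask :: com where
  "ask = get_token r_random r_ques1 ;; get_token r_random r_ques2 ;; clear r_input ;;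
     clear r_random ;; copy r_ques1 r_input ;; copy r_ques2 r_random"

lemma exec_ask:
  assumes "length x \<le> n" "length r \<le> n"
  shows "\<exists>S. exec ask (init_store [x, r]) (60 * quad n) S \<and> S 0 = first_token r
      \<and> S 1 = first_token (drop_token r)"
proof -
  let ?R = "init_store [x, r]" and ?s = "first_token r" and ?t = "first_token (drop_token r)"
  let ?S = "?R(r_ques1 := ?s, r_ques2 := ?t, r_input := ?s, r_random := ?t)"
  have R: "?R r_input = x" "?R r_random = r" "2 \<le> i \<Longrightarrow> ?R i = []" for i
    by (auto simp: init_store_def)
  have len: "length ?s \<le> n" "length ?t \<le> n" "length (drop_token r) \<le> n"
      "length (drop_token (drop_token r)) \<le> n"
    using assms length_tokens[of r] length_tokens[of "drop_token r"] by linarith+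
  have "exec (get_token r_random r_ques1) ?R (12 * n + 14)
      (?R(r_random := drop_token r, r_ques1 := ?s))"
    by (rule exec_mono[OF exec_get_token]) (use assms R in auto)
  also have "exec (get_token r_random r_ques2) \<dots> (12 * n + 14)
      (?R(r_random := drop_token (drop_token r), r_ques1 := ?s, r_ques2 := ?t))"
    by (rule exec_mono[OF exec_get_token]) (use len R in auto)
  also have "exec (clear r_input) \<dots> (2 * n + 1)
      (?R(r_random := drop_token (drop_token r), r_ques1 := ?s, r_ques2 := ?t, r_input := []))"
    by (rule exec_mono[OF exec_clear]) (use assms R in auto)
  also have "exec (clear r_random) \<dots> (2 * n + 1)
      (?R(r_random := [], r_ques1 := ?s, r_ques2 := ?t, r_input := []))"
    by (rule exec_mono[OF exec_clear]) (use len in auto)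
  also have "exec (copy r_ques1 r_input) \<dots> (6 * n + 3)
      (?R(r_random := [], r_ques1 := ?s, r_ques2 := ?t, r_input := ?s))"
    by (rule exec_mono[OF exec_copy]) (use len R in auto)
  also have "exec (copy r_ques2 r_random) \<dots> (6 * n + 3) ?S"
    by (rule exec_mono[OF exec_copy]) (use len R in auto)
  finally have "exec ask ?R (60 * quad n) ?S"
    unfolding ask_def by (rule exec_mono) (use quad_gt[of n] in simp)
  moreover have "?S 0 = ?s" "?S 1 = ?t" by simp_all
  ultimately show ?thesis by blast
qed

text \<open>Alice is asked for gate i of kind g and inputs a and b, and claims that a and b have the
  values u and v; Bob is asked for gate j and claims that it has the value c.\<close>

definition caught :: "nat \<Rightarrow> nat \<Rightarrow> gkind \<Rightarrow> nat \<Rightarrow> nat \<Rightarrow> nat \<Rightarrow> nat \<Rightarrow> bool \<Rightarrow> bool \<Rightarrow> bool \<Rightarrow> bool" where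
  "caught N k g a b i j u v c \<longleftrightarrow> j = k \<and> \<not> c \<or>
     i < N \<and> (j = i \<and> c \<noteq> gate_val g u v \<or> j = a \<and> c \<noteq> u \<or> j = b \<and> c \<noteq> v)"

text \<open>The random string supplies the questions and, as its third component, the number of gates of D
  in unary; if it fails to do so, the verifier accepts.\<close>

definition accepts :: "bool list \<Rightarrow> bool list \<Rightarrow> bool list \<Rightarrow> bool list \<Rightarrow> bool" where
  "accepts x r y z =
     (let s = first_token r; m = length s; u = first_token ((drop_token ^^ 2) r);
        (w, xs) = (eval_step ^^ length u) (s, (drop_token ^^ 4) x);
        a = output_bits w ((drop_token ^^ 3) xs) m; b = output_bits w ((drop_token ^^ (m + 3)) xs) m
      in number_at 2 x = m \<and> number_at 3 x = length u \<longrightarrow>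
        \<not> caught (number_at 0 x) (number_at 1 x) (token_gate (output_bits w xs 3))
          (bits_to_nat a) (bits_to_nat b) (bits_to_nat s) (number_at 1 r)
          (hd_bit y) (hd_bit (tl y)) (hd_bit z))"

definition parse :: com where
  "parse = get_token r_random r_ques1 ;; get_token r_random r_ques2 ;; get_token r_random r_gates ;;
     get_token r_input r_size ;; get_token r_input r_target ;;
     check_length r_ques1 ;; check_length r_gates"

lemma exec_parse:
  assumes R: "R = init_store [x, r, y, z]" and len: "length x < n" "length r < n"
    and s: "s = first_token r" and u: "u = first_token ((drop_token ^^ 2) r)"
    and S: "S = R(r_random := (drop_token ^^ 3) r, r_ques1 := s,
      r_ques2 := first_token (drop_token r), r_gates := u,
      r_input := (drop_token ^^ 4) x, r_size := first_token x,
      r_target := first_token (drop_token x),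
      r_tests := [number_at 3 x = length u, number_at 2 x = length s])"
  shows "exec parse R (300 * quad n) S"
proof -
  let ?r = "\<lambda>i. (drop_token ^^ i) r" and ?x = "\<lambda>i. (drop_token ^^ i) x"
  have R_simps: "R r_input = x" "R r_random = r" "R r_alice = y" "R r_bob = z"
    "4 \<le> i \<Longrightarrow> R i = []" for i
    by (auto simp: R init_store_def)
  have bounds: "length (?r i) < n" "length (?x i) < n" "length (first_token (?r i)) < n" for i
    using len length_drop_tokens[of i r] length_drop_tokens[of i x] length_first_token[of "?r i"]
    by linarith+
  have numerals: "?x 2 = drop_token (drop_token x)" "?x 3 = drop_token (?x 2)"
    "?x 4 = drop_token (?x 3)" "?r 2 = drop_token (drop_token r)" "?r 3 = drop_token (?r 2)"
    by (simp_all add: eval_nat_numeral)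
  have "exec (get_token r_random r_ques1) R (12 * n + 14) (R(r_random := ?r 1, r_ques1 := s))"
    by (rule exec_mono[OF exec_get_token]) (use len in \<open>auto simp: R_simps s\<close>)
  also have "exec (get_token r_random r_ques2) \<dots> (12 * n + 14)
      (R(r_random := ?r 2, r_ques1 := s, r_ques2 := first_token (drop_token r)))"
    by (rule exec_mono[OF exec_get_token])
      (use bounds[of 1] in \<open>auto simp: R_simps fun_eq_iff numerals\<close>)
  also have "exec (get_token r_random r_gates) \<dots> (12 * n + 14)
      (R(r_random := ?r 3, r_ques1 := s, r_ques2 := first_token (drop_token r), r_gates := u))"
    (is "exec _ _ _ ?S")
    by (rule exec_mono[OF exec_get_token])
      (use bounds[of 2] in \<open>auto simp: R_simps fun_eq_iff u numerals(5)\<close>)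
  also have "exec (get_token r_input r_size) \<dots> (12 * n + 14)
      (?S(r_input := ?x 1, r_size := first_token x))"
    by (rule exec_mono[OF exec_get_token]) (use len in \<open>auto simp: R_simps fun_eq_iff\<close>)
  also have "exec (get_token r_input r_target) \<dots> (12 * n + 14)
      (?S(r_input := ?x 2, r_size := first_token x, r_target := first_token (drop_token x)))"
    (is "exec _ _ _ ?T")
    by (rule exec_mono[OF exec_get_token])
      (use bounds[of 1] in \<open>auto simp: R_simps fun_eq_iff numerals(1)\<close>)
  also have "exec (check_length r_ques1) \<dots> (100 * quad n)
      (?T(r_input := ?x 3, r_tests := [number_at 2 x = length s]))"
    by (rule exec_check_length)
      (use bounds[of 2] bounds[of 0] in
          \<open>auto simp: R_simps fun_eq_iff numerals(2) number_at_def s\<close>)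
  also have "exec (check_length r_gates) \<dots> (100 * quad n) S"
    by (rule exec_check_length)
      (use bounds[of 3] bounds[of 2] in
        \<open>auto simp: S R_simps fun_eq_iff numerals(3) number_at_def u\<close>)
  finally show ?thesis unfolding parse_def by (rule exec_mono) (use quad_gt[of n] in simp)
qed

definition evaluate :: com where
  "evaluate = copy r_ques1 r_wires ;; Loop r_gates (\<lambda>_. gate_step) ;;
     (Push r_count True ;; Push r_count True ;; Push r_count True) ;; read_outputs r_kind ;;
     copy r_ques1 r_count ;; read_outputs r_in1 ;; copy r_ques1 r_count ;; read_outputs r_in2"

lemma exec_evaluate:
  assumes empty: "R r_wires = []" "R r_index = []" "R r_work = []" "R r_acc = []" "R r_flag = []"
      "R r_kind = []" "R r_in1 = []" "R r_in2 = []" "R r_left = []" "R r_right = []" "R r_count = []"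
    and len: "length (R r_input) \<le> n" "length (R r_ques1) + length (R r_gates) \<le> n" "3 \<le> n"
    and eval: "(w, xs) = (eval_step ^^ length (R r_gates)) (R r_ques1, R r_input)"
    and m: "m = length (R r_ques1)"
    and S: "S = R(r_gates := [], r_wires := w,
      r_input := (drop_token ^^ m) ((drop_token ^^ (m + 3)) xs), r_kind := output_bits w xs 3,
      r_in1 := output_bits w ((drop_token ^^ 3) xs) m,
      r_in2 := output_bits w ((drop_token ^^ (m + 3)) xs) m)"
  shows "exec evaluate R (400 * cube n) S"
proof -
  let ?xs = "\<lambda>i. (drop_token ^^ i) xs" and ?kind = "output_bits w xs 3"
    and ?in1 = "output_bits w ((drop_token ^^ 3) xs) m"
  have len_w: "length w \<le> n" and len_xs: "length (?xs i) \<le> n" for i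
    using length_eval_steps[of "length (R r_gates)" "(R r_ques1, R r_input)"]
        length_drop_tokens[of i xs] len
    unfolding eval[symmetric] by simp_all
  have "exec (copy r_ques1 r_wires) R (6 * n + 3) (R(r_wires := R r_ques1))"
    by (rule exec_mono[OF exec_copy]) (use empty len in auto)
  also have "exec (Loop r_gates (\<lambda>_. gate_step)) \<dots> (151 * cube n)
      (R(r_gates := [], r_wires := w, r_input := xs))" (is "exec _ _ _ ?S")
    by (rule exec_gates_loop) (use empty len in \<open>auto simp: fun_eq_iff simp flip: eval\<close>)
  also have "exec (Push r_count True ;; Push r_count True ;; Push r_count True) \<dots> 5
      (?S(r_count := [True, True, True]))"
    by (rule exec_Seq[where t = 3 and u = 1], rule exec_Seq[where t = 1 and u = 1];
        (rule exec_Push)?) (simp_all add: empty exec_Push_eq)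
  also have "exec (read_outputs r_kind) \<dots> (65 * cube n) (?S(r_input := ?xs 3, r_kind := ?kind))"
    by (rule exec_read_outputs)
      (use empty len_w len_xs[of 0] len in \<open>auto simp: fun_eq_iff numeral_3_eq_3\<close>)
  also have "exec (copy r_ques1 r_count) \<dots> (6 * n + 3)
      (?S(r_input := ?xs 3, r_kind := ?kind, r_count := R r_ques1))"
    by (rule exec_mono[OF exec_copy]) (use empty len in auto)
  also have "exec (read_outputs r_in1) \<dots> (65 * cube n)
      (?S(r_input := ?xs (m + 3), r_kind := ?kind, r_in1 := ?in1))"
    by (rule exec_read_outputs)
      (use empty len_w len_xs[of 3] len in \<open>auto simp: fun_eq_iff m funpow_add\<close>)
  also have "exec (copy r_ques1 r_count) \<dots> (6 * n + 3)
      (?S(r_input := ?xs (m + 3), r_kind := ?kind, r_in1 := ?in1, r_count := R r_ques1))"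
    by (rule exec_mono[OF exec_copy]) (use empty len in auto)
  also have "exec (read_outputs r_in2) \<dots> (65 * cube n) S"
    by (rule exec_read_outputs)
      (use empty len_w len_xs[of "m + 3"] len in \<open>auto simp: S fun_eq_iff m\<close>)
  finally show ?thesis
    unfolding evaluate_def by (rule exec_mono) (use quad_gt[of n] quad_le_cube[of n] len(3) in simp)
qed

definition run_tests :: com where
  "run_tests = push_comparison r_ques2 r_target [] ;; push_comparison r_ques1 r_size [True] ;;
     push_comparison r_ques2 r_ques1 [] ;; push_comparison r_ques2 r_in1 [] ;;
     push_comparison r_ques2 r_in2 []"

lemma exec_run_tests:
  assumes "R r_acc = []" "R r_flag = []" "R r_count = []"
    and "length (R r_ques1) \<le> n" "length (R r_ques2) \<le> n" "length (R r_size) \<le> n"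
    and "length (R r_target) \<le> n" "length (R r_in1) \<le> n" "length (R r_in2) \<le> n"
    and i: "i = bits_to_nat (R r_ques1)" and j: "j = bits_to_nat (R r_ques2)"
    and S: "S = R(r_target := [], r_size := [], r_ques1 := [], r_in1 := [], r_in2 := [],
      r_tests := [j = bits_to_nat (R r_in2), j = bits_to_nat (R r_in1), j = i,
        i < bits_to_nat (R r_size), j = bits_to_nat (R r_target)] @ R r_tests)"
  shows "exec run_tests R (105 * quad n) S"
proof -
  let ?tests = "[j = i, i < bits_to_nat (R r_size), j = bits_to_nat (R r_target)] @ R r_tests"
  note comparison_simps = comparison_eq_Nil comparison_eq_True
  have "exec (push_comparison r_ques2 r_target []) R (20 * quad n)
      (R(r_target := [], r_tests := (j = bits_to_nat (R r_target)) # R r_tests))"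
    by (rule exec_push_comparison) (use assms in \<open>auto simp: comparison_simps\<close>)
  also have "exec (push_comparison r_ques1 r_size [True]) \<dots> (20 * quad n)
      (R(r_target := [], r_size := [], r_tests := tl ?tests))"
    by (rule exec_push_comparison) (use assms in \<open>auto simp: comparison_simps fun_eq_iff\<close>)
  also have "exec (push_comparison r_ques2 r_ques1 []) \<dots> (20 * quad n)
      (R(r_target := [], r_size := [], r_ques1 := [], r_tests := ?tests))"
    by (rule exec_push_comparison) (use assms in \<open>auto simp: comparison_simps fun_eq_iff\<close>)
  also have "exec (push_comparison r_ques2 r_in1 []) \<dots> (20 * quad n)
      (R(r_target := [], r_size := [], r_ques1 := [], r_in1 := [],
        r_tests := (j = bits_to_nat (R r_in1)) # ?tests))"
    by (rule exec_push_comparison) (use assms in \<open>auto simp: comparison_simps fun_eq_iff\<close>)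
  also have "exec (push_comparison r_ques2 r_in2 []) \<dots> (20 * quad n) S"
    by (rule exec_push_comparison) (use assms in \<open>auto simp: comparison_simps fun_eq_iff\<close>)
  finally show ?thesis unfolding run_tests_def by (rule exec_mono) (use quad_gt[of n] in simp)
qed

definition verdict :: "bool list \<Rightarrow> bool" where
  "verdict bs = (case bs of
     [is_in2, is_in1, is_i, below, is_target, gates_ok, wires_ok, k0, k1, k2, u, v, c] \<Rightarrow>
     wires_ok \<and> gates_ok \<longrightarrow> \<not> (is_target \<and> \<not> c \<or> below \<and>
       (is_i \<and> c \<noteq> gate_val (token_gate [k0, k1, k2]) u v \<or> is_in1 \<and> c \<noteq> u \<or> is_in2 \<and> c \<noteq> v)))"

definition judge :: com where
  "judge = clear r_input ;;
     read_bits (replicate 7 r_tests @ [r_kind, r_kind, r_kind, r_alice, r_alice, r_bob])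
       (\<lambda>bs. Push r_input (verdict bs))"

lemma exec_judge:
  assumes "length (R r_input) \<le> n"
    and "R r_tests = [j = b, j = a, j = i, i < N, j = k, gates_ok, wires_ok]"
  shows "\<exists>S. exec judge R (18 * quad n) S \<and> S 0 = [wires_ok \<and> gates_ok \<longrightarrow>
    \<not> caught N k (token_gate (R r_kind)) a b i j
      (hd_bit (R r_alice)) (hd_bit (tl (R r_alice))) (hd_bit (R r_bob))]"
proof -
  let ?rs = "replicate 7 r_tests @ [r_kind, r_kind, r_kind, r_alice, r_alice, r_bob]"
  let ?R = "R(r_input := [])"
  let ?S = "(store_read ?rs ?R)(r_input := [verdict (bits_read ?rs ?R)])"
  have "exec (clear r_input) R (2 * n + 1) ?R"
    by (rule exec_mono[OF exec_clear]) (use assms(1) in auto)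
  also have "exec (read_bits ?rs (\<lambda>bs. Push r_input (verdict bs))) \<dots> (length ?rs + 1) ?S"
    by (rule exec_read_bits, rule exec_Push_eq) (simp_all add: eval_nat_numeral)
  finally have "exec judge R (18 * quad n) ?S"
    unfolding judge_def by (rule exec_mono) (use quad_gt[of n] in simp)
  moreover have "verdict (bits_read ?rs ?R) \<longleftrightarrow> (wires_ok \<and> gates_ok \<longrightarrow>
    \<not> caught N k (token_gate (R r_kind)) a b i j
      (hd_bit (R r_alice)) (hd_bit (tl (R r_alice))) (hd_bit (R r_bob)))"
    using assms(2) by (simp add: eval_nat_numeral verdict_def caught_def token_gate_padded)
  ultimately show ?thesis by (intro exI[of _ ?S]) simp
qed

definition decide :: com where
  "decide = parse ;; evaluate ;; run_tests ;; judge"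

lemma exec_examine:
  assumes n: "length x < n" "length r < n" "3 \<le> n"
    and s: "s = first_token r" and t: "t = first_token (drop_token r)"
    and u: "u = first_token ((drop_token ^^ 2) r)"
    and eval: "(w, xs) = (eval_step ^^ length u) (s, (drop_token ^^ 4) x)"
    and a: "a = output_bits w ((drop_token ^^ 3) xs) (length s)"
    and b: "b = output_bits w ((drop_token ^^ (length s + 3)) xs) (length s)"
  shows "\<exists>S. exec (parse ;; evaluate ;; run_tests) (init_store [x, r, y, z]) (900 * cube n) S
    \<and> length (S r_input) \<le> n \<and> S r_alice = y \<and> S r_bob = z \<and> S r_kind = output_bits w xs 3
    \<and> S r_tests =
      [bits_to_nat t = bits_to_nat b, bits_to_nat t = bits_to_nat a, bits_to_nat t = bits_to_nat s,
       bits_to_nat s < number_at 0 x, bits_to_nat t = number_at 1 x,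
       number_at 3 x = length u, number_at 2 x = length s]"
proof -
  let ?R = "init_store [x, r, y, z]"
  define S1 where "S1 = ?R(r_random := (drop_token ^^ 3) r, r_ques1 := s, r_ques2 := t,
    r_gates := u, r_input := (drop_token ^^ 4) x, r_size := first_token x,
    r_target := first_token (drop_token x),
    r_tests := [number_at 3 x = length u, number_at 2 x = length s])"
  define S2 where "S2 = S1(r_gates := [], r_wires := w,
    r_input := (drop_token ^^ length s) ((drop_token ^^ (length s + 3)) xs),
    r_kind := output_bits w xs 3, r_in1 := a, r_in2 := b)"
  define S3 where "S3 = S2(r_target := [], r_size := [], r_ques1 := [], r_in1 := [], r_in2 := [],
    r_tests :=
    [bits_to_nat t = bits_to_nat b, bits_to_nat t = bits_to_nat a, bits_to_nat t = bits_to_nat s,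
     bits_to_nat s < number_at 0 x, bits_to_nat t = number_at 1 x] @ S2 r_tests)"
  have R: "?R r_alice = y" "?R r_bob = z" "4 \<le> i \<Longrightarrow> ?R i = []" for i by (auto simp: init_store_def)
  have len: "length s + length u \<le> n" "length t \<le> n" "length (first_token x) \<le> n"
    "length (first_token (drop_token x)) \<le> n" "length ((drop_token ^^ 4) x) \<le> n"
    using n length_tokens[of r] length_tokens[of "drop_token r"] length_tokens[of x]
      length_first_token[of "(drop_token ^^ 2) r"] length_first_token[of "drop_token x"]
      length_drop_tokens[of 4 x]
    by (simp_all add: s t u numeral_2_eq_2)
  have len': "length a = length s" "length b = length s"
      "length ((drop_token ^^ i) ((drop_token ^^ j) xs)) \<le> n" for i j
    using length_drop_tokens[of i "(drop_token ^^ j) xs"] length_drop_tokens[of j xs] len(5)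
      length_eval_steps(2)[of "length u" "(s, (drop_token ^^ 4) x)"]
    by (simp_all add: a b flip: eval)
  have "exec parse ?R (300 * quad n) S1"
    by (rule exec_parse) (use n in \<open>simp_all add: s t u S1_def\<close>)
  also have "exec evaluate S1 (400 * cube n) S2"
    by (rule exec_evaluate[where w = w and xs = xs and m = "length s"])
      (use len n in \<open>simp_all add: S1_def S2_def R eval a b fun_eq_iff\<close>)
  also have "exec run_tests S2 (105 * quad n) S3"
    by (rule exec_run_tests)
      (use len len' in \<open>simp_all add: S1_def S2_def S3_def R number_at_def fun_eq_iff\<close>)
  finally have "exec (parse ;; evaluate ;; run_tests) ?R (900 * cube n) S3"
    by (rule exec_mono) (use quad_gt[of n] quad_le_cube[of n] n(3) in simp)
  then show ?thesis by (intro exI[of _ S3]) (use len' in \<open>simp add: S1_def S2_def S3_def R\<close>)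
qed

lemma exec_decide:
  assumes "length x < n" "length r < n" "3 \<le> n"
  shows "\<exists>S. exec decide (init_store [x, r, y, z]) (1000 * cube n) S \<and> S 0 = [accepts x r y z]"
proof -
  define s where "s = first_token r"
  define t where "t = first_token (drop_token r)"
  define u where "u = first_token ((drop_token ^^ 2) r)"
  obtain w xs where eval: "(w, xs) = (eval_step ^^ length u) (s, (drop_token ^^ 4) x)"
    by (metis surj_pair)
  define a where "a = output_bits w ((drop_token ^^ 3) xs) (length s)"
  define b where "b = output_bits w ((drop_token ^^ (length s + 3)) xs) (length s)"
  obtain S where
    S: "exec (parse ;; evaluate ;; run_tests) (init_store [x, r, y, z]) (900 * cube n) S"
    "length (S r_input) \<le> n" "S r_alice = y" "S r_bob = z" "S r_kind = output_bits w xs 3"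
    "S r_tests =
      [bits_to_nat t = bits_to_nat b, bits_to_nat t = bits_to_nat a, bits_to_nat t = bits_to_nat s,
       bits_to_nat s < number_at 0 x, bits_to_nat t = number_at 1 x,
       number_at 3 x = length u, number_at 2 x = length s]"
    using exec_examine[OF assms s_def t_def u_def eval a_def b_def] by blast
  obtain T where T: "exec judge S (18 * quad n) T"
    "T 0 = [number_at 2 x = length s \<and> number_at 3 x = length u \<longrightarrow>
      \<not> caught (number_at 0 x) (number_at 1 x) (token_gate (output_bits w xs 3))
        (bits_to_nat a) (bits_to_nat b) (bits_to_nat s) (bits_to_nat t)
        (hd_bit y) (hd_bit (tl y)) (hd_bit z)]"
    using exec_judge[OF S(2,6)] unfolding S(3-5) by blast
  note S(1)
  also note T(1)
  finally have "exec decide (init_store [x, r, y, z]) (1000 * cube n) T"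
    unfolding decide_def by (rule exec_mono) (use quad_gt[of n] quad_le_cube[of n] in simp)
  moreover have "T 0 = [accepts x r y z]"
    unfolding accepts_def Let_def s_def[symmetric] u_def[symmetric] eval[symmetric] prod.case
      a_def[symmetric] b_def[symmetric]
    using T(2) by (simp add: number_at_def t_def)
  ultimately show ?thesis by blast
qed

lemma first_token_enc: "first_token (enc_tuple (v # ws) @ xs) = v"
  and drop_token_enc: "drop_token (enc_tuple (v # ws) @ xs) = enc_tuple ws @ xs"
  by (induction v) (simp_all add: enc_tuple_Cons)

lemma enc_tuple_inject: "length vs = length ws \<Longrightarrow> enc_tuple vs = enc_tuple ws \<Longrightarrow> vs = ws"
proof (induction vs ws rule: list_induct2)
  case (Cons v vs w ws)
  then show ?case
    using first_token_enc[of _ _ "[]"] drop_token_enc[of _ _ "[]"] by (metis append_Nil2)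
qed simp

definition scv_verifier :: verifier where
  "scv_verifier = (\<lambda>n. n, \<lambda>n. n, \<lambda>x r. (first_token r, first_token (drop_token r)), accepts)"

lemma scv_verifier_simps [simp]:
  "v_rand scv_verifier n = n" "v_alen scv_verifier n = n"
  "v_ques scv_verifier x r = (first_token r, first_token (drop_token r))"
  "v_dec scv_verifier = accepts"
  by (simp_all add: scv_verifier_def v_rand_def v_alen_def v_ques_def v_dec_def)

lemma uses_below_simps [simp]:
  "uses_below k (read_bit r f) \<longleftrightarrow> r < k \<and> (\<forall>b. uses_below k (f b))"
  "uses_below k (move a b) \<longleftrightarrow> a < k \<and> b < k"
  "uses_below k (clear a) \<longleftrightarrow> a < k"
  "uses_below k (copy a b) \<longleftrightarrow> a < k \<and> b < k \<and> r_acc < k"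
  "uses_below k (get_token a b) \<longleftrightarrow> a < k \<and> b < k \<and> r_flag < k"
  by (auto simp: read_bit_def move_def clear_def copy_def get_token_def token_step_def)

lemma uses_below_verifier: "uses_below 22 ask" "uses_below 22 decide"
  by (simp_all add: ask_def decide_def parse_def evaluate_def run_tests_def judge_def
      check_length_def read_outputs_def read_output_def gate_step_def push_comparison_def
      compare_def set_flag_def lookup_def keep_evens_def eval_nat_numeral)

lemma questions_poly_computable:
  "\<exists>M. poly_computes_on M {enc_tuple [x, \<rho>] | x \<rho>. length \<rho> = length x}
     (\<lambda>w. SOME out. \<exists>x \<rho>. w = enc_tuple [x, \<rho>] \<and> length \<rho> = length x \<and>
        out = enc_tuple [first_token \<rho>, first_token (drop_token \<rho>)])"
    (is "\<exists>M. poly_computes_on M _ ?f")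
proof -
  let ?W = "{[x, r] | x r :: bool list. length r = length x}"
  have result: "?f (enc_tuple [x, r]) = enc_tuple [first_token r, first_token (drop_token r)]"
    if "length r = length x" for x r
    by (rule some_equality) (use that in \<open>auto dest!: enc_tuple_inject[rotated]\<close>)
  have "\<exists>M. poly_computes_on M (enc_tuple ` ?W) ?f"
  proof (rule poly_computes_on_stack_program)
    show "uses_below (2 + 20) ask" using uses_below_verifier by simp
    fix ws assume "ws \<in> ?W"
    then obtain x r where ws: "ws = [x, r]" "length r = length x" by auto
    then have "length x \<le> length (enc_tuple ws)" "length r \<le> length (enc_tuple ws)"
      by (simp_all add: enc_tuple_Cons)
    then show "\<exists>S. exec ask (init_store ws) (60 * (length (enc_tuple ws) + 1)\<^sup>2) S
        \<and> outputs (Registers 2) S (?f (enc_tuple ws))"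
      using exec_ask[of x "length (enc_tuple ws)" r] result[OF ws(2)]
      unfolding ws(1) quad_def by (auto simp: upt_rec)
  qed auto
  moreover have "enc_tuple ` ?W = {enc_tuple [x, r] | x r. length r = length x}" by auto
  ultimately show ?thesis by simp
qed

lemma decision_poly_computable:
  "\<exists>M. poly_computes_on M {enc_tuple [x, \<rho>, y, z] | x \<rho> y z.
       length \<rho> = length x \<and> length y = length x \<and> length z = length x}
     (\<lambda>w. SOME out. \<exists>x \<rho> y z. w = enc_tuple [x, \<rho>, y, z] \<and>
        length \<rho> = length x \<and> length y = length x \<and> length z = length x \<and>
        out = [accepts x \<rho> y z])" (is "\<exists>M. poly_computes_on M _ ?f")
proof -
  let ?W = "{[x, r, y, z] | x r y z :: bool list.
    length r = length x \<and> length y = length x \<and> length z = length x}"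
  have result: "?f (enc_tuple [x, r, y, z]) = [accepts x r y z]"
    if "length r = length x" "length y = length x" "length z = length x" for x r y z
    by (rule some_equality) (use that in \<open>auto dest!: enc_tuple_inject[rotated]\<close>)
  have "\<exists>M. poly_computes_on M (enc_tuple ` ?W) ?f"
  proof (rule poly_computes_on_stack_program)
    show "uses_below (4 + 18) decide" using uses_below_verifier by simp
    fix ws assume "ws \<in> ?W"
    then obtain x r y z where ws: "ws = [x, r, y, z]"
      "length r = length x" "length y = length x" "length z = length x" by auto
    then have "length x < length (enc_tuple ws)" "length r < length (enc_tuple ws)"
      "3 \<le> length (enc_tuple ws)"
      by (simp_all add: enc_tuple_Cons)
    then show "\<exists>S. exec decide (init_store ws) (1000 * (length (enc_tuple ws) + 1) ^ 3) S
        \<and> outputs First_bit S (?f (enc_tuple ws))"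
      using exec_decide[of x "length (enc_tuple ws)" r y z] result[OF ws(2-4)]
      unfolding ws(1) cube_def by auto
  qed auto
  moreover have "enc_tuple ` ?W =
      {enc_tuple [x, r, y, z] | x r y z.
        length r = length x \<and> length y = length x \<and> length z = length x}"
    by auto
  ultimately show ?thesis by simp
qed

theorem poly_verifier_scv_verifier: "poly_verifier scv_verifier"
  using questions_poly_computable decision_poly_computable id_in_poly
  unfolding poly_verifier_def scv_verifier_simps fst_conv snd_conv
  by (simp add: scv_verifier_def v_rand_def v_alen_def)

section \<open>The verifier on encoded instances\<close>

declare nat_bits.simps [simp del]

lemma nat_bits_0 [simp]: "nat_bits 0 = []"
  by (simp add: nat_bits.simps)

lemma nat_bits_pos: "0 < n \<Longrightarrow> nat_bits n = odd n # nat_bits (n div 2)"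
  by (subst nat_bits.simps) simp

lemma bits_to_nat_nat_bits [simp]: "bits_to_nat (nat_bits n) = n"
proof (induction n rule: less_induct)
  case (less n)
  then show ?case by (cases "n = 0") (auto simp: nat_bits_pos bits_to_nat_Cons)
qed

lemma length_nat_bits: "n < 2 ^ e \<Longrightarrow> length (nat_bits n) \<le> e"
proof (induction e arbitrary: n)
  case (Suc e)
  then have "n div 2 < 2 ^ e" by auto
  then show ?case using Suc.IH[of "n div 2"] by (cases "n = 0") (auto simp: nat_bits_pos)
qed simp

lemma nat_to_bits_Suc: "nat_to_bits (Suc m) i = odd i # nat_to_bits m (i div 2)"
proof -
  have "[0..<Suc m] = 0 # map Suc [0..<m]" by (simp add: upt_conv_Cons map_Suc_upt)
  then show ?thesis by (simp add: nat_to_bits_def div_mult2_eq)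
qed

lemma length_nat_to_bits [simp]: "length (nat_to_bits m i) = m"
  by (simp add: nat_to_bits_def)

lemma nat_to_bits_to_nat: "nat_to_bits (length bs) (bits_to_nat bs) = bs"
  by (induction bs) (auto simp: nat_to_bits_Suc bits_to_nat_Cons, simp add: nat_to_bits_def)

lemma bits_to_nat_to_bits: "i < 2 ^ m \<Longrightarrow> bits_to_nat (nat_to_bits m i) = i"
proof (induction m arbitrary: i)
  case 0
  then show ?case by (simp add: nat_to_bits_def)
next
  case (Suc m)
  then have "i div 2 < 2 ^ m" by auto
  with Suc.IH show ?case by (auto simp: nat_to_bits_Suc bits_to_nat_Cons)
qed

lemma drop_tokens_enc: "i \<le> length ws \<Longrightarrow> (drop_token ^^ i) (enc_tuple ws) = enc_tuple (drop i ws)"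
proof (induction i)
  case (Suc i)
  then have "drop i ws = ws ! i # drop (Suc i) ws" by (simp add: Cons_nth_drop_Suc)
  then show ?case using Suc drop_token_enc[of "ws ! i" "drop (Suc i) ws" "[]"] by simp
qed simp

lemma number_at_enc:
  assumes "i < length ns"
  shows "number_at i (enc_tuple (map nat_bits ns)) = ns ! i"
proof -
  have "drop i (map nat_bits ns) = nat_bits (ns ! i) # drop (Suc i) (map nat_bits ns)"
    using assms by (simp add: Cons_nth_drop_Suc[symmetric])
  then show ?thesis
    using assms first_token_enc[of "nat_bits (ns ! i)" _ "[]"]
    by (simp add: number_at_def drop_tokens_enc)
qed

lemma number_at_drop_tokens: "number_at i ((drop_token ^^ j) xs) = number_at (i + j) xs"
  by (simp add: number_at_def funpow_add)

lemma token_gate_code: "token_gate (nat_bits (code_of_kind g)) = g"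
proof -
  have "code_of_kind g < 2 ^ 3" by (cases g) (simp_all add: code_of_kind_def)
  then have "take 3 (nat_bits (code_of_kind g)) = nat_bits (code_of_kind g)"
    using length_nat_bits by simp
  then show ?thesis by (cases g) (simp_all add: token_gate_def kind_of_code_def code_of_kind_def)
qed

definition gate_numbers :: "gkind \<times> nat \<times> nat \<Rightarrow> nat list" where
  "gate_numbers = (\<lambda>(g, a, b). [code_of_kind g, a, b])"

definition eval_gate :: "bool list \<Rightarrow> gkind \<times> nat \<times> nat \<Rightarrow> bool list" where
  "eval_gate = (\<lambda>vs (g, a, b). vs @ [gate_val g (vs ! a) (vs ! b)])"

definition gates_wf :: "nat \<Rightarrow> (gkind \<times> nat \<times> nat) list \<Rightarrow> bool" where
  "gates_wf m gs \<longleftrightarrow> (\<forall>j < length gs. case gs ! j of (g, a, b) \<Rightarrow> a < m + j \<and> b < m + j)"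

lemma gates_wf_Cons: "gates_wf m ((g, a, b) # gs) \<longleftrightarrow> a < m \<and> b < m \<and> gates_wf (Suc m) gs"
  unfolding gates_wf_def length_Cons All_less_Suc2 by (simp add: case_prod_beta)

lemma length_gate_numbers: "length (concat (map gate_numbers gs)) = 3 * length gs"
  by (induction gs) (auto simp: gate_numbers_def)

lemma length_eval_gates: "length (foldl eval_gate w gs) = length w + length gs"
  by (induction gs arbitrary: w) (auto simp: eval_gate_def)

lemma eval_step_enc:
  assumes "a < length w" "b < length w"
  shows "eval_step (w, enc_tuple (map nat_bits (gate_numbers (g, a, b) @ ns)))
    = (eval_gate w (g, a, b), enc_tuple (map nat_bits ns))"
proof -
  let ?xs = "enc_tuple (map nat_bits (gate_numbers (g, a, b) @ ns))"
  have "number_at 1 ?xs = a" "number_at 2 ?xs = b"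
    using number_at_enc[of 1 "gate_numbers (g, a, b) @ ns"]
        number_at_enc[of 2 "gate_numbers (g, a, b) @ ns"]
    by (simp_all add: gate_numbers_def)
  moreover have "first_token ?xs = nat_bits (code_of_kind g)"
    using first_token_enc[of _ _ "[]"] by (simp add: gate_numbers_def)
  moreover have "(drop_token ^^ 3) ?xs = enc_tuple (map nat_bits ns)"
    using drop_tokens_enc[of 3 "map nat_bits (gate_numbers (g, a, b) @ ns)"]
    by (simp add: gate_numbers_def)
  ultimately show ?thesis
    using assms by (simp add: eval_step_def eval_gate_def token_gate_code nth_bit_def)
qed

lemma eval_steps_enc:
  "gates_wf (length w) gs \<Longrightarrow>
    (eval_step ^^ length gs) (w, enc_tuple (map nat_bits (concat (map gate_numbers gs) @ ns)))
      = (foldl eval_gate w gs, enc_tuple (map nat_bits ns))"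
proof (induction gs arbitrary: w)
  case (Cons p gs)
  obtain g a b where p: "p = (g, a, b)" by (cases p)
  have wf: "a < length w" "b < length w" "gates_wf (length (eval_gate w p)) gs"
    using Cons.prems by (simp_all add: p gates_wf_Cons eval_gate_def)
  have "eval_step (w, enc_tuple (map nat_bits (concat (map gate_numbers (p # gs)) @ ns)))
      = (eval_gate w p, enc_tuple (map nat_bits (concat (map gate_numbers gs) @ ns)))"
    using eval_step_enc[OF wf(1,2), of g "concat (map gate_numbers gs) @ ns"] by (simp add: p)
  then show ?case using Cons.IH[OF wf(3)] by (simp add: funpow_Suc_right del: funpow.simps)
qed simp

lemma output_bits_enc:
  assumes "\<forall>q \<in> set qs. q < length w" "j + l \<le> length qs"
  shows "output_bits w ((drop_token ^^ j) (enc_tuple (map nat_bits qs))) l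
      = take l (drop j (map ((!) w) qs))"
  using assms
  by (intro nth_equalityI)
    (auto simp: output_bits_def number_at_drop_tokens number_at_enc nth_bit_def add.commute)

lemma length_enc_tuple_ge: "2 * length ws \<le> length (enc_tuple ws)"
  by (induction ws) (auto simp: enc_tuple_Cons)

text \<open>Question strings and the gate count are only tested for their lengths, so the random string
  can be padded.\<close>

lemma random_string_exists:
  assumes "2 * length s + 2 * length t + 2 * l + 6 \<le> n"
  obtains r where "length r = n" "first_token r = s" "first_token (drop_token r) = t"
    "length (first_token ((drop_token ^^ 2) r)) = l"
proof
  let ?e = "enc_tuple [s, t, replicate l False]"
  let ?r = "?e @ replicate (n - length ?e) False"
  show "length ?r = n" using assms by (simp add: enc_tuple_Cons)
  show "first_token ?r = s" "first_token (drop_token ?r) = t"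
    "length (first_token ((drop_token ^^ 2) ?r)) = l"
    by (simp_all only: first_token_enc drop_token_enc length_replicate numeral_2_eq_2 funpow.simps
        o_apply id_apply)
qed

definition gate_value :: "circuit \<Rightarrow> nat \<Rightarrow> bool" where
  "gate_value D i = scv_vals D (Suc i) ! i"

lemma length_scv_vals [simp]: "length (scv_vals D n) = n"
  by (induction n) (auto simp: Let_def)

lemma nth_scv_vals: "i < n \<Longrightarrow> scv_vals D n ! i = gate_value D i"
proof (induction n)
  case (Suc n)
  show ?case
  proof (cases "i = n")
    case True
    then show ?thesis by (simp add: gate_value_def)
  next
    case False
    then show ?thesis using Suc by (simp add: Let_def nth_append)
  qed
qed simp

lemma scv_value_eq: "scv_value (N, D, k) = gate_value D k"
  by (simp add: scv_value_def gate_value_def)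

locale succinct_circuit =
  fixes N m :: nat and gs :: "(gkind \<times> nat \<times> nat) list" and outs :: "nat list" and k :: nat
  assumes wf: "scv_wf (N, (m, gs, outs), k)"
begin

abbreviation D :: circuit where "D \<equiv> (m, gs, outs)"

definition enc :: "bool list" where "enc = scv_enc (N, D, k)"

definition kind :: "nat \<Rightarrow> gkind" where "kind i = kind_of_code (D_code D i)"

definition exposed :: "nat \<Rightarrow> nat \<Rightarrow> bool list \<Rightarrow> bool list \<Rightarrow> bool" where
  "exposed i j y z \<longleftrightarrow>
     caught N k (kind i) (D_in1 D i) (D_in2 D i) i j (hd_bit y) (hd_bit (tl y)) (hd_bit z)"

lemma size_le: "N \<le> 2 ^ m" and target_less: "k < N"
  using wf by (auto simp: scv_wf_def)

lemma inputs_less: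
  assumes "i < N"
  shows "kind i \<in> {AND, OR, NOT} \<Longrightarrow> D_in1 D i < i" "kind i \<in> {AND, OR} \<Longrightarrow> D_in2 D i < i"
  using wf assms unfolding scv_wf_def kind_def prod.case by blast+

lemma gate_value_rec:
  assumes "i < N"
  shows "gate_value D i = gate_val (kind i) (gate_value D (D_in1 D i)) (gate_value D (D_in2 D i))"
proof -
  have "gate_value D i = gate_val (kind i) (scv_vals D i ! D_in1 D i) (scv_vals D i ! D_in2 D i)"
    by (simp add: gate_value_def Let_def nth_append kind_def)
  then show ?thesis
    using inputs_less[OF assms] by (cases "kind i") (auto simp: nth_scv_vals gate_val_def)
qed

lemma gates_wf: "gates_wf m gs"
  and outs_less: "\<forall>q \<in> set outs. q < m + length gs"
  and length_outs: "length outs = 3 + 2 * m"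
  using wf by (auto simp: scv_wf_def circuit_wf_def gates_wf_def)

lemma enc_eq:
  "enc = enc_tuple (map nat_bits ([N, k, m, length gs] @ concat (map gate_numbers gs) @ outs))"
  by (simp add: enc_def scv_enc_def gate_numbers_def)

lemma length_enc_ge: "14 + 6 * length gs + 4 * m \<le> length enc"
  using length_enc_tuple_ge[of
      "map nat_bits ([N, k, m, length gs] @ concat (map gate_numbers gs) @ outs)"]
  by (simp add: enc_eq length_gate_numbers length_outs)

lemma accepts_enc_iff:
  "accepts enc r y z \<longleftrightarrow>
     (length (first_token r) = m \<and> length (first_token ((drop_token ^^ 2) r)) = length gs \<longrightarrow>
        \<not> exposed (bits_to_nat (first_token r)) (number_at 1 r) y z)"
proof (cases "length (first_token r) = m \<and> length (first_token ((drop_token ^^ 2) r)) = length gs")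
  case True
  define s where "s = first_token r"
  let ?u = "first_token ((drop_token ^^ 2) r)" and ?w = "foldl eval_gate s gs"
    and ?xs = "enc_tuple (map nat_bits outs)"
  have len: "length s = m" "length ?u = length gs" using True by (simp_all add: s_def)
  have numbers: "number_at 0 enc = N" "number_at 1 enc = k" "number_at 2 enc = m"
    "number_at 3 enc = length gs"
    unfolding enc_eq by (subst number_at_enc; simp)+
  have "(drop_token ^^ 4) enc = enc_tuple (map nat_bits (concat (map gate_numbers gs) @ outs))"
    unfolding enc_eq by (subst drop_tokens_enc) simp_all
  then have eval: "(eval_step ^^ length gs) (s, (drop_token ^^ 4) enc) = (?w, ?xs)"
    using eval_steps_enc[of s gs outs] gates_wf len by simp
  have D_out: "D_out D (bits_to_nat s) = map ((!) ?w) outs"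
    using nat_to_bits_to_nat[of s] len by (simp add: D_out_def circuit_eval_def eval_gate_def)
  have "output_bits ?w ((drop_token ^^ j) ?xs) l = take l (drop j (D_out D (bits_to_nat s)))"
    if "j + l \<le> 3 + 2 * m" for j l
    unfolding D_out using that outs_less length_outs len
    by (intro output_bits_enc) (simp_all add: length_eval_gates)
  from this[of 0 3] this[of 3 m] this[of "m + 3" m]
  have "token_gate (output_bits ?w ?xs 3) = kind (bits_to_nat s)"
    "bits_to_nat (output_bits ?w ((drop_token ^^ 3) ?xs) m) = D_in1 D (bits_to_nat s)"
    "bits_to_nat (output_bits ?w ((drop_token ^^ (m + 3)) ?xs) m) = D_in2 D (bits_to_nat s)"
    using length_outs
    by (simp_all add: token_gate_def kind_def D_code_def D_in1_def D_in2_def D_out add.commute)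
  then show ?thesis
    unfolding accepts_def Let_def s_def[symmetric] len eval numbers prod.case exposed_def by simp
next
  case False
  have "number_at 2 enc = m" "number_at 3 enc = length gs"
    unfolding enc_eq by (subst number_at_enc; simp)+
  then show ?thesis using False by (auto simp: accepts_def Let_def case_prod_beta)
qed

end

section \<open>Events under no-signaling strategies\<close>

type_synonym strategy = "bool list \<Rightarrow> bool list \<Rightarrow> bool list \<Rightarrow> bool list \<Rightarrow> real"

definition event_prob :: "verifier \<Rightarrow> bool list \<Rightarrow> strategy \<Rightarrow> bool list \<Rightarrow> bool list
    \<Rightarrow> (bool list \<Rightarrow> bool list \<Rightarrow> bool) \<Rightarrow> real" where
  "event_prob V x P s t E = (\<Sum>y \<in> answers V x. \<Sum>z \<in> answers V x. P s t y z * of_bool (E y z))"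

definition rejection_prob :: "verifier \<Rightarrow> bool list \<Rightarrow> strategy \<Rightarrow> bool list \<Rightarrow> real" where
  "rejection_prob V x P \<rho>
    = event_prob V x P (fst (v_ques V x \<rho>)) (snd (v_ques V x \<rho>)) (\<lambda>y z. \<not> v_dec V x \<rho> y z)"

lemma finite_bit_strings [simp]: "finite {w :: bool list. length w = n}"
  using finite_lists_length_eq[of "UNIV :: bool set" n] by simp

lemma card_bit_strings: "card {w :: bool list. length w = n} = 2 ^ n"
  using card_lists_length_eq[of "UNIV :: bool set" n] by simp

lemma finite_answers [simp]: "finite (answers V x)"
  by (simp add: answers_def)

context
  fixes V x P assumes ns: "no_signaling V x P"
begin

lemma strategy_nonneg: "y \<in> answers V x \<Longrightarrow> z \<in> answers V x \<Longrightarrow> 0 \<le> P s t y z"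
  using ns by (simp add: no_signaling_def strategy_def)

lemma event_prob_True: "event_prob V x P s t (\<lambda>_ _. True) = 1"
  using ns by (simp add: event_prob_def no_signaling_def strategy_def)

lemma event_prob_mono: "(\<And>y z. E y z \<Longrightarrow> F y z) \<Longrightarrow> event_prob V x P s t E \<le> event_prob V x P s t F"
  unfolding event_prob_def by (intro sum_mono mult_left_mono) (auto simp: strategy_nonneg)

lemma event_prob_nonneg: "0 \<le> event_prob V x P s t E"
  unfolding event_prob_def by (intro sum_nonneg mult_nonneg_nonneg) (auto simp: strategy_nonneg)

lemma event_prob_Un_le:
  "event_prob V x P s t (\<lambda>y z. E y z \<or> F y z) \<le> event_prob V x P s t E + event_prob V x P s t F"
  unfolding event_prob_def sum.distrib[symmetric] distrib_left[symmetric]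
  by (intro sum_mono mult_left_mono) (auto simp: strategy_nonneg)

lemma event_prob_compl: "event_prob V x P s t (\<lambda>y z. \<not> E y z) = 1 - event_prob V x P s t E"
proof -
  have "event_prob V x P s t (\<lambda>y z. \<not> E y z) + event_prob V x P s t E
      = event_prob V x P s t (\<lambda>_ _. True)"
    unfolding event_prob_def sum.distrib[symmetric] distrib_left[symmetric]
    by (intro sum.cong refl) auto
  then show ?thesis using event_prob_True by simp
qed

lemma event_prob_alice: "event_prob V x P s t (\<lambda>y z. E y) = event_prob V x P s t' (\<lambda>y z. E y)"
proof -
  have "(\<Sum>z \<in> answers V x. P s t y z) = (\<Sum>z \<in> answers V x. P s t' y z)" if "y \<in> answers V x" for y
    using ns that by (auto simp: no_signaling_def)
  then show ?thesis unfolding event_prob_def sum_distrib_right[symmetric] by (intro sum.cong) auto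
qed

lemma event_prob_bob: "event_prob V x P s t (\<lambda>y z. E z) = event_prob V x P s' t (\<lambda>y z. E z)"
proof -
  have "event_prob V x P s t (\<lambda>y z. E z)
      = (\<Sum>z \<in> answers V x. (\<Sum>y \<in> answers V x. P s t y z) * of_bool (E z))" for s
    unfolding event_prob_def sum_distrib_right by (rule sum.swap)
  moreover have "(\<Sum>y \<in> answers V x. P s t y z) = (\<Sum>y \<in> answers V x. P s' t y z)"
    if "z \<in> answers V x" for z
    using ns that by (auto simp: no_signaling_def)
  ultimately show ?thesis by simp
qed

lemma sum_rejection_prob:
  "(\<Sum>\<rho> | length \<rho> = v_rand V (length x). rejection_prob V x P \<rho>)
    = 2 ^ v_rand V (length x) * (1 - accept_prob V x P)"
proof -
  have "accept_prob V x P
      = (\<Sum>\<rho> | length \<rho> = v_rand V (length x). 1 - rejection_prob V x P \<rho>) / 2 ^ v_rand V (length x)"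
    by (simp add: accept_prob_def rejection_prob_def event_prob_compl)
      (simp add: event_prob_def of_bool_def)
  then show ?thesis by (simp add: sum_subtractf card_bit_strings field_simps)
qed

lemma rejection_prob_le:
  assumes "length \<rho> = v_rand V (length x)"
  shows "rejection_prob V x P \<rho> \<le> 2 ^ v_rand V (length x) * (1 - accept_prob V x P)"
  unfolding sum_rejection_prob[symmetric]
  using assms by (intro member_le_sum) (auto simp: rejection_prob_def event_prob_nonneg)

lemma accept_prob_ge:
  assumes "\<And>\<rho>. rejection_prob V x P \<rho> \<le> h"
  shows "1 - h \<le> accept_prob V x P"
proof -
  have "2 ^ v_rand V (length x) * (1 - accept_prob V x P)
      \<le> (\<Sum>\<rho>::bool list | length \<rho> = v_rand V (length x). h)"
    unfolding sum_rejection_prob[symmetric] by (intro sum_mono assms)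
  then show ?thesis by (simp add: card_bit_strings)
qed

end

section \<open>Soundness\<close>

locale succinct_circuit_strategy = succinct_circuit +
  fixes P :: strategy
  assumes no_signaling: "no_signaling scv_verifier enc P"
begin

abbreviation prob :: "bool list \<Rightarrow> bool list \<Rightarrow> (bool list \<Rightarrow> bool list \<Rightarrow> bool) \<Rightarrow> real" where
  "prob \<equiv> event_prob scv_verifier enc P"

abbreviation question :: "nat \<Rightarrow> bool list" where "question \<equiv> nat_to_bits m"

definition rejection_bound :: real where
  "rejection_bound = 2 ^ length enc * (1 - accept_prob scv_verifier enc P)"

definition bob_error :: "nat \<Rightarrow> real" where
  "bob_error j = prob (question 0) (question j) (\<lambda>y z. hd_bit z \<noteq> gate_value D j)"

lemma prob_exposed_le:
  assumes "i < 2 ^ m" "j < 2 ^ m"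
  shows "prob (question i) (question j) (exposed i j) \<le> rejection_bound"
proof -
  have "2 * length (question i) + 2 * length (question j) + 2 * length gs + 6 \<le> length enc"
    using length_enc_ge by simp
  then obtain r where r: "length r = length enc" "first_token r = question i"
    "first_token (drop_token r) = question j" "length (first_token ((drop_token ^^ 2) r)) = length gs"
    by (rule random_string_exists)
  have "number_at 1 r = j" using assms by (simp add: number_at_def r bits_to_nat_to_bits)
  then have "(\<lambda>y z. \<not> accepts enc r y z) = exposed i j"
    using assms by (simp add: accepts_enc_iff r bits_to_nat_to_bits fun_eq_iff)
  then show ?thesis
    using rejection_prob_le[OF no_signaling, of r] r
    by (simp add: rejection_prob_def rejection_bound_def)
qed

lemma rejection_bound_nonneg: "0 \<le> rejection_bound"
  using prob_exposed_le[of 0 0]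
    event_prob_nonneg[OF no_signaling, of "question 0" "question 0" "exposed 0 0"] by simp

lemma bob_error_eq: "prob s (question j) (\<lambda>y z. hd_bit z \<noteq> gate_value D j) = bob_error j"
  unfolding bob_error_def by (rule event_prob_bob[OF no_signaling])

lemma prob_alice_error_le:
  assumes "i < 2 ^ m" "a < 2 ^ m" "\<And>y z. claim y \<noteq> hd_bit z \<Longrightarrow> exposed i a y z"
  shows "prob (question i) t (\<lambda>y z. claim y \<noteq> gate_value D a) \<le> bob_error a + rejection_bound"
proof -
  have "prob (question i) t (\<lambda>y z. claim y \<noteq> gate_value D a)
      = prob (question i) (question a) (\<lambda>y z. claim y \<noteq> gate_value D a)"
    by (rule event_prob_alice[OF no_signaling])
  also have "\<dots> \<le> prob (question i) (question a) (\<lambda>y z. hd_bit z \<noteq> gate_value D a \<or> exposed i a y z)"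
    using assms(3) by (intro event_prob_mono[OF no_signaling]) blast
  also have "\<dots> \<le> prob (question i) (question a) (\<lambda>y z. hd_bit z \<noteq> gate_value D a)
      + prob (question i) (question a) (exposed i a)"
    by (rule event_prob_Un_le[OF no_signaling])
  also have "\<dots> \<le> bob_error a + rejection_bound"
    unfolding bob_error_eq by (intro add_left_mono prob_exposed_le assms(1,2))
  finally show ?thesis .
qed

lemma bob_error_step:
  assumes "i < N" "0 \<le> e" "\<And>a. a < i \<Longrightarrow> bob_error a \<le> e"
  shows "bob_error i \<le> 2 * e + 3 * rejection_bound"
proof -
  let ?reads1 = "kind i \<in> {AND, OR, NOT}" and ?reads2 = "kind i \<in> {AND, OR}"
  let ?v1 = "gate_value D (D_in1 D i)" and ?v2 = "gate_value D (D_in2 D i)"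
  let ?pr = "prob (question i) (question i)"
  have i: "i < 2 ^ m" using assms(1) size_le by simp
  have claim_error: "?pr (\<lambda>y z. reads \<and> claim y \<noteq> gate_value D a) \<le> e + rejection_bound"
    if "reads \<Longrightarrow> a < i" "\<And>y z. claim y \<noteq> hd_bit z \<Longrightarrow> exposed i a y z" for reads a claim
  proof (cases reads)
    case True
    then have "?pr (\<lambda>y z. claim y \<noteq> gate_value D a) \<le> bob_error a + rejection_bound"
      using that i by (intro prob_alice_error_le) auto
    then show ?thesis using True assms(3)[OF that(1)] by simp
  next
    case False
    then show ?thesis using assms(2) rejection_bound_nonneg by (simp add: event_prob_def)
  qed
  have error1: "?pr (\<lambda>y z. ?reads1 \<and> hd_bit y \<noteq> ?v1) \<le> e + rejection_bound"
    by (rule claim_error) (use inputs_less assms(1) in \<open>auto simp: exposed_def caught_def\<close>)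
  have error2: "?pr (\<lambda>y z. ?reads2 \<and> hd_bit (tl y) \<noteq> ?v2) \<le> e + rejection_bound"
    by (rule claim_error) (use inputs_less assms(1) in \<open>auto simp: exposed_def caught_def\<close>)
  have "bob_error i = ?pr (\<lambda>y z. hd_bit z \<noteq> gate_value D i)" by (simp only: bob_error_eq)
  also have "\<dots> \<le> ?pr (\<lambda>y z. ((?reads1 \<and> hd_bit y \<noteq> ?v1) \<or> (?reads2 \<and> hd_bit (tl y) \<noteq> ?v2))
      \<or> exposed i i y z)"
    using assms(1) unfolding gate_value_rec[OF assms(1)] exposed_def caught_def
    by (intro event_prob_mono[OF no_signaling]) (cases "kind i"; auto simp: gate_val_def)
  also have "\<dots> \<le> (?pr (\<lambda>y z. ?reads1 \<and> hd_bit y \<noteq> ?v1)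
      + ?pr (\<lambda>y z. ?reads2 \<and> hd_bit (tl y) \<noteq> ?v2)) + ?pr (exposed i i)"
    by (intro order_trans[OF event_prob_Un_le[OF no_signaling]] add_right_mono
        event_prob_Un_le[OF no_signaling])
  finally show ?thesis using error1 error2 prob_exposed_le[OF i i] by simp
qed

lemma bob_error_le: "i < N \<Longrightarrow> bob_error i \<le> 3 * rejection_bound * (2 ^ (i + 1) - 1)"
proof (induction i rule: less_induct)
  case (less i)
  let ?e = "3 * rejection_bound * (2 ^ i - 1)"
  have "bob_error a \<le> ?e" if "a < i" for a
  proof -
    have "3 * rejection_bound * (2 ^ (a + 1) - 1) \<le> ?e"
      using that rejection_bound_nonneg
      by (intro mult_left_mono diff_right_mono power_increasing) auto
    then show ?thesis using less that by (meson order_trans less_trans)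
  qed
  moreover have "0 \<le> ?e" using rejection_bound_nonneg by simp
  ultimately have "bob_error i \<le> 2 * ?e + 3 * rejection_bound"
    using less.prems by (intro bob_error_step)
  then show ?case by (simp add: algebra_simps)
qed

lemma rejection_bound_ge:
  assumes "\<not> gate_value D k"
  shows "1 \<le> 3 * rejection_bound * 2 ^ (k + 1)"
proof -
  have k: "k < 2 ^ m" using size_le target_less by simp
  have "1 = prob (question 0) (question k) (\<lambda>_ _. True)"
    by (simp add: event_prob_True[OF no_signaling])
  also have "\<dots> \<le> prob (question 0) (question k) (\<lambda>y z. hd_bit z \<noteq> gate_value D k \<or> exposed 0 k y z)"
    by (intro event_prob_mono[OF no_signaling]) (auto simp: assms exposed_def caught_def)
  also have "\<dots> \<le> prob (question 0) (question k) (\<lambda>y z. hd_bit z \<noteq> gate_value D k)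
      + prob (question 0) (question k) (exposed 0 k)"
    by (rule event_prob_Un_le[OF no_signaling])
  also have "\<dots> \<le> bob_error k + rejection_bound"
    unfolding bob_error_eq using k by (intro add_left_mono prob_exposed_le) simp_all
  also have "\<dots> \<le> 3 * rejection_bound * 2 ^ (k + 1)"
    using bob_error_le[OF target_less] rejection_bound_nonneg by (simp add: algebra_simps)
  finally show ?thesis .
qed

lemma length_enc_exponent: "length enc + N + 2 \<le> 2 ^ length enc"
proof -
  let ?n = "length enc"
  have n: "14 + 4 * m \<le> ?n" using length_enc_ge by simp
  have "q + 4 \<le> 2 ^ (q + 1)" if "2 \<le> q" for q :: nat
    using that by (induction q rule: dec_induct) auto
  from this[of "?n - 2"] have "?n + 2 \<le> 2 ^ (?n - 1)"
    using n by (simp add: Suc_diff_Suc numeral_2_eq_2)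
  moreover have "(2::nat) ^ m \<le> 2 ^ (?n - 1)" using n by (intro power_increasing) auto
  moreover have "(2::nat) ^ ?n = 2 ^ (?n - 1) + 2 ^ (?n - 1)" using n by (cases ?n) auto
  ultimately show ?thesis using size_le by linarith
qed

theorem accept_prob_le:
  assumes "\<not> scv_value (N, D, k)"
  shows "accept_prob scv_verifier enc P \<le> 1 - 1 / 2 ^ (2 ^ length enc)"
proof -
  let ?q = "1 - accept_prob scv_verifier enc P"
  have q: "0 \<le> ?q"
    using rejection_bound_nonneg zero_less_power[of "2 :: real" "length enc"]
    unfolding rejection_bound_def by (auto simp: zero_le_mult_iff simp del: zero_less_power)
  have "1 \<le> 3 * rejection_bound * 2 ^ (k + 1)"
    using rejection_bound_ge assms by (simp add: scv_value_eq)
  also have "\<dots> \<le> 4 * rejection_bound * 2 ^ N"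
    using rejection_bound_nonneg target_less by (intro mult_mono power_increasing) auto
  also have "\<dots> = 2 ^ (length enc + N + 2) * ?q"
    by (simp add: rejection_bound_def power_add algebra_simps)
  also have "\<dots> \<le> 2 ^ (2 ^ length enc) * ?q"
    using q by (intro mult_right_mono power_increasing length_enc_exponent) auto
  finally show ?thesis by (simp add: field_simps)
qed

end

theorem SCV_no_accept_prob_le:
  assumes "x \<in> SCV_no" "no_signaling scv_verifier x P"
  shows "accept_prob scv_verifier x P \<le> 1 - 1 / 2 ^ (2 ^ length x)"
proof -
  obtain N m gs outs k where x: "x = scv_enc (N, (m, gs, outs), k)"
    and wf: "scv_wf (N, (m, gs, outs), k)"
    and no: "\<not> scv_value (N, (m, gs, outs), k)"
    using assms(1) by (auto simp: SCV_no_def)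
  interpret succinct_circuit N m gs outs k by unfold_locales (rule wf)
  interpret succinct_circuit_strategy N m gs outs k P
    by unfold_locales (use assms(2) x in \<open>simp add: enc_def\<close>)
  show ?thesis using accept_prob_le no x by (simp add: enc_def)
qed

section \<open>Strategies with finitely many answers\<close>

definition encoded_strategy ::
  "(bool list \<Rightarrow> 'a::finite \<Rightarrow> bool list) \<Rightarrow> (bool list \<Rightarrow> 'b::finite \<Rightarrow> bool list)
    \<Rightarrow> (bool list \<Rightarrow> bool list \<Rightarrow> 'a \<Rightarrow> 'b \<Rightarrow> real) \<Rightarrow> strategy" where
  "encoded_strategy f g q s t y z
    = (\<Sum>a\<in>UNIV. of_bool (y = f s a) * (\<Sum>b\<in>UNIV. of_bool (z = g t b) * q s t a b))"

lemma sum_of_bool_eq: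
  fixes h :: "'c \<Rightarrow> 'a::finite \<Rightarrow> real"
  assumes "finite S" "\<And>a. f a \<in> S"
  shows "(\<Sum>y\<in>S. \<Sum>a\<in>UNIV. of_bool (y = f a) * h y a) = (\<Sum>a\<in>UNIV. h (f a) a)"
proof -
  have "(\<Sum>y\<in>S. of_bool (y = f a) * h y a) = h (f a) a" for a
    using assms sum.delta[OF assms(1), of "f a" "\<lambda>y. h y a"]
    by (simp add: of_bool_def if_distrib if_distribR cong: if_cong)
  then show ?thesis by (subst sum.swap) simp
qed

context
  fixes V x and f :: "bool list \<Rightarrow> 'a::finite \<Rightarrow> bool list"
    and g :: "bool list \<Rightarrow> 'b::finite \<Rightarrow> bool list"
    and q :: "bool list \<Rightarrow> bool list \<Rightarrow> 'a \<Rightarrow> 'b \<Rightarrow> real"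
  assumes f: "\<And>s a. f s a \<in> answers V x" and g: "\<And>t b. g t b \<in> answers V x"
begin

lemma event_prob_encoded_strategy:
  "event_prob V x (encoded_strategy f g q) s t E
    = (\<Sum>a\<in>UNIV. \<Sum>b\<in>UNIV. q s t a b * of_bool (E (f s a) (g t b)))"
proof -
  have "event_prob V x (encoded_strategy f g q) s t E
      = (\<Sum>y \<in> answers V x. \<Sum>a\<in>UNIV. of_bool (y = f s a) *
          (\<Sum>z \<in> answers V x. \<Sum>b\<in>UNIV. of_bool (z = g t b) * (q s t a b * of_bool (E y z))))"
    unfolding event_prob_def encoded_strategy_def sum_distrib_right sum_distrib_left
    by (intro sum.cong refl, subst sum.swap) (simp add: ac_simps)
  also have "\<dots> = (\<Sum>a\<in>UNIV. \<Sum>z \<in> answers V x. \<Sum>b\<in>UNIV. of_bool (z = g t b)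
      * (q s t a b * of_bool (E (f s a) z)))"
    by (rule sum_of_bool_eq) (use f in auto)
  also have "\<dots> = (\<Sum>a\<in>UNIV. \<Sum>b\<in>UNIV. q s t a b * of_bool (E (f s a) (g t b)))"
    by (intro sum.cong refl sum_of_bool_eq) (use g in auto)
  finally show ?thesis .
qed

lemma no_signaling_encoded_strategy:
  assumes "\<And>s t a b. 0 \<le> q s t a b" "\<And>s t. (\<Sum>a\<in>UNIV. \<Sum>b\<in>UNIV. q s t a b) = 1"
    and "\<And>s s' t b. (\<Sum>a\<in>UNIV. q s t a b) = (\<Sum>a\<in>UNIV. q s' t a b)"
    and "\<And>s t t' a. (\<Sum>b\<in>UNIV. q s t a b) = (\<Sum>b\<in>UNIV. q s t' a b)"
  shows "no_signaling V x (encoded_strategy f g q)"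
proof -
  have bob: "(\<Sum>y \<in> answers V x. encoded_strategy f g q s t y z)
      = (\<Sum>b\<in>UNIV. of_bool (z = g t b) * (\<Sum>a\<in>UNIV. q s t a b))" for s t z
  proof -
    have "(\<Sum>y \<in> answers V x. encoded_strategy f g q s t y z)
        = (\<Sum>a\<in>UNIV. \<Sum>b\<in>UNIV. of_bool (z = g t b) * q s t a b)"
      unfolding encoded_strategy_def by (rule sum_of_bool_eq) (use f in auto)
    then show ?thesis by (subst (asm) sum.swap) (simp add: sum_distrib_left)
  qed
  have alice: "(\<Sum>z \<in> answers V x. encoded_strategy f g q s t y z)
      = (\<Sum>a\<in>UNIV. of_bool (y = f s a) * (\<Sum>b\<in>UNIV. q s t a b))" for s t y
  proof -
    have "(\<Sum>z \<in> answers V x. encoded_strategy f g q s t y z)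
        = (\<Sum>a\<in>UNIV. of_bool (y = f s a) *
            (\<Sum>z \<in> answers V x. \<Sum>b\<in>UNIV. of_bool (z = g t b) * q s t a b))"
      unfolding encoded_strategy_def by (subst sum.swap) (simp add: sum_distrib_left)
    moreover have "(\<Sum>z \<in> answers V x. \<Sum>b\<in>UNIV. of_bool (z = g t b) * q s t a b)
        = (\<Sum>b\<in>UNIV. q s t a b)" for a
      by (rule sum_of_bool_eq) (use g in auto)
    ultimately show ?thesis by (simp only:)
  qed
  have "(\<Sum>y \<in> answers V x. \<Sum>z \<in> answers V x. encoded_strategy f g q s t y z) = 1" for s t
    using event_prob_encoded_strategy[of s t "\<lambda>_ _. True"] assms(2) by (simp add: event_prob_def)
  moreover have "0 \<le> encoded_strategy f g q s t y z" for s t y z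
    unfolding encoded_strategy_def by (intro sum_nonneg mult_nonneg_nonneg assms(1)) simp_all
  ultimately have "strategy V x (encoded_strategy f g q)" by (simp add: strategy_def)
  moreover have "(\<Sum>y \<in> answers V x. encoded_strategy f g q s t y z)
      = (\<Sum>y \<in> answers V x. encoded_strategy f g q s' t y z)" for s s' t z
    unfolding bob assms(3)[of s t _ s'] ..
  moreover have "(\<Sum>z \<in> answers V x. encoded_strategy f g q s t y z)
      = (\<Sum>z \<in> answers V x. encoded_strategy f g q s t' y z)" for s t t' y
    unfolding alice assms(4)[of s t _ t'] ..
  ultimately show ?thesis by (simp only: no_signaling_def) blast
qed

end

context succinct_circuit
begin

theorem honest_strategy_accepted:
  assumes "scv_value (N, D, k)"
  shows "\<exists>P. no_signaling scv_verifier enc P \<and> accept_prob scv_verifier enc P = 1"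
proof -
  let ?n = "length enc" and ?v = "gate_value D"
  define f where "f s (a :: unit) = ?v (D_in1 D (bits_to_nat s)) # ?v (D_in2 D (bits_to_nat s))
      # replicate (?n - 2) False" for s a
  define g where "g t (b :: unit) = ?v (bits_to_nat t) # replicate (?n - 1) False" for t b
  let ?P = "encoded_strategy f g (\<lambda>_ _ _ _. 1)"
  have fg: "f s a \<in> answers scv_verifier enc" "g t b \<in> answers scv_verifier enc" for s t a b
    using length_enc_ge by (simp_all add: f_def g_def answers_def)
  have ns: "no_signaling scv_verifier enc ?P"
    by (rule no_signaling_encoded_strategy) (use fg in simp_all)
  have "accepts enc r (f (first_token r) a) (g (first_token (drop_token r)) b)" for r a b
    using gate_value_rec assms
    by (auto simp: accepts_enc_iff exposed_def caught_def f_def g_def number_at_def scv_value_eq)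
  then have "rejection_prob scv_verifier enc ?P r = 0" for r
    using event_prob_encoded_strategy[of f scv_verifier enc g "\<lambda>_ _ _ _. 1", OF fg]
    by (simp add: rejection_prob_def)
  then have "accept_prob scv_verifier enc ?P = 1" using sum_rejection_prob[OF ns] by simp
  with ns show ?thesis by blast
qed

end

theorem SCV_yes_accepted:
  assumes "x \<in> SCV_yes"
  shows "\<exists>P. no_signaling scv_verifier x P \<and> accept_prob scv_verifier x P = 1"
proof -
  obtain N m gs outs k where x: "x = scv_enc (N, (m, gs, outs), k)"
    and wf: "scv_wf (N, (m, gs, outs), k)"
    and yes: "scv_value (N, (m, gs, outs), k)"
    using assms by (auto simp: SCV_yes_def)
  interpret succinct_circuit N m gs outs k by unfold_locales (rule wf)
  show ?thesis using honest_strategy_accepted[OF yes] by (simp add: x enc_def)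
qed

section \<open>Instances with doubly exponentially small error\<close>

text \<open>Alice and Bob answer independently, Alice according to \<open>A s\<close> and Bob with a bit of expectation
  \<open>\<beta> t\<close>, unless the questions are linked, in which case Bob's bit is a function of Alice's answer.\<close>

definition linked :: "('q \<Rightarrow> 'a \<Rightarrow> real) \<Rightarrow> ('q \<Rightarrow> real) \<Rightarrow> ('q \<Rightarrow> 'q \<Rightarrow> ('a \<Rightarrow> bool) option) \<Rightarrow>
    'q \<Rightarrow> 'q \<Rightarrow> 'a \<Rightarrow> bool \<Rightarrow> real" where
  "linked A \<beta> link s t a b =
     A s a * (case link s t of Some f \<Rightarrow> of_bool (b = f a) | None \<Rightarrow> if b then \<beta> t else 1 - \<beta> t)"

lemma linked_nonneg: "0 \<le> A s a \<Longrightarrow> 0 \<le> \<beta> t \<Longrightarrow> \<beta> t \<le> 1 \<Longrightarrow> 0 \<le> linked A \<beta> link s t a b"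
  by (simp add: linked_def split: option.split)

lemma sum_bob_linked: "(\<Sum>b\<in>UNIV. linked A \<beta> link s t a b) = A s a"
  by (auto simp: linked_def UNIV_bool algebra_simps split: option.split)

lemma sum_alice_linked:
  fixes A :: "'q \<Rightarrow> 'a::finite \<Rightarrow> real"
  assumes "(\<Sum>a\<in>UNIV. A s a) = 1" "\<And>f. link s t = Some f \<Longrightarrow> (\<Sum>a\<in>UNIV. A s a * of_bool (f a)) = \<beta> t"
  shows "(\<Sum>a\<in>UNIV. linked A \<beta> link s t a b) = (if b then \<beta> t else 1 - \<beta> t)"
proof (cases "link s t")
  case None
  then show ?thesis using assms(1) by (simp add: linked_def flip: sum_distrib_right)
next
  case (Some f)
  have "(\<Sum>a\<in>UNIV. A s a * of_bool (\<not> f a)) = (\<Sum>a\<in>UNIV. A s a - A s a * of_bool (f a))"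
    by (intro sum.cong) auto
  also have "\<dots> = 1 - \<beta> t" unfolding sum_subtractf assms(1) assms(2)[OF Some] ..
  finally show ?thesis
    using Some assms(2)[OF Some] by (cases b) (simp_all add: linked_def del: sum_mult_of_bool_eq)
qed

text \<open>A circuit that subtracts one from a number of l bits: bit i is on wire p + i, wire q holds the
  disjunction of the lower bits, w is the next free wire, and an output bit is the negated exclusive
  disjunction of its bit and the disjunction of the lower bits.\<close>

fun decrement_gates :: "nat \<Rightarrow> nat \<Rightarrow> nat \<Rightarrow> nat \<Rightarrow> (gkind \<times> nat \<times> nat) list" where
  "decrement_gates 0 p q w = []"
| "decrement_gates (Suc l) p q w =
     (OR, p, q) # (AND, p, q) # (NOT, w, 0) # (OR, w + 1, w + 2) #
     decrement_gates l (Suc p) w (w + 4)"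

fun decrement_outs :: "nat \<Rightarrow> nat \<Rightarrow> nat list" where
  "decrement_outs 0 w = []"
| "decrement_outs (Suc l) w = (w + 3) # decrement_outs l (w + 4)"

fun nonzero_wire :: "nat \<Rightarrow> nat \<Rightarrow> nat \<Rightarrow> nat" where
  "nonzero_wire 0 q w = q"
| "nonzero_wire (Suc l) q w = nonzero_wire l w (w + 4)"

fun decrement_bits :: "bool \<Rightarrow> bool list \<Rightarrow> bool list" where
  "decrement_bits b [] = []"
| "decrement_bits b (x # xs) = (x \<and> b \<or> \<not> (x \<or> b)) # decrement_bits (x \<or> b) xs"

lemma decrement_gates_eval:
  assumes "p + length bs \<le> length w" "\<And>i. i < length bs \<Longrightarrow> w ! (p + i) = bs ! i" "q < length w"
  shows "\<exists>vs. foldl eval_gate w (decrement_gates (length bs) p q (length w)) = w @ vs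
    \<and> map ((!) (w @ vs)) (decrement_outs (length bs) (length w)) = decrement_bits (w ! q) bs
    \<and> (w @ vs) ! nonzero_wire (length bs) q (length w) = (w ! q \<or> True \<in> set bs)"
  using assms
proof (induction bs arbitrary: w p q)
  case Nil
  then show ?case by simp
next
  case (Cons x bs)
  define b where "b = w ! q"
  define w' where "w' = w @ [x \<or> b, x \<and> b, \<not> (x \<or> b), x \<and> b \<or> \<not> (x \<or> b)]"
  have x: "w ! p = x" using Cons.prems(2)[of 0] by simp
  have w': "length w' = length w + 4" "w' ! length w = (x \<or> b)"
    "w' ! (length w + 3) = (x \<and> b \<or> \<not> (x \<or> b))"
    by (simp_all add: w'_def nth_append)
  have eval: "foldl eval_gate w (decrement_gates (length (x # bs)) p q (length w))
      = foldl eval_gate w' (decrement_gates (length bs) (Suc p) (length w) (length w + 4))"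
    using Cons.prems(1,3) x by (simp add: eval_gate_def gate_val_def nth_append w'_def b_def)
  have "w' ! (Suc p + i) = bs ! i" if "i < length bs" for i
    using that Cons.prems(1) Cons.prems(2)[of "Suc i"] by (simp add: w'_def nth_append)
  then obtain vs where
    vs: "foldl eval_gate w' (decrement_gates (length bs) (Suc p) (length w) (length w + 4)) = w' @ vs"
    "map ((!) (w' @ vs)) (decrement_outs (length bs) (length w + 4)) = decrement_bits (x \<or> b) bs"
    "(w' @ vs) ! nonzero_wire (length bs) (length w) (length w + 4) = ((x \<or> b) \<or> True \<in> set bs)"
    using Cons.IH[of "Suc p" w' "length w"] Cons.prems(1) w' by auto
  have "(w' @ vs) ! (length w + 3) = (x \<and> b \<or> \<not> (x \<or> b))" using w' by (simp add: nth_append)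
  then have "map ((!) (w' @ vs)) (decrement_outs (length (x # bs)) (length w))
      = decrement_bits b (x # bs)"
    using vs(2) by simp
  moreover have "(w' @ vs) ! nonzero_wire (length (x # bs)) q (length w)
      = (b \<or> True \<in> set (x # bs))"
    using vs(3) by auto
  moreover have "w' @ vs = w @ [x \<or> b, x \<and> b, \<not> (x \<or> b), x \<and> b \<or> \<not> (x \<or> b)] @ vs"
    by (simp add: w'_def)
  ultimately show ?case using eval vs(1) unfolding b_def by metis
qed

lemma decrement_gates_wf: "p + l \<le> w \<Longrightarrow> q < w \<Longrightarrow> gates_wf w (decrement_gates l p q w)"
proof (induction l arbitrary: p q w)
  case (Suc l)
  have "gates_wf (w + 4) (decrement_gates l (Suc p) w (w + 4))"
    using Suc.prems by (intro Suc.IH) auto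
  then show ?case using Suc.prems by (auto simp: gates_wf_Cons numeral_eq_Suc)
qed (simp add: gates_wf_def)

lemma length_decrement_gates [simp]: "length (decrement_gates l p q w) = 4 * l"
  by (induction l p q w rule: decrement_gates.induct) auto

lemma length_decrement_outs [simp]: "length (decrement_outs l w) = l"
  by (induction l w rule: decrement_outs.induct) auto

lemma length_decrement_bits [simp]: "length (decrement_bits b bs) = length bs"
  by (induction b bs rule: decrement_bits.induct) auto

lemma decrement_outs_less: "v \<in> set (decrement_outs l w) \<Longrightarrow> v < w + 4 * l"
  by (induction l w rule: decrement_outs.induct) auto

lemma nonzero_wire_less: "q < w \<Longrightarrow> nonzero_wire l q w < w + 4 * l"
  by (induction l q w rule: nonzero_wire.induct) auto

lemma bits_to_nat_eq_0_iff: "bits_to_nat bs = 0 \<longleftrightarrow> True \<notin> set bs"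
  by (induction bs) (auto simp: bits_to_nat_Cons)

lemma bits_to_nat_decrement_True: "bits_to_nat (decrement_bits True bs) = bits_to_nat bs"
  by (induction bs) (auto simp: bits_to_nat_Cons)

lemma bits_to_nat_decrement:
  "bits_to_nat (decrement_bits False bs)
    = (if bits_to_nat bs = 0 then 2 ^ length bs - 1 else bits_to_nat bs - 1)"
proof (induction bs)
  case (Cons x bs)
  obtain e where "(2 :: nat) ^ length bs = Suc e" by (cases "(2 :: nat) ^ length bs") auto
  then show ?case
    using Cons bits_to_nat_decrement_True[of bs] by (cases x) (auto simp: bits_to_nat_Cons)
qed simp

text \<open>Gate 2 l + c is copy c of level l: a ZERO gate for l = 0, and otherwise the OR of both copies
  at level l - 1. At level 0 the decrement wraps around, so the inputs of the ZERO gates, which the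
  verifier tests as well, are the gates of the top level.\<close>

definition ladder_gates :: "nat \<Rightarrow> (gkind \<times> nat \<times> nat) list" where
  "ladder_gates L = (ZERO, 0, 0) # (ONE, 0, 0) # decrement_gates L 1 (Suc L) (L + 3)"

definition ladder_outs :: "nat \<Rightarrow> nat list" where
  "ladder_outs L = (let nonzero = nonzero_wire L (Suc L) (L + 3); pred = decrement_outs L (L + 3)
     in [nonzero, nonzero, Suc L] @ (Suc L # pred) @ ((L + 2) # pred))"

definition ladder :: "nat \<Rightarrow> circuit" where
  "ladder L = (Suc L, ladder_gates L, ladder_outs L)"

definition ladder_size :: "nat \<Rightarrow> nat" where
  "ladder_size L = 2 ^ Suc L"

definition ladder_target :: "nat \<Rightarrow> nat" where
  "ladder_target L = ladder_size L - 1"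

definition level_below :: "nat \<Rightarrow> nat \<Rightarrow> nat" where
  "level_below L i = (if i div 2 = 0 then 2 ^ L - 1 else i div 2 - 1)"

lemma ladder_out:
  assumes "i < ladder_size L"
  shows "D_out (ladder L) i = [i div 2 \<noteq> 0, i div 2 \<noteq> 0, False]
    @ (False # decrement_bits False (nat_to_bits L (i div 2)))
    @ (True # decrement_bits False (nat_to_bits L (i div 2)))"
proof -
  let ?bs = "nat_to_bits L (i div 2)"
  define w where "w = (odd i # ?bs) @ [False, True]"
  have w: "length w = L + 3" "w ! Suc L = False" "w ! (L + 2) = True"
    "\<And>q. q < length ?bs \<Longrightarrow> w ! (1 + q) = ?bs ! q"
    by (simp_all add: w_def nth_append)
  then obtain vs where vs: "foldl eval_gate w (decrement_gates L 1 (Suc L) (L + 3)) = w @ vs"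
    "map ((!) (w @ vs)) (decrement_outs L (L + 3)) = decrement_bits False ?bs"
    "(w @ vs) ! nonzero_wire L (Suc L) (L + 3) = (True \<in> set ?bs)"
    using decrement_gates_eval[of 1 ?bs w "Suc L"] by auto
  have "i div 2 < 2 ^ L" using assms by (auto simp: ladder_size_def)
  then have nonzero: "True \<in> set ?bs \<longleftrightarrow> i div 2 \<noteq> 0"
    using bits_to_nat_eq_0_iff[of ?bs] bits_to_nat_to_bits[of "i div 2" L] by simp
  have "foldl eval_gate (nat_to_bits (Suc L) i) (ladder_gates L) = w @ vs"
    using vs(1) by (simp add: ladder_gates_def nat_to_bits_Suc eval_gate_def gate_val_def w_def)
  then have "D_out (ladder L) i = map ((!) (w @ vs)) (ladder_outs L)"
    by (simp add: D_out_def circuit_eval_def ladder_def eval_gate_def)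
  also have "\<dots> = [i div 2 \<noteq> 0, i div 2 \<noteq> 0, False]
      @ (False # decrement_bits False ?bs) @ (True # decrement_bits False ?bs)"
    using vs(2,3) w(1-3) nonzero by (simp add: ladder_outs_def Let_def nth_append)
  finally show ?thesis .
qed

lemma ladder_gate:
  assumes "i < ladder_size L"
  shows "D_code (ladder L) i \<le> 4"
    and "kind_of_code (D_code (ladder L) i) = (if i div 2 = 0 then ZERO else OR)"
    and "D_in1 (ladder L) i = 2 * level_below L i" "D_in2 (ladder L) i = 2 * level_below L i + 1"
proof -
  let ?pred = "decrement_bits False (nat_to_bits L (i div 2))"
  have "i div 2 < 2 ^ L" using assms by (auto simp: ladder_size_def)
  then have pred: "bits_to_nat ?pred = level_below L i"
    by (simp add: bits_to_nat_decrement bits_to_nat_to_bits level_below_def)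
  note out = ladder_out[OF assms]
  have parts: "take l (drop j (us @ vs @ ws)) = vs" "drop (j + l) (us @ vs @ ws) = ws"
    if "length us = j" "length vs = l" for j l and us vs ws :: "bool list" using that by auto
  show "D_code (ladder L) i \<le> 4"
    "kind_of_code (D_code (ladder L) i) = (if i div 2 = 0 then ZERO else OR)"
    unfolding D_code_def out by (simp_all add: bits_to_nat_Cons kind_of_code_def)
  show "D_in1 (ladder L) i = 2 * level_below L i" "D_in2 (ladder L) i = 2 * level_below L i + 1"
    using parts[of "[i div 2 \<noteq> 0, i div 2 \<noteq> 0, False]" 3 "False # ?pred" "Suc L" "True # ?pred"]
    unfolding D_in1_def D_in2_def out by (simp_all add: ladder_def bits_to_nat_Cons pred)
qed

lemma scv_wf_ladder:
  assumes "1 \<le> L"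
  shows "scv_wf (ladder_size L, ladder L, ladder_target L)"
proof -
  have "gates_wf (Suc L) (ladder_gates L)"
    using decrement_gates_wf[of 1 L "L + 3" "Suc L"]
    by (simp add: ladder_gates_def gates_wf_Cons numeral_3_eq_3)
  moreover have "v < Suc L + length (ladder_gates L)" if "v \<in> set (ladder_outs L)" for v
    using that decrement_outs_less[of v L "L + 3"] nonzero_wire_less[of "Suc L" "L + 3" L]
    by (auto simp: ladder_outs_def ladder_gates_def Let_def)
  ultimately have "circuit_wf (ladder L)" unfolding circuit_wf_def ladder_def gates_wf_def by simp
  moreover have "D_code (ladder L) i \<le> 4 \<and>
      (kind_of_code (D_code (ladder L) i) \<in> {AND, OR, NOT} \<longrightarrow> D_in1 (ladder L) i < i) \<and>
      (kind_of_code (D_code (ladder L) i) \<in> {AND, OR} \<longrightarrow> D_in2 (ladder L) i < i)"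
      if "i < ladder_size L" for i
    using ladder_gate[OF that] by (auto simp: level_below_def)
  ultimately show ?thesis
    by (simp add: scv_wf_def ladder_def ladder_outs_def Let_def ladder_size_def ladder_target_def)
qed

locale or_ladder =
  fixes L :: nat
  assumes L_pos: "1 \<le> L"
begin

sublocale succinct_circuit "ladder_size L" "Suc L" "ladder_gates L" "ladder_outs L"
  "ladder_target L"
  by unfold_locales (use scv_wf_ladder[OF L_pos] in \<open>simp add: ladder_def\<close>)

lemma gate_simps:
  assumes "i < ladder_size L"
  shows "kind i = (if i div 2 = 0 then ZERO else OR)" "D_in1 D i = 2 * level_below L i"
    "D_in2 D i = 2 * level_below L i + 1"
  using ladder_gate[OF assms] unfolding kind_def ladder_def by auto

lemma gate_value_False: "i < ladder_size L \<Longrightarrow> \<not> gate_value D i"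
proof (induction i rule: less_induct)
  case (less i)
  show ?case
  proof (cases "i div 2 = 0")
    case True
    then show ?thesis
      using gate_value_rec[OF less.prems] gate_simps(1)[OF less.prems] by (simp add: gate_val_def)
  next
    case False
    then have "2 * level_below L i < i" "2 * level_below L i + 1 < i"
      by (auto simp: level_below_def)
    then show ?thesis
      using gate_value_rec[OF less.prems] gate_simps[OF less.prems] False less
      by (simp add: gate_val_def)
  qed
qed

lemma enc_in_SCV_no: "enc \<in> SCV_no"
proof -
  have "\<not> scv_value (ladder_size L, D, ladder_target L)"
    unfolding scv_value_eq by (rule gate_value_False[OF target_less])
  then show ?thesis unfolding SCV_no_def enc_def using wf by blast
qed

definition top_level :: nat where "top_level = 2 ^ L - 1"

lemma size_eq: "ladder_size L = 2 * top_level + 2"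
  and target_eq: "ladder_target L = 2 * top_level + 1"
proof -
  obtain e where "(2 :: nat) ^ L = Suc e" by (cases "(2 :: nat) ^ L") auto
  then show "ladder_size L = 2 * top_level + 2" "ladder_target L = 2 * top_level + 1"
    by (simp_all add: top_level_def ladder_size_def ladder_target_def)
qed

definition bob_one :: "nat \<Rightarrow> real" where
  "bob_one j = (if j \<le> 2 * top_level + 1 then (1 / 2) ^ (top_level - j div 2) else 0)"

definition is_or :: "nat \<Rightarrow> bool" where
  "is_or i \<longleftrightarrow> i \<le> 2 * top_level + 1 \<and> i div 2 \<noteq> 0"

definition alice_bits :: "nat \<Rightarrow> bool \<times> bool \<Rightarrow> real" where
  "alice_bits i ab = (let p = bob_one (2 * level_below L i) in
     if is_or i then (if ab = (True, True) then 0 else if ab = (False, False) then 1 - 2 * p else p)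
     else of_bool (ab = (True, True)))"

definition link :: "nat \<Rightarrow> nat \<Rightarrow> (bool \<times> bool \<Rightarrow> bool) option" where
  "link i j = (if \<not> is_or i then None else if j = i then Some (\<lambda>(a, b). a \<or> b)
     else if j = 2 * level_below L i then Some fst
     else if j = 2 * level_below L i + 1 then Some snd else None)"

lemma bob_one_bounds: "0 \<le> bob_one j" "bob_one j \<le> 1"
  by (simp_all add: bob_one_def power_le_one)

lemma bob_one_below:
  assumes "is_or i"
  shows "bob_one (2 * level_below L i + 1) = bob_one (2 * level_below L i)"
    "2 * bob_one (2 * level_below L i) = bob_one i"
proof -
  have "top_level - level_below L i = Suc (top_level - i div 2)"
    using assms by (auto simp: is_or_def level_below_def)
  then show "2 * bob_one (2 * level_below L i) = bob_one i"
    "bob_one (2 * level_below L i + 1) = bob_one (2 * level_below L i)"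
    using assms by (auto simp: bob_one_def is_or_def level_below_def)
qed

lemma sum_bool_pairs:
  "(\<Sum>ab\<in>UNIV. h ab) = h (True, True) + h (True, False) + h (False, True) + h (False, False)"
  for h :: "bool \<times> bool \<Rightarrow> real"
  by (simp add: UNIV_Times_UNIV[symmetric] UNIV_bool sum.cartesian_product[symmetric]
      del: UNIV_Times_UNIV)

lemma alice_bits_nonneg: "0 \<le> alice_bits i ab"
  using bob_one_below(2)[of i] bob_one_bounds[of i] bob_one_bounds[of "2 * level_below L i"]
  by (simp add: alice_bits_def Let_def)

lemma sum_alice_bits: "(\<Sum>ab\<in>UNIV. alice_bits i ab) = 1"
  by (simp add: sum_bool_pairs alice_bits_def Let_def)

lemma sum_alice_bits_link:
  assumes "link i j = Some f"
  shows "(\<Sum>ab\<in>UNIV. alice_bits i ab * of_bool (f ab)) = bob_one j"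
proof -
  have "is_or i" using assms by (auto simp: link_def split: if_splits)
  then show ?thesis
    using assms bob_one_below[of i]
    by (auto simp: link_def sum_bool_pairs alice_bits_def Let_def split: if_splits)
qed

definition caught_weight :: "nat \<Rightarrow> nat \<Rightarrow> bool \<times> bool \<Rightarrow> bool \<Rightarrow> real" where
  "caught_weight i j ab c = linked alice_bits bob_one link i j ab c *
     of_bool (caught (ladder_size L) (ladder_target L) (kind i) (D_in1 D i) (D_in2 D i)
        i j (fst ab) (snd ab) c)"

lemma caught_weight_zero_gate:
  assumes "i < ladder_size L" "i div 2 = 0"
  shows "caught_weight i j ab c \<le> of_bool (fst ab \<and> snd ab \<and> c) * (1 / 2) ^ top_level"
proof (cases "ab = (True, True)")
  case True
  have linked: "linked alice_bits bob_one link i j ab c = (if c then bob_one j else 1 - bob_one j)"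
    using assms(2) True by (simp add: linked_def alice_bits_def link_def is_or_def)
  have below: "level_below L i = top_level"
    using assms(2) by (simp add: level_below_def top_level_def)
  have i: "i \<le> 2 * top_level + 1" using assms(1) size_eq by simp
  show ?thesis
  proof (cases c)
    case c: True
    show ?thesis unfolding caught_weight_def linked
      using True c assms i by (auto simp: caught_def gate_simps gate_val_def bob_one_def)
  next
    case False
    then show ?thesis unfolding caught_weight_def linked
      using True assms size_eq target_eq
      by (auto simp: caught_def gate_simps gate_val_def below bob_one_def)
  qed
next
  case False
  then show ?thesis
    using assms(2) by (auto simp: caught_weight_def linked_def alice_bits_def is_or_def)
qed

lemma caught_weight_or_gate:
  assumes "i < ladder_size L" "i div 2 \<noteq> 0"
  shows "caught_weight i j ab c = 0"
proof (rule ccontr)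
  obtain a b where ab: "ab = (a, b)" by fastforce
  assume "\<not> ?thesis"
  then have supported: "linked alice_bits bob_one link i j (a, b) c \<noteq> 0"
    and caught: "caught (ladder_size L) (ladder_target L) (kind i) (D_in1 D i) (D_in2 D i)
      i j a b c"
    by (auto simp: caught_weight_def ab)
  have or: "is_or i" using assms size_eq target_eq by (simp add: is_or_def)
  have i_neq: "i \<noteq> 2 * level_below L i" "i \<noteq> 2 * level_below L i + 1"
    using assms(2) by (auto simp: level_below_def)
  have below_less: "2 * level_below L i + 1 < 2 * top_level + 1"
    using or by (auto simp: is_or_def level_below_def)
  have last: "bob_one (2 * top_level + 1) = 1" by (simp add: bob_one_def)
  consider "j = i" | "j = 2 * level_below L i" | "j = 2 * level_below L i + 1"
    | "j \<noteq> i" "j \<noteq> 2 * level_below L i" "j \<noteq> 2 * level_below L i + 1" by blast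
  then show False
  proof cases
    assume "j = i"
    then have support: "c = (a \<or> b)" "alice_bits i (a, b) \<noteq> 0"
      using supported or by (auto simp: linked_def link_def)
    then have "i = 2 * top_level + 1" "\<not> a" "\<not> b"
      using caught \<open>j = i\<close> assms size_eq target_eq i_neq
      by (auto simp: caught_def gate_simps gate_val_def)
    then show False using support(2) or bob_one_below(2)[OF or] last by (simp add: alice_bits_def)
  next
    assume "j = 2 * level_below L i"
    then show False using supported caught or assms size_eq target_eq i_neq below_less
      by (auto simp: linked_def link_def caught_def gate_simps)
  next
    assume "j = 2 * level_below L i + 1"
    then show False using supported caught or assms size_eq target_eq i_neq below_less
      by (auto simp: linked_def link_def caught_def gate_simps)
  next
    assume "j \<noteq> i" "j \<noteq> 2 * level_below L i" "j \<noteq> 2 * level_below L i + 1"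
    then show False using supported caught or assms size_eq target_eq last
      by (auto simp: linked_def link_def caught_def gate_simps)
  qed
qed

lemma sum_caught_weight_le:
  assumes "i < ladder_size L"
  shows "(\<Sum>ab\<in>UNIV. \<Sum>c\<in>UNIV. caught_weight i j ab c) \<le> (1 / 2) ^ top_level"
proof (cases "i div 2 = 0")
  case True
  have "(\<Sum>ab\<in>UNIV. \<Sum>c\<in>UNIV. caught_weight i j ab c)
      \<le> (\<Sum>ab\<in>UNIV. \<Sum>c\<in>UNIV. of_bool (fst ab \<and> snd ab \<and> c) * (1 / 2) ^ top_level)"
    by (intro sum_mono caught_weight_zero_gate[OF assms True])
  then show ?thesis by (simp add: sum_bool_pairs UNIV_bool)
next
  case False
  then show ?thesis using caught_weight_or_gate[OF assms] by simp
qed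

theorem cheating_strategy_exists:
  "\<exists>P. no_signaling scv_verifier enc P \<and> 1 - (1 / 2) ^ top_level \<le> accept_prob scv_verifier enc P"
proof -
  let ?n = "length enc"
  define f :: "bool list \<Rightarrow> bool \<times> bool \<Rightarrow> bool list"
    where "f s ab = fst ab # snd ab # replicate (?n - 2) False" for s ab
  define g :: "bool list \<Rightarrow> bool \<Rightarrow> bool list" where "g t c = c # replicate (?n - 1) False" for t c
  define q where "q s t = linked alice_bits bob_one link (bits_to_nat s) (bits_to_nat t)" for s t
  let ?P = "encoded_strategy f g q"
  have fg: "f s ab \<in> answers scv_verifier enc" "g t c \<in> answers scv_verifier enc" for s t ab c
    using length_enc_ge by (simp_all add: f_def g_def answers_def)
  have alice: "(\<Sum>c\<in>UNIV. q s t ab c) = alice_bits (bits_to_nat s) ab" for s t ab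
    unfolding q_def by (rule sum_bob_linked)
  have bob: "(\<Sum>ab\<in>UNIV. q s t ab c)
      = (if c then bob_one (bits_to_nat t) else 1 - bob_one (bits_to_nat t))" for s t c
    unfolding q_def by (intro sum_alice_linked sum_alice_bits sum_alice_bits_link)
  have ns: "no_signaling scv_verifier enc ?P"
  proof (rule no_signaling_encoded_strategy[OF fg])
    show "0 \<le> q s t ab c" for s t ab c
      unfolding q_def by (intro linked_nonneg alice_bits_nonneg bob_one_bounds)
  qed (simp_all add: alice bob sum_alice_bits)
  have "rejection_prob scv_verifier enc ?P r \<le> (1 / 2) ^ top_level" for r
  proof (cases "length (first_token r) = Suc L
      \<and> length (first_token ((drop_token ^^ 2) r)) = length (ladder_gates L)")
    case True
    let ?i = "bits_to_nat (first_token r)" and ?j = "bits_to_nat (first_token (drop_token r))"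
    have "?i < ladder_size L"
      using bits_to_nat_less[of "first_token r"] True by (simp add: ladder_size_def)
    moreover have "rejection_prob scv_verifier enc ?P r
        = (\<Sum>ab\<in>UNIV. \<Sum>c\<in>UNIV. caught_weight ?i ?j ab c)"
      unfolding rejection_prob_def event_prob_encoded_strategy[OF fg] caught_weight_def q_def
      using True
      by (intro sum.cong refl) (simp add: accepts_enc_iff exposed_def f_def g_def number_at_def)
    ultimately show ?thesis using sum_caught_weight_le[of ?i ?j] by simp
  next
    case False
    then have "accepts enc r y z" for y z by (auto simp: accepts_enc_iff)
    then show ?thesis by (simp add: rejection_prob_def event_prob_def)
  qed
  then have "1 - (1 / 2) ^ top_level \<le> accept_prob scv_verifier enc ?P"
    by (rule accept_prob_ge[OF ns])
  with ns show ?thesis by blast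
qed

end

lemma length_enc_tuple_le:
  "(\<And>w. w \<in> set ws \<Longrightarrow> length w \<le> l) \<Longrightarrow> length (enc_tuple ws) \<le> length ws * (2 * l + 2)"
proof (induction ws)
  case (Cons w ws)
  then have "length w \<le> l" "length (enc_tuple ws) \<le> length ws * (2 * l + 2)" by auto
  then show ?case by (simp add: enc_tuple_Cons)
qed simp

lemma gate_numbers_less:
  assumes "gates_wf m gs" "v \<in> set (concat (map gate_numbers gs))"
  shows "v < 5 + m + length gs"
proof -
  obtain j g a b where j: "j < length gs" "gs ! j = (g, a, b)" "v \<in> {code_of_kind g, a, b}"
    using assms(2) by (auto simp: gate_numbers_def in_set_conv_nth)
  have "a < m + j" "b < m + j" using assms(1) j(1,2) by (auto simp: gates_wf_def)
  moreover have "code_of_kind g < 5" by (cases g) (auto simp: code_of_kind_def)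
  ultimately show ?thesis using j(1,3) by auto
qed

context or_ladder
begin

lemma length_enc_le: "length enc \<le> 300 * (Suc L)\<^sup>2"
proof -
  let ?ns = "[ladder_size L, ladder_target L, Suc L, length (ladder_gates L)]
      @ concat (map gate_numbers (ladder_gates L)) @ ladder_outs L"
  have gates: "length (ladder_gates L) = 4 * L + 2" by (simp add: ladder_gates_def)
  have "length (nat_bits v) \<le> 5 * Suc L + 3" if v: "v \<in> set ?ns" for v
  proof (cases "v \<le> 5 * Suc L + 3")
    case True
    then show ?thesis using length_nat_bits[of v v] by simp
  next
    case False
    have "v \<in> {ladder_size L, ladder_target L}"
      using v False gates outs_less gate_numbers_less[OF gates_wf, of v] by auto
    then have "v \<le> 2 ^ Suc L" by (auto simp: ladder_size_def ladder_target_def)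
    also have "(2 :: nat) ^ Suc L < 2 ^ (Suc L + 1)" by simp
    finally show ?thesis using length_nat_bits[of v "Suc L + 1"] by simp
  qed
  then have "length enc \<le> length (map nat_bits ?ns) * (2 * (5 * Suc L + 3) + 2)"
    unfolding enc_eq by (intro length_enc_tuple_le) auto
  also have "length (map nat_bits ?ns) = 14 * L + 15"
    using gates length_outs by (simp add: length_gate_numbers)
  also have "(14 * L + 15) * (2 * (5 * Suc L + 3) + 2) \<le> 300 * (Suc L)\<^sup>2"
    by (simp add: power2_eq_square algebra_simps)
  finally show ?thesis .
qed

end

lemma double_exponential_le:
  fixes x :: real
  assumes "0 \<le> x" "x \<le> real l ^ 4"
  shows "(1 / 2) ^ (2 ^ Suc l - 1) \<le> 1 / (2 powr (2 powr (x powr (1 / 4))))"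
proof -
  have "x powr (1 / 4) \<le> (real l ^ 4) powr (1 / 4)" using assms by (intro powr_mono2) auto
  also have "(real l ^ 4) powr (1 / 4) = real l"
  proof (cases "l = 0")
    case False
    then have "(real l ^ 4) powr (1 / 4) = (real l powr real 4) powr (1 / 4)"
      by (subst powr_realpow) simp_all
    also have "\<dots> = real l powr (real 4 * (1 / 4))" by (rule powr_powr)
    finally show ?thesis by simp
  qed simp
  finally have "2 powr (x powr (1 / 4)) \<le> 2 powr real l" by simp
  also have "\<dots> = real (2 ^ l)" by (simp add: powr_realpow)
  also have "\<dots> \<le> real (2 ^ Suc l - 1)" by (simp only: of_nat_le_iff) simp
  finally have "2 powr (2 powr (x powr (1 / 4))) \<le> 2 powr real (2 ^ Suc l - 1)" by simp
  also have "\<dots> = 2 ^ (2 ^ Suc l - 1)" by (rule powr_realpow) simp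
  finally show ?thesis by (simp add: power_one_over frac_le)
qed

lemma ladder_error:
  assumes "30 \<le> L"
  shows "\<exists>x \<in> SCV_no. Suc L \<le> length x \<and> (\<exists>P. no_signaling scv_verifier x P \<and>
     accept_prob scv_verifier x P \<ge> 1 - 1 / (2 powr (2 powr (real (length x) powr (1 / 4)))))"
proof -
  interpret or_ladder L by unfold_locales (use assms in simp)
  obtain l where l: "L = Suc l" "29 \<le> l" using assms by (cases L) auto
  have "18 * (l + 2) \<le> 29 * l" using l(2) by simp
  also have "\<dots> \<le> l\<^sup>2" unfolding power2_eq_square using l(2) by (rule mult_le_mono1)
  finally have "(18 * (l + 2))\<^sup>2 \<le> (l\<^sup>2)\<^sup>2" by (rule power_mono) simp
  then have "300 * (Suc L)\<^sup>2 \<le> l ^ 4"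
    unfolding power_mult_distrib by (simp add: l(1) flip: power_mult)
  then have "length enc \<le> l ^ 4" using length_enc_le by linarith
  then have "real (length enc) \<le> real l ^ 4" by (simp flip: of_nat_power)
  moreover have "top_level = 2 ^ Suc l - 1" using top_level_def by (simp only: l(1))
  ultimately have "(1 / 2) ^ top_level \<le> 1 / (2 powr (2 powr (real (length enc) powr (1 / 4))))"
    by (simp only: double_exponential_le of_nat_0_le_iff)
  moreover obtain P where "no_signaling scv_verifier enc P"
    "1 - (1 / 2) ^ top_level \<le> accept_prob scv_verifier enc P"
    using cheating_strategy_exists by blast
  moreover have "Suc L \<le> length enc" using length_enc_ge by simp
  ultimately show ?thesis using enc_in_SCV_no by (intro bexI[of _ enc] conjI exI[of _ P]) simp_all
qed

theorem theorem2:
  shows "\<exists>p \<in> poly. \<exists>\<alpha>::real. \<alpha> > 0 \<and> (\<exists>V. poly_verifier V \<and>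
     (\<forall>x \<in> SCV_yes. \<exists>P. no_signaling V x P \<and> accept_prob V x P = 1) \<and>
     (\<forall>x \<in> SCV_no. \<forall>P. no_signaling V x P \<longrightarrow>
        accept_prob V x P \<le> 1 - 1 / 2 ^ (2 ^ p (length x))) \<and>
     infinite {x \<in> SCV_no. \<exists>P. no_signaling V x P \<and>
        accept_prob V x P \<ge> 1 - 1 / (2 powr (2 powr (real (length x) powr \<alpha>)))})"
proof (intro bexI[OF _ id_in_poly] exI[of _ "1 / 4"] exI[of _ scv_verifier] conjI ballI allI impI)
  show "poly_verifier scv_verifier" by (rule poly_verifier_scv_verifier)
next
  fix x assume "x \<in> SCV_yes"
  then show "\<exists>P. no_signaling scv_verifier x P \<and> accept_prob scv_verifier x P = 1"
    using SCV_yes_accepted by blast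
next
  fix x P assume "x \<in> SCV_no" "no_signaling scv_verifier x P"
  then show "accept_prob scv_verifier x P \<le> 1 - 1 / 2 ^ (2 ^ length x)"
    by (rule SCV_no_accept_prob_le)
next
  let ?S = "{x \<in> SCV_no. \<exists>P. no_signaling scv_verifier x P \<and>
    accept_prob scv_verifier x P \<ge> 1 - 1 / (2 powr (2 powr (real (length x) powr (1 / 4))))}"
  have "\<exists>x \<in> ?S. l < length x" for l
    using ladder_error[of "max l 30"] by fastforce
  then have "infinite (length ` ?S)"
    unfolding finite_nat_set_iff_bounded_le by (meson image_eqI not_le)
  then show "infinite ?S" by (rule contrapos_nn) (rule finite_imageI)
qed simp

end
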